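(* There are isomorphisms $\pi:\ker\phi_{T^*}\to\mathcal{A}$ and $\pi^*:\ker\phi_T\to\mathcal{A}$ and an automorphism $\alpha$ of $\mathcal{A}_0$ such that the following diagram commutes and has all rows and columns exact: $$\begin{array}{ccccccccc} &&0&&0&&0&&\\ &&\downarrow&&\downarrow&&\downarrow&&\\ 0&\to&\mathcal{A}_0&\xrightarrow{\ \mathrm{id}\ }&\mathcal{A}&\xrightarrow{\ \epsilon_\infty\ }&\mathcal{K}(\ell^2(\mathbb{N}))&\to&0\\ &&\ \ \downarrow{\scriptstyle\alpha}&&\ \ \downarrow{\scriptstyle\pi^{-1}}&&\downarrow&&\\ 0&\to&\mathcal{A}&\xrightarrow{(\pi^* )^{-1}}&\mathbf{c}\times_\tau\mathbb{N}&\xrightarrow{\ \phi_T\ }&\mathcal{T}(\mathbb{Z})&\to&0\\ &&\ \ \downarrow{\scriptstyle\epsilon_\infty}&&\ \ \downarrow{\scriptstyle\phi_{T^*}}&&\ \ \downarrow{\scriptstyle\psi_{T^*}}&&\\ 0&\to&\mathcal{K}(\ell^2(\mathbb{N}))&\to&\mathcal{T}(\mathbb{Z})&\xrightarrow{\ \psi_T\ }&C(\mathbb{T})&\to&0\\ &&\downarrow&&\downarrow&&\downarrow&&\\ &&0&&0&&0&& \end{array}$$ Here $\mathrm{id}:\mathcal{A}_0\to\mathcal{A}$ is the inclusion, $\alpha:\mathcal{A}_0\to\mathcal{A}$ is the automorphism $\alpha$ of $\mathcal{A}_0$ followed by the inclusion $\mathcal{A}_0\subset\mathcal{A}$, $\pi^{-1}$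 and $(\pi^* )^{-1}$ are followed by the inclusions of $\ker\phi_{T^*}$ and $\ker\phi_T$ in $\mathbf{c}\times_\tau\mathbb{N}$, and the maps $\mathcal{K}(\ell^2(\mathbb{N}))\to\mathcal{T}(\mathbb{Z})$ are inclusions.
   Context: $\mathbb{N}$ contains $0$. $\mathbf{c}$ is the $C^*$-algebra of convergent complex sequences indexed by $\mathbb{N}$, and $\tau:\mathbb{N}\to\operatorname{End}\mathbf{c}$ is the action generated by $\tau_1(x_0,x_1,x_2,\dots)=(0,x_0,x_1,x_2,\dots)$. A covariant partial-isometric representation of $(\mathbf{c},\mathbb{N},\tau)$ on $H$ is a pair $(\rho,V)$ of a non-degenerate representation $\rho:\mathbf{c}\to B(H)$ and a map $V:\mathbb{N}\to B(H)$ into partial isometries with $V_mV_n=V_{m+n}$, such that $\rho(\tau_n(a))=V_n\rho(a)V_n^*$ and $V_n^*V_n\rho(a)=\rho(a)V_n^*V_n$. The crossed product $\mathbf{c}\times_\tau\mathbb{N}$ is the $C^*$-algebra generated by a universal covariant partial-isometric representation $(i_{\mathbf{c}},i_{\mathbb{N}})$; it is generated by $i_{\mathbb{N}}(1)$, and is the universal (unital) $C^*$-algebra generated by a power partial isometry (an element all of whose powers are partial isometries). $T$ is the unilateral shift on $\ell^2(\mathbb{N})$ (with orthonormal basis $\{e_i:i\in\mathbb{N}\}$), $\mathcal{T}(\mathbb{Z})=C^*(T)$, and $\phi_T,\phi_{T^*}:\mathbf{c}\times_\tau\mathbb{N}\to\mathcal{T}(\mathbb{Z})$ are the unital homomorphisms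 with $\phi_T(i_{\mathbb{N}}(1))=T$ and $\phi_{T^*}(i_{\mathbb{N}}(1))=T^*$. $\psi_T,\psi_{T^*}:\mathcal{T}(\mathbb{Z})\to C(\mathbb{T})$ are the homomorphisms carrying $T$ to $z\mapsto z$ and to $z\mapsto\bar z$ respectively. Let $P_n=1-T^{n+1}(T^* )^{n+1}$, the projection onto $\operatorname{span}\{e_i:0\le i\le n\}$, and $$\mathcal{A}=\{f:\mathbb{N}\to\mathcal{K}(\ell^2(\mathbb{N})):f(n)\in P_n\mathcal{K}(\ell^2(\mathbb{N}))P_n\text{ for all }n\text{, and }\epsilon_\infty(f):=\lim_{n\to\infty}f(n)\text{ exists in norm}\},$$ a $C^*$-algebra under pointwise operations and supremum norm, and $\mathcal{A}_0=\{f\in\mathcal{A}:\epsilon_\infty(f)=0\}$. *)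

theory Defs
  imports "HOL-Analysis.Analysis" "HOL-Library.Function_Algebras"
begin

section \<open>Complex star algebras\<close>

class scaleC =
  fixes scaleC :: "complex \<Rightarrow> 'a \<Rightarrow> 'a"  (infixr \<open>*\<^sub>C\<close> 75)

class complex_vector = scaleC + ab_group_add +
  assumes scaleC_add_right: "a *\<^sub>C (x + y) = a *\<^sub>C x + a *\<^sub>C y"
    and scaleC_add_left: "(a + b) *\<^sub>C x = a *\<^sub>C x + b *\<^sub>C x"
    and scaleC_scaleC: "a *\<^sub>C b *\<^sub>C x = (a * b) *\<^sub>C x"
    and scaleC_one: "1 *\<^sub>C x = x"

class star =
  fixes star :: "'a \<Rightarrow> 'a"

class complex_star_algebra = ring + complex_vector + star +
  assumes mult_scaleC_left: "(c *\<^sub>C x) * y = c *\<^sub>C (x * y)"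
    and mult_scaleC_right: "x * (c *\<^sub>C y) = c *\<^sub>C (x * y)"
    and star_star: "star (star x) = x"
    and star_add: "star (x + y) = star x + star y"
    and star_mult: "star (x * y) = star y * star x"
    and star_scaleC: "star (c *\<^sub>C x) = cnj c *\<^sub>C star x"

instantiation complex :: complex_star_algebra
begin
definition scaleC_complex :: "complex \<Rightarrow> complex \<Rightarrow> complex" where "scaleC_complex c x = c * x"
definition star_complex :: "complex \<Rightarrow> complex" where "star_complex = cnj"
instance
  by standard (simp_all add: scaleC_complex_def star_complex_def algebra_simps)
end

text \<open>Functions into a star algebra carry the pointwise operations (those of the ring are in
  \<^theory>\<open>HOL-Library.Function_Algebras\<close>).\<close>

instantiation "fun" :: (type, scaleC) scaleC
begin
definition scaleC_fun :: "complex \<Rightarrow> ('a \<Rightarrow> 'b) \<Rightarrow> 'a \<Rightarrow> 'b" where "scaleC_fun c f = (\<lambda>x. c *\<^sub>C f x)"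
instance ..
end

instantiation "fun" :: (type, star) star
begin
definition star_fun :: "('a \<Rightarrow> 'b) \<Rightarrow> 'a \<Rightarrow> 'b" where "star_fun f = (\<lambda>x. star (f x))"
instance ..
end

instance "fun" :: (type, complex_vector) complex_vector
  by standard
    (simp_all add: scaleC_fun_def fun_eq_iff scaleC_add_right scaleC_add_left scaleC_scaleC scaleC_one)

instance "fun" :: (type, complex_star_algebra) complex_star_algebra
  by standard
    (simp_all add: scaleC_fun_def star_fun_def fun_eq_iff mult_scaleC_left mult_scaleC_right
      star_star star_add star_mult star_scaleC)


section \<open>Complex Hilbert spaces\<close>

text \<open>The inner product \<open>cinner\<close> is conjugate-linear in its first argument. Norm, metric and
  topology are those of the real inner product \<open>Re (cinner x y)\<close>.\<close>

class complex_hilbert = complex_vector + real_inner + complete_space +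
  fixes cinner :: "'a \<Rightarrow> 'a \<Rightarrow> complex"
  assumes scaleR_scaleC: "r *\<^sub>R x = complex_of_real r *\<^sub>C x"
    and cinner_commute: "cinner x y = cnj (cinner y x)"
    and cinner_add_right: "cinner x (y + z) = cinner x y + cinner x z"
    and cinner_scaleC_right: "cinner x (c *\<^sub>C y) = c * cinner x y"
    and inner_eq_Re_cinner: "inner x y = Re (cinner x y)"

lemma cinner_add_left: "cinner (x + y) z = cinner x z + cinner y z"
  for x y z :: "'a::complex_hilbert"
  by (metis cinner_add_right cinner_commute complex_cnj_add)

lemma cinner_scaleC_left: "cinner (c *\<^sub>C x) y = cnj c * cinner x y"
  for x y :: "'a::complex_hilbert"
  by (metis cinner_commute cinner_scaleC_right complex_cnj_mult)

lemma cinner_self: "cinner x x = complex_of_real ((norm x)\<^sup>2)"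
  for x :: "'a::complex_hilbert"
proof -
  have "Im (cinner x x) = 0"
    using arg_cong[OF cinner_commute[of x x], of Im] by simp
  moreover have "Re (cinner x x) = (norm x)\<^sup>2"
    by (metis inner_eq_Re_cinner power2_norm_eq_inner)
  ultimately show ?thesis
    by (simp add: complex_eq_iff)
qed

lemma Im_cinner: "Im (cinner x y) = - inner x (\<i> *\<^sub>C y)"
  for x y :: "'a::complex_hilbert"
  by (simp add: inner_eq_Re_cinner cinner_scaleC_right)

lemma norm_scaleC: "norm (c *\<^sub>C x) = cmod c * norm x"
  for x :: "'a::complex_hilbert"
proof -
  have "complex_of_real ((norm (c *\<^sub>C x))\<^sup>2) = cnj c * (c * complex_of_real ((norm x)\<^sup>2))"
    by (simp only: cinner_self[symmetric] cinner_scaleC_left cinner_scaleC_right mult.left_commute)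
  also have "\<dots> = complex_of_real ((cmod c * norm x)\<^sup>2)"
    using complex_norm_square[of c] by (simp add: power_mult_distrib mult_ac)
  finally have "(norm (c *\<^sub>C x))\<^sup>2 = (cmod c * norm x)\<^sup>2"
    using of_real_eq_iff by blast
  then show ?thesis by simp
qed

lemma scaleC_zero_right: "c *\<^sub>C (0::'a::complex_vector) = 0"
  using scaleC_add_right[of c 0 "0::'a"] by simp

lemma scaleC_minus_right: "c *\<^sub>C (- x) = - (c *\<^sub>C x)" for x :: "'a::complex_vector"
  using scaleC_add_right[of c x "- x"] by (simp add: scaleC_zero_right add_eq_0_iff)

lemma scaleC_diff_right: "c *\<^sub>C (x - y) = c *\<^sub>C x - c *\<^sub>C y" for x y :: "'a::complex_vector"
  using scaleC_add_right[of c x "- y"] by (simp add: scaleC_minus_right)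

lemma bounded_linear_scaleC_right: "bounded_linear (\<lambda>x::'a::complex_hilbert. c *\<^sub>C x)"
proof
  show "c *\<^sub>C (r *\<^sub>R x) = r *\<^sub>R c *\<^sub>C x" for r and x :: 'a
    by (simp add: scaleR_scaleC scaleC_scaleC mult.commute)
  show "\<exists>K. \<forall>x::'a. norm (c *\<^sub>C x) \<le> norm x * K"
    by (rule exI[of _ "cmod c"]) (simp add: norm_scaleC mult.commute)
qed (simp add: scaleC_add_right)

lemma riesz_real:
  fixes g :: "'a::{real_inner,complete_space} \<Rightarrow> real"
  assumes "bounded_linear g"
  shows "\<exists>z. \<forall>x. g x = inner z x"
proof -
  interpret g: bounded_linear g by fact
  define q where "q x = (norm x)\<^sup>2 - 2 * g x" for x
  obtain K where K: "\<And>x. \<bar>g x\<bar> \<le> norm x * K"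
    using g.bounded by auto
  have lower: "- K\<^sup>2 \<le> q x" for x
  proof -
    have "0 \<le> (norm x - K)\<^sup>2" by simp
    with K[of x] show ?thesis
      by (simp add: q_def power2_diff abs_le_iff)
  qed
  define m where "m = (INF x. q x)"
  have bdd: "bdd_below (range q)"
    using lower by (meson bdd_belowI2)
  have m_le: "m \<le> q x" for x
    unfolding m_def by (rule cINF_lower[OF bdd]) simp
  have "\<exists>x. q x < m + inverse (real (Suc n))" for n
  proof (rule ccontr)
    assume "\<nexists>x. q x < m + inverse (real (Suc n))"
    then have "m + inverse (real (Suc n)) \<le> m"
      unfolding m_def by (intro cINF_greatest) (auto simp: not_less m_def)
    then show False by simp
  qed
  then obtain X where X: "\<And>n. q (X n) < m + inverse (real (Suc n))"
    by metis
  have para: "(norm (x - y))\<^sup>2 \<le> 2 * (q x - m) + 2 * (q y - m)" for x y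
  proof -
    have "(norm (x - y))\<^sup>2 = 2 * q x + 2 * q y - 4 * q ((1/2) *\<^sub>R (x + y))"
      by (simp add: q_def g.add g.scaleR power2_norm_eq_inner inner_add inner_diff
          inner_commute algebra_simps)
    with m_le[of "(1/2) *\<^sub>R (x + y)"] show ?thesis by simp
  qed
  have "Cauchy X"
  proof (rule CauchyI)
    fix e :: real
    assume "e > 0"
    then obtain N where N: "inverse (real (Suc N)) < e\<^sup>2 / 4"
      using reals_Archimedean[of "e\<^sup>2 / 4"] by auto
    have small: "q (X n) - m < e\<^sup>2 / 4" if "n \<ge> N" for n
    proof -
      have "inverse (real (Suc n)) \<le> inverse (real (Suc N))"
        using that by (intro le_imp_inverse_le) auto
      with X[of n] N show ?thesis by linarith
    qed
    have "norm (X i - X j) < e" if "i \<ge> N" "j \<ge> N" for i j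
    proof -
      have "(norm (X i - X j))\<^sup>2 < e\<^sup>2"
      proof (rule order_le_less_trans[OF para])
        have "2 * (q (X i) - m) + 2 * (q (X j) - m) < 2 * (e\<^sup>2 / 4) + 2 * (e\<^sup>2 / 4)"
          by (intro add_strict_mono mult_strict_left_mono small that) simp_all
        then show "2 * (q (X i) - m) + 2 * (q (X j) - m) < e\<^sup>2" by simp
      qed
      then show ?thesis
        using \<open>e > 0\<close> by (simp add: power2_less_imp_less)
    qed
    then show "\<exists>M. \<forall>i\<ge>M. \<forall>j\<ge>M. norm (X i - X j) < e" by blast
  qed
  then obtain z where z: "X \<longlonglongrightarrow> z"
    using Cauchy_convergent_iff convergent_def by blast
  have "(\<lambda>n. q (X n)) \<longlonglongrightarrow> q z"
    unfolding q_def by (intro tendsto_intros z g.tendsto)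
  moreover have "(\<lambda>n. m + inverse (real (Suc n))) \<longlonglongrightarrow> m + 0"
    by (intro tendsto_intros LIMSEQ_inverse_real_of_nat)
  ultimately have qz: "q z \<le> m"
    using LIMSEQ_le[of "\<lambda>n. q (X n)" "q z" "\<lambda>n. m + inverse (real (Suc n))" m] X
    by (auto intro: less_imp_le)
  have "g y = inner z y" for y
  proof (rule ccontr)
    assume "g y \<noteq> inner z y"
    define d where "d = inner z y - g y"
    define B where "B = (norm y)\<^sup>2 + 1"
    have d: "d \<noteq> 0" and B: "B > 0"
      using \<open>g y \<noteq> inner z y\<close> by (auto simp: d_def B_def add_nonneg_pos)
    have ineq: "0 \<le> 2 * t * d + t\<^sup>2 * (norm y)\<^sup>2" for t
    proof -
      have "q (z + t *\<^sub>R y) = q z + 2 * t * d + t\<^sup>2 * (norm y)\<^sup>2"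
        unfolding q_def d_def g.add g.scaleR power2_norm_eq_inner inner_add
        by (simp add: inner_commute[of y z] algebra_simps power2_eq_square)
      with qz m_le[of "z + t *\<^sub>R y"] show ?thesis by simp
    qed
    have "0 \<le> 2 * (- d / B) * d + (- d / B)\<^sup>2 * (norm y)\<^sup>2"
      by (rule ineq)
    also have "\<dots> \<le> 2 * (- d / B) * d + (- d / B)\<^sup>2 * B"
      by (intro add_left_mono mult_left_mono) (auto simp: B_def)
    also have "\<dots> = - (d\<^sup>2 / B)"
      using B by (simp add: field_simps power2_eq_square)
    also have "\<dots> < 0"
      using d B by simp
    finally show False by simp
  qed
  then show ?thesis by blast
qed


section \<open>Bounded operators on a complex Hilbert space\<close>

typedef (overloaded) 'h cop =
  "{f :: 'h::complex_hilbert \<Rightarrow> 'h. bounded_linear f \<and> (\<forall>c x. f (c *\<^sub>C x) = c *\<^sub>C f x)}"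
  morphisms cop_apply Abs_cop
  by (rule exI[of _ "\<lambda>x. x"]) (simp add: bounded_linear_ident)

setup_lifting type_definition_cop

lemma cop_eqI: "(\<And>x. cop_apply A x = cop_apply B x) \<Longrightarrow> A = B"
  by transfer auto

lemma bounded_linear_cop_apply: "bounded_linear (cop_apply A)"
  by transfer simp

lemma cop_apply_scaleC: "cop_apply A (c *\<^sub>C x) = c *\<^sub>C cop_apply A x"
  by transfer simp

instantiation cop :: (complex_hilbert) real_normed_vector
begin

lift_definition norm_cop :: "'a cop \<Rightarrow> real" is onorm .

lift_definition zero_cop :: "'a cop" is "\<lambda>x. 0"
  by (simp add: scaleC_zero_right)

lift_definition plus_cop :: "'a cop \<Rightarrow> 'a cop \<Rightarrow> 'a cop" is "\<lambda>f g x. f x + g x"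
  by (simp add: scaleC_add_right bounded_linear_add)

lift_definition minus_cop :: "'a cop \<Rightarrow> 'a cop \<Rightarrow> 'a cop" is "\<lambda>f g x. f x - g x"
  by (simp add: scaleC_diff_right bounded_linear_sub)

lift_definition uminus_cop :: "'a cop \<Rightarrow> 'a cop" is "\<lambda>f x. - f x"
  by (simp add: scaleC_minus_right bounded_linear_minus)

lift_definition scaleR_cop :: "real \<Rightarrow> 'a cop \<Rightarrow> 'a cop" is "\<lambda>r f x. r *\<^sub>R f x"
  by (auto simp: scaleR_scaleC scaleC_scaleC mult.commute
      intro: bounded_linear_compose[OF bounded_linear_scaleC_right])

definition dist_cop :: "'a cop \<Rightarrow> 'a cop \<Rightarrow> real" where "dist_cop a b = norm (a - b)"

definition [code del]:
  "(uniformity :: ('a cop \<times> 'a cop) filter) = (INF e\<in>{0 <..}. principal {(x, y). dist x y < e})"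

definition open_cop :: "'a cop set \<Rightarrow> bool"
  where [code del]: "open_cop S = (\<forall>x\<in>S. \<forall>\<^sub>F (x', y) in uniformity. x' = x \<longrightarrow> y \<in> S)"

definition sgn_cop :: "'a cop \<Rightarrow> 'a cop" where "sgn_cop x = inverse (norm x) *\<^sub>R x"

instance
  apply standard
  unfolding dist_cop_def open_cop_def sgn_cop_def uniformity_cop_def
  apply (rule refl | (transfer, force simp: onorm_triangle onorm_scaleR onorm_eq_0 algebra_simps))+
  done

end

instantiation cop :: (complex_hilbert) monoid_mult
begin
lift_definition one_cop :: "'a cop" is "\<lambda>x. x"
  by simp
lift_definition times_cop :: "'a cop \<Rightarrow> 'a cop \<Rightarrow> 'a cop" is "\<lambda>f g x. f (g x)"
  by (simp add: bounded_linear_compose)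
instance
  by standard (transfer, simp)+
end

instance cop :: (complex_hilbert) real_normed_algebra
proof
  fix a b c :: "'a cop" and r :: real
  show "(a + b) * c = a * c + b * c"
    by transfer simp
  show "a * (b + c) = a * b + a * c"
    by transfer (auto simp: linear_simps)
  show "r *\<^sub>R a * b = r *\<^sub>R (a * b)"
    by transfer simp
  show "a * r *\<^sub>R b = r *\<^sub>R (a * b)"
    by transfer (auto simp: linear_simps)
  show "norm (a * b) \<le> norm a * norm b"
    by transfer (use onorm_compose in \<open>auto simp: o_def\<close>)
qed

instantiation cop :: (complex_hilbert) complex_vector
begin
lift_definition scaleC_cop :: "complex \<Rightarrow> 'a cop \<Rightarrow> 'a cop" is "\<lambda>c f x. c *\<^sub>C f x"
  by (auto intro: bounded_linear_compose[OF bounded_linear_scaleC_right]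
      simp: scaleC_scaleC mult.commute)
instance
  by standard
    (transfer, simp add: scaleC_add_right scaleC_add_left scaleC_scaleC scaleC_one)+
end

instantiation cop :: (complex_hilbert) star
begin
definition star_cop :: "'a cop \<Rightarrow> 'a cop" where
  "star_cop A = (THE B. \<forall>x y. cinner (cop_apply B x) y = cinner x (cop_apply A y))"
instance ..
end

lemma cinner_left_eqI: "x = y" if "\<And>z. cinner x z = cinner y z"
  for x y :: "'a::complex_hilbert"
proof -
  have "inner (x - y) z = 0" for z
    using inner_diff_left[of x y z] that[of z] by (simp only: inner_eq_Re_cinner)
  from this[of "x - y"] show ?thesis by simp
qed

lemma adjoint_exists: "\<exists>B. \<forall>x y. cinner (cop_apply B x) y = cinner x (cop_apply A y)"
  for A :: "'a::complex_hilbert cop"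
proof -
  interpret A: bounded_linear "cop_apply A"
    by (rule bounded_linear_cop_apply)
  have "\<exists>z. \<forall>y. inner x (cop_apply A y) = inner z y" for x
    by (intro riesz_real bounded_linear_compose[OF bounded_linear_inner_right] A.bounded_linear_axioms)
  then obtain f where f: "\<And>x y. inner x (cop_apply A y) = inner (f x) y"
    by metis
  have cf: "cinner (f x) y = cinner x (cop_apply A y)" for x y
    using f[of x y] f[of x "\<i> *\<^sub>C y"]
    by (simp add: complex_eq_iff Im_cinner cop_apply_scaleC inner_eq_Re_cinner)
  have fC: "f (c *\<^sub>C x) = c *\<^sub>C f x" for c x
    by (rule cinner_left_eqI) (simp add: cf cinner_scaleC_left)
  have "bounded_linear f"
  proof (rule bounded_linear_intro[of _ "onorm (cop_apply A)"])
    show "f (x + y) = f x + f y" for x y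
      by (rule cinner_left_eqI) (simp add: cf cinner_add_left)
    show "f (r *\<^sub>R x) = r *\<^sub>R f x" for r x
      by (simp add: scaleR_scaleC fC)
    show "norm (f x) \<le> norm x * onorm (cop_apply A)" for x
    proof (cases "f x = 0")
      case False
      have "norm (f x) * norm (f x) = inner x (cop_apply A (f x))"
        by (simp add: f norm_eq_sqrt_inner)
      also have "\<dots> \<le> norm x * norm (cop_apply A (f x))"
        by (rule norm_cauchy_schwarz)
      also have "\<dots> \<le> norm x * (onorm (cop_apply A) * norm (f x))"
        by (intro mult_left_mono onorm A.bounded_linear_axioms) simp
      finally show ?thesis
        using False by (simp add: mult.assoc[symmetric])
    qed (simp add: onorm_pos_le A.bounded_linear_axioms)
  qed
  then have "cop_apply (Abs_cop f) = f"
    by (intro Abs_cop_inverse) (simp add: fC)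
  with cf show ?thesis
    by (intro exI[of _ "Abs_cop f"]) simp
qed

lemma adjoint_unique:
  assumes "\<forall>x y. cinner (cop_apply B x) y = cinner x (cop_apply A y)"
    and "\<forall>x y. cinner (cop_apply C x) y = cinner x (cop_apply A y)"
  shows "B = C"
  using assms by (intro cop_eqI cinner_left_eqI) simp

lemma cinner_star_left: "cinner (cop_apply (star A) x) y = cinner x (cop_apply A y)"
proof -
  have "\<exists>!B. \<forall>x y. cinner (cop_apply B x) y = cinner x (cop_apply A y)"
    using adjoint_exists[of A] adjoint_unique[of _ A] by blast
  from theI'[OF this] show ?thesis
    unfolding star_cop_def by blast
qed

lemma cinner_star_right: "cinner x (cop_apply (star A) y) = cinner (cop_apply A x) y"
  by (metis cinner_commute cinner_star_left)

lemma star_eqI: "star A = B" if "\<And>x y. cinner (cop_apply B x) y = cinner x (cop_apply A y)"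
  using that by (intro adjoint_unique[of _ A]) (simp_all add: cinner_star_left)

instance cop :: (complex_hilbert) complex_star_algebra
proof
  fix x y :: "'a cop" and c :: complex
  show "c *\<^sub>C x * y = c *\<^sub>C (x * y)" "x * c *\<^sub>C y = c *\<^sub>C (x * y)"
    by (transfer; simp)+
  show "star (star x) = x"
    by (rule star_eqI) (simp add: cinner_star_right)
  show "star (x + y) = star x + star y"
    by (rule star_eqI)
      (simp add: plus_cop.rep_eq cinner_star_left cinner_add_left cinner_add_right)
  show "star (x * y) = star y * star x"
    by (rule star_eqI) (simp add: times_cop.rep_eq cinner_star_left)
  show "star (c *\<^sub>C x) = cnj c *\<^sub>C star x"
    by (rule star_eqI)
      (simp add: scaleC_cop.rep_eq cinner_star_left cinner_scaleC_left cinner_scaleC_right)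
qed

definition compact_operators :: "'h::complex_hilbert cop set" where
  "compact_operators = {A. compact (closure (cop_apply A ` cball 0 1))}"

definition cstar_subalgebra :: "'h::complex_hilbert cop set \<Rightarrow> bool" where
  "cstar_subalgebra X \<longleftrightarrow> closed X \<and> 0 \<in> X \<and>
    (\<forall>a\<in>X. \<forall>b\<in>X. a + b \<in> X \<and> a * b \<in> X) \<and> (\<forall>c. \<forall>a\<in>X. c *\<^sub>C a \<in> X) \<and> (\<forall>a\<in>X. star a \<in> X)"

definition cstar_generated :: "'h::complex_hilbert cop set \<Rightarrow> 'h cop set" where
  "cstar_generated S = cstar_subalgebra hull S"


section \<open>Homomorphisms and short exact sequences\<close>

text \<open>Algebras are given by their underlying sets, with the operations of the ambient type; maps are
  total functions of which only the values on the domain algebra matter. Star homomorphisms between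
  C*-algebras are automatically contractive, and isomorphisms isometric.\<close>

definition star_hom ::
  "'a::complex_star_algebra set \<Rightarrow> 'b::complex_star_algebra set \<Rightarrow> ('a \<Rightarrow> 'b) \<Rightarrow> bool" where
  "star_hom X Y f \<longleftrightarrow> f ` X \<subseteq> Y \<and>
    (\<forall>a\<in>X. \<forall>b\<in>X. f (a + b) = f a + f b \<and> f (a * b) = f a * f b) \<and>
    (\<forall>c. \<forall>a\<in>X. f (c *\<^sub>C a) = c *\<^sub>C f a) \<and>
    (\<forall>a\<in>X. f (star a) = star (f a))"

definition star_iso ::
  "'a::complex_star_algebra set \<Rightarrow> 'b::complex_star_algebra set \<Rightarrow> ('a \<Rightarrow> 'b) \<Rightarrow> bool" where
  "star_iso X Y f \<longleftrightarrow> star_hom X Y f \<and> bij_betw f X Y"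

definition hom_kernel :: "'a set \<Rightarrow> ('a \<Rightarrow> 'b::zero) \<Rightarrow> 'a set" where
  "hom_kernel X f = {a \<in> X. f a = 0}"

text \<open>Exactness of \<open>0 \<rightarrow> X \<rightarrow> Y \<rightarrow> Z \<rightarrow> 0\<close> with maps \<open>f\<close> and \<open>g\<close>.\<close>

definition short_exact ::
  "'a::complex_star_algebra set \<Rightarrow> 'b::complex_star_algebra set \<Rightarrow> 'c::complex_star_algebra set
    \<Rightarrow> ('a \<Rightarrow> 'b) \<Rightarrow> ('b \<Rightarrow> 'c) \<Rightarrow> bool" where
  "short_exact X Y Z f g \<longleftrightarrow> star_hom X Y f \<and> star_hom Y Z g \<and>
    inj_on f X \<and> f ` X = hom_kernel Y g \<and> g ` Y = Z"


section \<open>The Hilbert space of square-summable sequences and the unilateral shift\<close>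

typedef ell2 = "{x :: nat \<Rightarrow> complex. summable (\<lambda>i. (cmod (x i))\<^sup>2)}"
  morphisms ell2_nth Abs_ell2
  by (rule exI[of _ "\<lambda>_. 0"]) simp

setup_lifting type_definition_ell2

lemma summable_sq_add:
  fixes x y :: "nat \<Rightarrow> complex"
  assumes "summable (\<lambda>i. (cmod (x i))\<^sup>2)" "summable (\<lambda>i. (cmod (y i))\<^sup>2)"
  shows "summable (\<lambda>i. (cmod (x i + y i))\<^sup>2)"
proof (rule summable_comparison_test')
  show "summable (\<lambda>i. 2 * (cmod (x i))\<^sup>2 + 2 * (cmod (y i))\<^sup>2)"
    using assms by (intro summable_add summable_mult)
  fix n :: nat
  have "(cmod (x n + y n))\<^sup>2 \<le> (cmod (x n) + cmod (y n))\<^sup>2"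
    by (intro power_mono norm_triangle_ineq) simp
  also have "\<dots> \<le> 2 * (cmod (x n))\<^sup>2 + 2 * (cmod (y n))\<^sup>2"
    using zero_le_power2[of "cmod (x n) - cmod (y n)"]
    by (simp add: power2_diff power2_sum)
  finally show "norm ((cmod (x n + y n))\<^sup>2) \<le> 2 * (cmod (x n))\<^sup>2 + 2 * (cmod (y n))\<^sup>2"
    by simp
qed

lemma summable_sq_mult:
  fixes x :: "nat \<Rightarrow> complex"
  assumes "summable (\<lambda>i. (cmod (x i))\<^sup>2)"
  shows "summable (\<lambda>i. (cmod (c * x i))\<^sup>2)"
  using summable_mult[OF assms, of "(cmod c)\<^sup>2"] by (simp add: norm_mult power_mult_distrib)

lemma summable_cnj_mult:
  fixes x y :: "nat \<Rightarrow> complex"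
  assumes "summable (\<lambda>i. (cmod (x i))\<^sup>2)" "summable (\<lambda>i. (cmod (y i))\<^sup>2)"
  shows "summable (\<lambda>i. cnj (x i) * y i)"
proof (rule summable_norm_cancel, rule summable_comparison_test')
  show "summable (\<lambda>i. (cmod (x i))\<^sup>2 + (cmod (y i))\<^sup>2)"
    using assms by (intro summable_add)
  fix n :: nat
  show "norm (norm (cnj (x n) * y n)) \<le> (cmod (x n))\<^sup>2 + (cmod (y n))\<^sup>2"
    using zero_le_power2[of "cmod (x n) - cmod (y n)"]
      mult_nonneg_nonneg[of "cmod (x n)" "cmod (y n)"]
    by (simp add: power2_diff norm_mult del: mult_nonneg_nonneg)
qed

lemma summable_ell2: "summable (\<lambda>i. (cmod (ell2_nth x i))\<^sup>2)"
  by transfer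

lemma summable_ell2_cinner: "summable (\<lambda>i. cnj (ell2_nth x i) * ell2_nth y i)"
  by (intro summable_cnj_mult summable_ell2)

instantiation ell2 :: complex_vector
begin

lift_definition zero_ell2 :: ell2 is "\<lambda>_. 0" by simp

lift_definition plus_ell2 :: "ell2 \<Rightarrow> ell2 \<Rightarrow> ell2" is "\<lambda>x y i. x i + y i"
  by (rule summable_sq_add)

lift_definition uminus_ell2 :: "ell2 \<Rightarrow> ell2" is "\<lambda>x i. - x i"
  by simp

lift_definition minus_ell2 :: "ell2 \<Rightarrow> ell2 \<Rightarrow> ell2" is "\<lambda>x y i. x i - y i"
  subgoal for x y using summable_sq_add[of x "\<lambda>i. - y i"] by simp
  done

lift_definition scaleC_ell2 :: "complex \<Rightarrow> ell2 \<Rightarrow> ell2" is "\<lambda>c x i. c * x i"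
  by (rule summable_sq_mult)

instance
  by standard (transfer, simp add: fun_eq_iff algebra_simps)+

end

instantiation ell2 :: real_inner
begin

definition scaleR_ell2 :: "real \<Rightarrow> ell2 \<Rightarrow> ell2" where
  "scaleR_ell2 r x = complex_of_real r *\<^sub>C x"

definition inner_ell2 :: "ell2 \<Rightarrow> ell2 \<Rightarrow> real" where
  "inner_ell2 x y = Re (\<Sum>i. cnj (ell2_nth x i) * ell2_nth y i)"

definition norm_ell2 :: "ell2 \<Rightarrow> real" where "norm_ell2 x = sqrt (inner x x)"

definition dist_ell2 :: "ell2 \<Rightarrow> ell2 \<Rightarrow> real" where "dist_ell2 x y = norm (x - y)"

definition [code del]:
  "(uniformity :: (ell2 \<times> ell2) filter) = (INF e\<in>{0 <..}. principal {(x, y). dist x y < e})"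

definition open_ell2 :: "ell2 set \<Rightarrow> bool"
  where [code del]: "open_ell2 S = (\<forall>x\<in>S. \<forall>\<^sub>F (x', y) in uniformity. x' = x \<longrightarrow> y \<in> S)"

definition sgn_ell2 :: "ell2 \<Rightarrow> ell2" where "sgn_ell2 x = inverse (norm x) *\<^sub>R x"

lemma inner_ell2_sum: "inner x y = (\<Sum>i. Re (cnj (ell2_nth x i) * ell2_nth y i))"
  unfolding inner_ell2_def by (rule Re_suminf[OF summable_ell2_cinner])

lemma inner_self_ell2: "inner x x = (\<Sum>i. (cmod (ell2_nth x i))\<^sup>2)" for x :: ell2
  unfolding inner_ell2_sum by (intro suminf_cong) (simp add: cmod_power2 power2_eq_square[of "Re _"] power2_eq_square[of "Im _"])

instance
proof
  fix x y z :: ell2 and a b r :: real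
  show "a *\<^sub>R (x + y) = a *\<^sub>R x + a *\<^sub>R y" "(a + b) *\<^sub>R x = a *\<^sub>R x + b *\<^sub>R x"
    "a *\<^sub>R b *\<^sub>R x = (a * b) *\<^sub>R x" "1 *\<^sub>R x = x"
    by (simp_all add: scaleR_ell2_def scaleC_add_right scaleC_add_left scaleC_scaleC scaleC_one)
  show "inner x y = inner y x"
    unfolding inner_ell2_sum by (intro suminf_cong) simp
  show "inner (x + y) z = inner x z + inner y z"
    unfolding inner_ell2_def plus_ell2.rep_eq
    by (simp add: distrib_right suminf_add[OF summable_ell2_cinner summable_ell2_cinner, symmetric])
  show "inner (r *\<^sub>R x) y = r * inner x y"
    unfolding inner_ell2_def scaleR_ell2_def scaleC_ell2.rep_eq
    by (simp add: mult.assoc suminf_mult[OF summable_ell2_cinner])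
  show "0 \<le> inner x x"
    unfolding inner_self_ell2 by (intro suminf_nonneg summable_ell2) simp
  show "inner x x = 0 \<longleftrightarrow> x = 0"
    unfolding inner_self_ell2
    by (subst suminf_eq_zero_iff[OF summable_ell2]) (simp, transfer, simp add: fun_eq_iff)
qed (simp_all add: norm_ell2_def dist_ell2_def open_ell2_def sgn_ell2_def uniformity_ell2_def)

end

lemma norm_sq_ell2: "(norm x)\<^sup>2 = (\<Sum>i. (cmod (ell2_nth x i))\<^sup>2)" for x :: ell2
  by (simp add: power2_norm_eq_inner inner_self_ell2)

lemma norm_ell2_nth_le: "cmod (ell2_nth x i) \<le> norm x"
proof -
  have "(\<Sum>j\<in>{i}. (cmod (ell2_nth x j))\<^sup>2) \<le> (norm x)\<^sup>2"
    unfolding norm_sq_ell2 by (intro sum_le_suminf summable_ell2) auto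
  then show ?thesis
    by (intro power2_le_imp_le[OF _ norm_ge_zero]) simp
qed

instance ell2 :: complete_space
proof
  fix X :: "nat \<Rightarrow> ell2"
  assume X: "Cauchy X"
  have coord: "Cauchy (\<lambda>n. ell2_nth (X n) i)" for i
  proof (rule CauchyI)
    fix e :: real
    assume "e > 0"
    from CauchyD[OF X this]
    obtain M where M: "\<And>m n. m \<ge> M \<Longrightarrow> n \<ge> M \<Longrightarrow> norm (X m - X n) < e"
      by blast
    have "norm (ell2_nth (X m) i - ell2_nth (X n) i) < e" if "m \<ge> M" "n \<ge> M" for m n
      using order_le_less_trans[OF norm_ell2_nth_le[of "X m - X n" i] M[OF that]]
      by (simp add: minus_ell2.rep_eq)
    then show "\<exists>M. \<forall>m\<ge>M. \<forall>n\<ge>M. norm (ell2_nth (X m) i - ell2_nth (X n) i) < e"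
      by blast
  qed
  define y where "y i = lim (\<lambda>n. ell2_nth (X n) i)" for i
  have y: "(\<lambda>n. ell2_nth (X n) i) \<longlonglongrightarrow> y i" for i
    unfolding y_def using coord[of i] Cauchy_convergent_iff convergent_LIMSEQ_iff by blast
  have tail: "\<exists>M. \<forall>n\<ge>M. \<forall>k. (\<Sum>i<k. (cmod (ell2_nth (X n) i - y i))\<^sup>2) \<le> e\<^sup>2" if "e > 0" for e
  proof -
    obtain M where M: "\<And>m n. m \<ge> M \<Longrightarrow> n \<ge> M \<Longrightarrow> norm (X m - X n) < e"
      using CauchyD[OF X \<open>e > 0\<close>] by blast
    have "(\<Sum>i<k. (cmod (ell2_nth (X n) i - y i))\<^sup>2) \<le> e\<^sup>2" if "n \<ge> M" for n k
    proof (rule Lim_bounded)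
      show "(\<lambda>m. \<Sum>i<k. (cmod (ell2_nth (X n) i - ell2_nth (X m) i))\<^sup>2)
        \<longlonglongrightarrow> (\<Sum>i<k. (cmod (ell2_nth (X n) i - y i))\<^sup>2)"
        by (intro tendsto_intros y)
      show "\<forall>m\<ge>M. (\<Sum>i<k. (cmod (ell2_nth (X n) i - ell2_nth (X m) i))\<^sup>2) \<le> e\<^sup>2"
      proof (intro allI impI)
        fix m assume "m \<ge> M"
        have "(\<Sum>i<k. (cmod (ell2_nth (X n) i - ell2_nth (X m) i))\<^sup>2) \<le> (norm (X n - X m))\<^sup>2"
          using sum_le_suminf[OF summable_ell2[of "X n - X m"], of "{..<k}"]
          by (simp add: norm_sq_ell2 minus_ell2.rep_eq)
        also have "\<dots> \<le> e\<^sup>2"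
          using M[OF \<open>n \<ge> M\<close> \<open>m \<ge> M\<close>] by (intro power_mono) auto
        finally show "(\<Sum>i<k. (cmod (ell2_nth (X n) i - ell2_nth (X m) i))\<^sup>2) \<le> e\<^sup>2" .
      qed
    qed
    then show ?thesis by blast
  qed
  have diff_sq: "summable (\<lambda>i. (cmod (ell2_nth (X n) i - y i))\<^sup>2) \<and>
      (\<Sum>i. (cmod (ell2_nth (X n) i - y i))\<^sup>2) \<le> e\<^sup>2"
    if "\<forall>k. (\<Sum>i<k. (cmod (ell2_nth (X n) i - y i))\<^sup>2) \<le> e\<^sup>2" for n e
  proof -
    have "summable (\<lambda>i. (cmod (ell2_nth (X n) i - y i))\<^sup>2)"
      using that by (intro summableI_nonneg_bounded[where x = "e\<^sup>2"]) auto
    with that show ?thesis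
      by (auto intro: suminf_le_const)
  qed
  obtain M where "summable (\<lambda>i. (cmod (ell2_nth (X M) i - y i))\<^sup>2)"
    using tail[of 1] diff_sq[of _ 1] by auto
  then have "summable (\<lambda>i. (cmod (y i - ell2_nth (X M) i))\<^sup>2)"
    by (simp add: norm_minus_commute)
  from summable_sq_add[OF this summable_ell2[of "X M"]]
  have "summable (\<lambda>i. (cmod (y i))\<^sup>2)" by simp
  then have Y: "ell2_nth (Abs_ell2 y) = y"
    by (simp add: Abs_ell2_inverse)
  have "X \<longlonglongrightarrow> Abs_ell2 y"
  proof (rule LIMSEQ_I)
    fix r :: real
    assume "r > 0"
    then obtain M where M: "\<forall>n\<ge>M. \<forall>k. (\<Sum>i<k. (cmod (ell2_nth (X n) i - y i))\<^sup>2) \<le> (r / 2)\<^sup>2"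
      using tail[of "r / 2"] by auto
    have "norm (X n - Abs_ell2 y) < r" if "n \<ge> M" for n
    proof -
      have "(norm (X n - Abs_ell2 y))\<^sup>2 \<le> (r / 2)\<^sup>2"
        unfolding norm_sq_ell2 minus_ell2.rep_eq Y using M that diff_sq[of n "r / 2"] by auto
      then have "norm (X n - Abs_ell2 y) \<le> r / 2"
        using \<open>r > 0\<close> by (auto intro: power2_le_imp_le)
      with \<open>r > 0\<close> show ?thesis by simp
    qed
    then show "\<exists>no. \<forall>n\<ge>no. norm (X n - Abs_ell2 y) < r" by blast
  qed
  then show "convergent X"
    by (rule convergentI)
qed

instantiation ell2 :: complex_hilbert
begin
definition cinner_ell2 :: "ell2 \<Rightarrow> ell2 \<Rightarrow> complex" where
  "cinner_ell2 x y = (\<Sum>i. cnj (ell2_nth x i) * ell2_nth y i)"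
instance
proof
  fix x y z :: ell2 and r :: real and c :: complex
  show "r *\<^sub>R x = complex_of_real r *\<^sub>C x"
    by (rule scaleR_ell2_def)
  show "cinner x y = cnj (cinner y x)"
    unfolding cinner_ell2_def
    using bounded_linear.suminf[OF bounded_linear_cnj summable_ell2_cinner[of y x]]
    by (simp add: mult.commute)
  show "cinner x (y + z) = cinner x y + cinner x z"
    unfolding cinner_ell2_def plus_ell2.rep_eq
    by (simp add: distrib_left suminf_add[OF summable_ell2_cinner summable_ell2_cinner, symmetric])
  show "cinner x (c *\<^sub>C y) = c * cinner x y"
    unfolding cinner_ell2_def scaleC_ell2.rep_eq
    by (simp add: mult.left_commute suminf_mult[OF summable_ell2_cinner])
  show "inner x y = Re (cinner x y)"
    unfolding cinner_ell2_def inner_ell2_def ..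
qed
end

lemma summable_sq_shift:
  "summable (\<lambda>i. (cmod (case i of 0 \<Rightarrow> 0 | Suc j \<Rightarrow> x j))\<^sup>2)" if "summable (\<lambda>i. (cmod (x i))\<^sup>2)"
  for x :: "nat \<Rightarrow> complex"
  using that by (subst summable_Suc_iff[symmetric]) simp

lift_definition shift_ell2 :: "ell2 \<Rightarrow> ell2" is "\<lambda>x i. case i of 0 \<Rightarrow> 0 | Suc j \<Rightarrow> x j"
  by (rule summable_sq_shift)

lemma norm_shift_ell2: "norm (shift_ell2 x) = norm x"
proof -
  have "(norm (shift_ell2 x))\<^sup>2 = (norm x)\<^sup>2"
    using suminf_split_head[OF summable_ell2[of "shift_ell2 x"]]
    by (simp add: norm_sq_ell2 shift_ell2.rep_eq)
  then show ?thesis by simp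
qed

lift_definition shift :: "ell2 cop" is shift_ell2
proof (intro conjI allI)
  have C: "shift_ell2 (c *\<^sub>C x) = c *\<^sub>C shift_ell2 x" for c x
    by transfer (auto simp: fun_eq_iff split: nat.splits)
  show "shift_ell2 (c *\<^sub>C x) = c *\<^sub>C shift_ell2 x" for c x
    by (rule C)
  show "bounded_linear shift_ell2"
  proof (rule bounded_linear_intro[of _ 1])
    show "shift_ell2 (x + y) = shift_ell2 x + shift_ell2 y" for x y
      by transfer (auto simp: fun_eq_iff split: nat.splits)
    show "shift_ell2 (r *\<^sub>R x) = r *\<^sub>R shift_ell2 x" for r x
      by (simp add: scaleR_scaleC C)
  qed (simp add: norm_shift_ell2)
qed

definition toeplitz_algebra :: "ell2 cop set" where
  "toeplitz_algebra = cstar_generated {shift}"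

text \<open>\<open>C(\<T>)\<close> consists of the continuous functions on the unit circle, extended by \<open>0\<close> so that
  the zero function and equality of functions are those of the type.\<close>

definition circle_fun :: "(complex \<Rightarrow> complex) \<Rightarrow> complex \<Rightarrow> complex" where
  "circle_fun g = (\<lambda>z. if z \<in> sphere 0 1 then g z else 0)"

definition C_circle :: "(complex \<Rightarrow> complex) set" where
  "C_circle = {f. continuous_on (sphere 0 1) f \<and> (\<forall>z. z \<notin> sphere 0 1 \<longrightarrow> f z = 0)}"


section \<open>The algebra of norm-convergent sequences of compact operators\<close>

definition proj_P :: "nat \<Rightarrow> ell2 cop" where
  "proj_P n = 1 - shift ^ (n + 1) * star shift ^ (n + 1)"

definition alg_A :: "(nat \<Rightarrow> ell2 cop) set" where
  "alg_A = {f. (\<forall>n. f n \<in> {proj_P n * k * proj_P n |k. k \<in> compact_operators}) \<and> convergent f}"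

definition eps_inf :: "(nat \<Rightarrow> ell2 cop) \<Rightarrow> ell2 cop" where
  "eps_inf f = lim f"

definition alg_A0 :: "(nat \<Rightarrow> ell2 cop) set" where
  "alg_A0 = {f \<in> alg_A. eps_inf f = 0}"


section \<open>The partial-isometric crossed product\<close>

definition conv_seqs :: "(nat \<Rightarrow> complex) set" where
  "conv_seqs = {x. convergent x}"

definition tau1 :: "(nat \<Rightarrow> complex) \<Rightarrow> nat \<Rightarrow> complex" where
  "tau1 x = (\<lambda>i. case i of 0 \<Rightarrow> 0 | Suc j \<Rightarrow> x j)"

definition tau :: "nat \<Rightarrow> (nat \<Rightarrow> complex) \<Rightarrow> nat \<Rightarrow> complex" where
  "tau n = tau1 ^^ n"

definition partial_isometry :: "'h::complex_hilbert cop \<Rightarrow> bool" where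
  "partial_isometry v \<longleftrightarrow> v * star v * v = v"

text \<open>In the non-degeneracy condition the real span is also the complex span, since the set of
  vectors \<open>\<rho> a h\<close> is stable under complex scalars.\<close>

definition nondegenerate_rep :: "((nat \<Rightarrow> complex) \<Rightarrow> 'h::complex_hilbert cop) \<Rightarrow> bool" where
  "nondegenerate_rep \<rho> \<longleftrightarrow> star_hom conv_seqs UNIV \<rho> \<and>
    closure (span {cop_apply (\<rho> a) h |a h. a \<in> conv_seqs}) = UNIV"

definition covariant_rep ::
  "((nat \<Rightarrow> complex) \<Rightarrow> 'h::complex_hilbert cop) \<Rightarrow> (nat \<Rightarrow> 'h cop) \<Rightarrow> bool" where
  "covariant_rep \<rho> V \<longleftrightarrow> nondegenerate_rep \<rho> \<and>
    (\<forall>n. partial_isometry (V n)) \<and> (\<forall>m n. V m * V n = V (m + n)) \<and>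
    (\<forall>n. \<forall>a\<in>conv_seqs. \<rho> (tau n a) = V n * \<rho> a * star (V n)) \<and>
    (\<forall>n. \<forall>a\<in>conv_seqs. star (V n) * V n * \<rho> a = \<rho> a * (star (V n) * V n))"

definition covariant_algebra ::
  "((nat \<Rightarrow> complex) \<Rightarrow> 'h::complex_hilbert cop) \<Rightarrow> (nat \<Rightarrow> 'h cop) \<Rightarrow> 'h cop set" where
  "covariant_algebra \<rho> V = cstar_generated (\<rho> ` conv_seqs \<union> range V)"

text \<open>A covariant representation \<open>(\<rho>, V)\<close> on an arbitrary Hilbert space is universal if every
  covariant representation factors through the C*-algebra generated by it; this C*-algebra,
  \<open>covariant_algebra \<rho> V\<close>, is then the crossed product. A formula cannot quantify over the types of
  all Hilbert spaces, so the factorisation is demanded for representations on \<open>\<ell>\<^sup>2(\<nat>)\<close>, which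
  every universal representation in the usual sense satisfies. It is no weaker: the algebra in
  question is separable, so every covariant representation is a direct sum of representations on
  separable spaces, and these have infinite multiples on \<open>\<ell>\<^sup>2(\<nat>)\<close>.\<close>

definition universal_covariant_rep ::
  "((nat \<Rightarrow> complex) \<Rightarrow> 'h::complex_hilbert cop) \<Rightarrow> (nat \<Rightarrow> 'h cop) \<Rightarrow> bool" where
  "universal_covariant_rep i_c i_N \<longleftrightarrow> covariant_rep i_c i_N \<and>
    (\<forall>(\<rho> :: (nat \<Rightarrow> complex) \<Rightarrow> ell2 cop) V. covariant_rep \<rho> V \<longrightarrow>
      (\<exists>\<Lambda>. star_hom (covariant_algebra i_c i_N) UNIV \<Lambda> \<and>
        (\<forall>a\<in>conv_seqs. \<Lambda> (i_c a) = \<rho> a) \<and> (\<forall>n. \<Lambda> (i_N n) = V n)))"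

end

theory Submission
  imports Defs
begin

text \<open>Let \<open>v = i\<^sub>N(1)\<close>, and let \<open>w\<close> be \<open>v\<close> or \<open>v\<^sup>*\<close> and \<open>\<phi>\<close> the homomorphism with \<open>\<phi>(w) = T\<^sup>*\<close>. The map
  \<open>T\<^sup>a T\<^sup>*\<^sup>b \<mapsto> w\<^sup>*\<^sup>a w\<^sup>b\<close> extends to a contractive linear section of \<open>\<phi>\<close>, because \<open>r w\<close> with \<open>r < 1\<close> is the
  restriction of an amplified backward shift to an invariant subspace. Subtracting the section from
  monomials in \<open>w, w\<^sup>*\<close> shows that \<open>ker \<phi>\<close> is the closed span of the elements
  \<open>w\<^sup>i w\<^sup>*\<^sup>m w\<^sup>m (1 - w w\<^sup>*) w\<^sup>*\<^sup>j\<close>. By universality the truncated shifts \<open>P\<^sub>n T\<close> define representations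
  \<open>\<Lambda>\<^sub>n\<close>; these send such an element to the matrix unit \<open>e\<^sub>i\<^sub>j\<close> for \<open>n \<ge> max(m, i, j)\<close> and to \<open>0\<close> for smaller
  \<open>n\<close>, and a Bessel inequality shows that they are jointly isometric on \<open>ker \<phi>\<close>. Hence
  \<open>b \<mapsto> (P\<^sub>n \<Lambda>\<^sub>n(b))\<^sub>n\<close> is an isomorphism of \<open>ker \<phi>\<close> onto \<open>\<A>\<close>, whose limit at infinity is the other
  homomorphism. Both isomorphisms map the intersection of the two kernels onto \<open>\<A>\<^sub>0\<close>, and \<open>\<alpha>\<close> is
  the resulting automorphism \<open>\<pi>\<^sup>* \<pi>\<^sup>-\<^sup>1\<close>. The extension by \<open>C(\<T>)\<close> is treated in the same way, with the
  section \<open>z\<^sup>k \<mapsto> T\<^sup>k, z\<^sup>-\<^sup>k \<mapsto> T\<^sup>*\<^sup>k\<close>, which is contractive by discrete Fourier analysis at roots of unity.\<close>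

section \<open>Operators and star homomorphisms\<close>

text \<open>The representations \<open>\<Lambda> n\<close> must act on all of l^2. Beyond e_n the
  truncated shift is 0, and a sequence acts there as its entry 0, because evaluation at 0 is the
  character that vanishes on every shifted sequence. On this complement 1 -
  \<open>w * star w\<close> becomes the identity, which is why \<open>\<pi>\<close> cuts down by
  \<open>proj_P n\<close>. The index m of the spanning elements records how many powers of
  \<open>w\<close> stay isometric on the range of 1 - \<open>w * star w\<close>. The difference of
  the elements for m = n and m = n + 1 therefore lives in the summand of size n + 1 alone. Every
  passage from a dense subspace to a closed algebra follows one pattern. A section that does not
  increase norms splits the closure of a sum into the sum of the closures, and it turns approximants
  in the quotient into a Cauchy sequence upstairs. The operator estimates are bounds of |<y, A x>|
  by M/2 (|x|^2 + |y|^2), a form that adds up over orthogonal pieces. The relations of a power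
  partial isometry are symmetric in v and its adjoint, so one locale serves both kernels.\<close>

instance complex_hilbert \<subseteq> banach ..

lemma scaleC_zero_left: "0 *\<^sub>C x = 0" for x :: "'a::complex_vector"
  using scaleC_add_left[of 0 0 x] by simp

lemma scaleC_minus1: "(-1) *\<^sub>C x = - x" for x :: "'a::complex_vector"
  using scaleC_add_left[of 1 "-1" x] by (simp add: scaleC_one scaleC_zero_left eq_neg_iff_add_eq_0 add.commute)

lemma scaleC_diff_left: "(a - b) *\<^sub>C x = a *\<^sub>C x - b *\<^sub>C x" for x :: "'a::complex_vector"
  using scaleC_add_left[of "a - b" b x] by simp

lemma star_zero: "star (0::'a::complex_star_algebra) = 0"
  using star_add[of 0 "0::'a"] by simp

lemma star_minus: "star (- x) = - star x" for x :: "'a::complex_star_algebra"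
  using star_add[of x "- x"] by (simp add: star_zero eq_neg_iff_add_eq_0 add.commute)

lemma star_diff: "star (x - y) = star x - star y" for x y :: "'a::complex_star_algebra"
  using star_add[of x "- y"] by (simp add: star_minus)

lemma star_one: "star (1::'h::complex_hilbert cop) = 1"
  by (rule star_eqI) (simp add: one_cop.rep_eq)

lemma star_power: "star (a ^ n) = star a ^ n" for a :: "'h::complex_hilbert cop"
  by (induction n) (simp_all add: star_one star_mult power_commutes)

lemma cinner_diff_right: "cinner x (y - z) = cinner x y - cinner x z"
  for x y z :: "'a::complex_hilbert"
  using cinner_add_right[of x "y - z" z] by simp

lemma cinner_zero_right [simp]: "cinner x 0 = 0" for x :: "'a::complex_hilbert"
  using cinner_add_right[of x 0 0] by simp

lemma cinner_zero_left [simp]: "cinner 0 x = 0" for x :: "'a::complex_hilbert"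
  using cinner_add_left[of 0 0 x] by simp

lemma cinner_sum_right: "cinner x (sum f A) = (\<Sum>a\<in>A. cinner x (f a))"
  for x :: "'a::complex_hilbert"
  by (induction A rule: infinite_finite_induct) (simp_all add: cinner_add_right)

lemma cinner_sum_left: "cinner (sum f A) x = (\<Sum>a\<in>A. cinner (f a) x)"
  for x :: "'a::complex_hilbert"
  by (induction A rule: infinite_finite_induct) (simp_all add: cinner_add_left)

lemma norm_sq_cinner: "(norm x)\<^sup>2 = Re (cinner x x)" for x :: "'a::complex_hilbert"
  by (simp add: cinner_self)

lemma norm_cinner_le: "cmod (cinner x y) \<le> norm x * norm y" for x y :: "'a::complex_hilbert"
proof (cases "cinner x y = 0")
  case False
  \<comment> \<open>The phase that rotates the inner product onto the positive axis; this reduces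
    the claim to the real Cauchy-Schwarz inequality.\<close>
  define c where "c = cnj (cinner x y) / complex_of_real (cmod (cinner x y))"
  have c: "cmod c = 1" "c * cinner x y = complex_of_real (cmod (cinner x y))"
    using False complex_norm_square[of "cinner x y"]
    by (simp_all add: c_def norm_divide field_simps power2_eq_square)
  have "cmod (cinner x y) = Re (cinner x (c *\<^sub>C y))"
    by (simp add: cinner_scaleC_right c)
  also have "\<dots> \<le> norm x * norm (c *\<^sub>C y)"
    unfolding inner_eq_Re_cinner[symmetric] by (rule norm_cauchy_schwarz)
  finally show ?thesis by (simp add: norm_scaleC c)
qed simp

lemma bounded_bilinear_cinner: "bounded_bilinear (cinner :: 'a::complex_hilbert \<Rightarrow> _)"
proof
  fix a b :: 'a and r :: real
  show "cinner (r *\<^sub>R a) b = r *\<^sub>R cinner a b" "cinner a (r *\<^sub>R b) = r *\<^sub>R cinner a b"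
    by (simp_all add: scaleR_scaleC cinner_scaleC_left cinner_scaleC_right scaleR_conv_of_real)
  show "\<exists>K. \<forall>a b :: 'a. norm (cinner a b) \<le> norm a * norm b * K"
    by (rule exI[of _ 1]) (simp add: norm_cinner_le)
qed (simp_all add: cinner_add_left cinner_add_right)

lemmas tendsto_cinner = bounded_bilinear.tendsto[OF bounded_bilinear_cinner]

lemma cop_apply_mult: "cop_apply (A * B) x = cop_apply A (cop_apply B x)"
  by (simp add: times_cop.rep_eq)

lemma norm_cop_le: "norm (cop_apply A x) \<le> norm A * norm x"
  unfolding norm_cop.rep_eq by (rule onorm[OF bounded_linear_cop_apply])

lemma norm_cop_bound: "norm A \<le> M" if "0 \<le> M" "\<And>x. norm (cop_apply A x) \<le> M * norm x"
  unfolding norm_cop.rep_eq by (rule onorm_bound) (rule that)+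

lemma bounded_bilinear_cop_apply: "bounded_bilinear (cop_apply :: 'h::complex_hilbert cop \<Rightarrow> _)"
proof
  show "\<exists>K. \<forall>(a::'h cop) b. norm (cop_apply a b) \<le> norm a * norm b * K"
    by (rule exI[of _ 1]) (simp add: norm_cop_le)
qed (simp_all add: plus_cop.rep_eq scaleR_cop.rep_eq linear_simps bounded_linear_cop_apply)

lemmas tendsto_cop_apply = bounded_bilinear.tendsto[OF bounded_bilinear_cop_apply]
lemmas cop_apply_add_right = bounded_bilinear.add_right[OF bounded_bilinear_cop_apply]
lemmas cop_apply_diff_right = bounded_bilinear.diff_right[OF bounded_bilinear_cop_apply]
lemmas cop_apply_sum_right = bounded_bilinear.sum_right[OF bounded_bilinear_cop_apply]
lemmas cop_apply_sum_left = bounded_bilinear.sum_left[OF bounded_bilinear_cop_apply]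
lemmas cop_apply_zero_right = bounded_bilinear.zero_right[OF bounded_bilinear_cop_apply]
lemmas cop_apply_simps = plus_cop.rep_eq minus_cop.rep_eq uminus_cop.rep_eq zero_cop.rep_eq
  times_cop.rep_eq one_cop.rep_eq scaleC_cop.rep_eq

text \<open>Operators embed isometrically into the complete space of bounded real-linear maps, and
  complex linearity survives the pointwise limit.\<close>

instance cop :: (complex_hilbert) banach
proof
  fix X :: "nat \<Rightarrow> 'a cop"
  assume X: "Cauchy X"
  have nb: "norm (blinfun_apply F x) \<le> norm F * norm x" for F :: "'a \<Rightarrow>\<^sub>L 'a" and x
    by (rule norm_blinfun)
  define Y where "Y n = Blinfun (cop_apply (X n))" for n
  have Y: "blinfun_apply (Y n) = cop_apply (X n)" for n
    unfolding Y_def by (rule bounded_linear_Blinfun_apply[OF bounded_linear_cop_apply])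
  have iso: "norm (Y m - Y n) = norm (X m - X n)" for m n
    by (simp add: norm_blinfun.rep_eq norm_cop.rep_eq minus_blinfun.rep_eq[abs_def] minus_cop.rep_eq Y)
  have "Cauchy Y"
    using X by (simp add: Cauchy_iff iso)
  then obtain G where G: "Y \<longlonglongrightarrow> G"
    using Cauchy_convergent_iff convergent_def by blast
  have Gx: "(\<lambda>n. cop_apply (X n) x) \<longlonglongrightarrow> blinfun_apply G x" for x
    using blinfun.tendsto[OF G tendsto_const, of x] by (simp add: Y)
  have "blinfun_apply G (c *\<^sub>C x) = c *\<^sub>C blinfun_apply G x" for c x
    using Gx[of "c *\<^sub>C x"] bounded_linear.tendsto[OF bounded_linear_scaleC_right Gx[of x], of c]
    by (auto simp: cop_apply_scaleC intro: LIMSEQ_unique)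
  then have H: "cop_apply (Abs_cop (blinfun_apply G)) = blinfun_apply G"
    by (intro Abs_cop_inverse) (simp add: blinfun.bounded_linear_right)
  have "norm (X n - Abs_cop (blinfun_apply G)) = norm (Y n - G)" for n
    by (simp add: norm_blinfun.rep_eq norm_cop.rep_eq minus_blinfun.rep_eq[abs_def] minus_cop.rep_eq Y H)
  then have "X \<longlonglongrightarrow> Abs_cop (blinfun_apply G)"
    using G by (simp add: LIMSEQ_iff)
  then show "convergent X"
    by (rule convergentI)
qed

lemma norm_scaleC_cop: "norm (c *\<^sub>C A) = cmod c * norm A" for A :: "'h::complex_hilbert cop"
proof -
  have le: "norm (c *\<^sub>C A) \<le> cmod c * norm A" for c and A :: "'h cop"
    by (rule norm_cop_bound) (auto simp: scaleC_cop.rep_eq norm_scaleC mult.assoc intro!: mult_left_mono norm_cop_le)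
  show ?thesis
  proof (cases "c = 0")
    case False
    then have "norm A \<le> cmod (inverse c) * norm (c *\<^sub>C A)"
      using le[of "inverse c" "c *\<^sub>C A"] by (simp add: scaleC_scaleC scaleC_one)
    then have "cmod c * norm A \<le> cmod c * (cmod (inverse c) * norm (c *\<^sub>C A))"
      by (intro mult_left_mono) simp_all
    also have "\<dots> = norm (c *\<^sub>C A)"
      using False by (simp add: norm_inverse)
    finally show ?thesis
      using le[of c A] by simp
  qed (simp add: scaleC_zero_left)
qed

lemma scaleR_scaleC_cop: "r *\<^sub>R A = complex_of_real r *\<^sub>C A" for A :: "'h::complex_hilbert cop"
  by transfer (simp add: scaleR_scaleC)

lemma bounded_linear_scaleC_cop: "bounded_linear (\<lambda>A::'h::complex_hilbert cop. c *\<^sub>C A)"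
  by (rule bounded_linear_intro[of _ "cmod c"])
    (simp_all add: scaleC_add_right norm_scaleC_cop scaleR_scaleC_cop scaleC_scaleC mult.commute)

lemma norm_star: "norm (star A) = norm A" for A :: "'h::complex_hilbert cop"
proof -
  have le: "norm (star A) \<le> norm A" for A :: "'h cop"
  proof (rule norm_cop_bound[OF norm_ge_zero])
    fix x
    let ?y = "cop_apply (star A) x"
    have "(norm ?y)\<^sup>2 = Re (cinner x (cop_apply A ?y))"
      by (simp add: norm_sq_cinner cinner_star_left)
    also have "\<dots> \<le> norm x * norm (cop_apply A ?y)"
      unfolding inner_eq_Re_cinner[symmetric] by (rule norm_cauchy_schwarz)
    also have "\<dots> \<le> norm x * (norm A * norm ?y)"
      by (intro mult_left_mono norm_cop_le) simp
    finally show "norm ?y \<le> norm A * norm x"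
      by (cases "norm ?y = 0") (simp_all add: power2_eq_square mult_ac)
  qed
  from le[of A] le[of "star A"] show ?thesis by (simp add: star_star)
qed

lemma bounded_linear_star: "bounded_linear (star :: 'h::complex_hilbert cop \<Rightarrow> _)"
  by (rule bounded_linear_intro[of _ 1])
    (simp_all add: star_add norm_star scaleR_scaleC_cop star_scaleC)

lemmas tendsto_star = bounded_linear.tendsto[OF bounded_linear_star]
lemmas tendsto_scaleC_cop = bounded_linear.tendsto[OF bounded_linear_scaleC_cop]

text \<open>The half of the C*-identity that does not follow from submultiplicativity.\<close>

lemma norm_sq_le_star_mult: "(norm A)\<^sup>2 \<le> norm (star A * A)" for A :: "'h::complex_hilbert cop"
proof -
  have "norm A \<le> sqrt (norm (star A * A))"
  proof (rule norm_cop_bound, simp)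
    fix x
    have "(norm (cop_apply A x))\<^sup>2 = Re (cinner x (cop_apply (star A * A) x))"
      by (simp add: norm_sq_cinner cinner_star_right times_cop.rep_eq)
    also have "\<dots> \<le> norm x * norm (cop_apply (star A * A) x)"
      unfolding inner_eq_Re_cinner[symmetric] by (rule norm_cauchy_schwarz)
    also have "\<dots> \<le> norm x * (norm (star A * A) * norm x)"
      by (intro mult_left_mono norm_cop_le) simp
    finally have "(norm (cop_apply A x))\<^sup>2 \<le> (sqrt (norm (star A * A)) * norm x)\<^sup>2"
      by (simp add: power_mult_distrib power2_eq_square mult_ac)
    then show "norm (cop_apply A x) \<le> sqrt (norm (star A * A)) * norm x"
      by (rule power2_le_imp_le) simp
  qed
  then show ?thesis
    using power_mono[of "norm A" "sqrt (norm (star A * A))" 2] by simp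
qed

text \<open>A bound by the sum of squares suffices: for \<open>y\<close> parallel to the image of
  \<open>x\<close> and of the same norm as \<open>x\<close>, it agrees with the bound by the product
  of the norms.\<close>

lemma norm_le_cinner_bound:
  fixes A :: "'h::complex_hilbert cop"
  assumes "0 \<le> M"
    and "\<And>x y. cmod (cinner y (cop_apply A x)) \<le> M / 2 * ((norm x)\<^sup>2 + (norm y)\<^sup>2)"
  shows "norm A \<le> M"
proof (rule norm_cop_bound[OF assms(1)])
  fix x
  let ?z = "cop_apply A x"
  show "norm ?z \<le> M * norm x"
  proof (cases "x = 0 \<or> ?z = 0")
    case True
    with assms(1) show ?thesis by (auto simp: cop_apply_zero_right)
  next
    case False
    define y where "y = complex_of_real (norm x / norm ?z) *\<^sub>C ?z"
    have y: "norm y = norm x"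
      using False by (simp add: y_def norm_scaleC norm_divide)
    have "cinner y ?z = complex_of_real (norm x * norm ?z)"
      using False by (simp add: y_def cinner_scaleC_left cinner_self power2_eq_square)
    then have "norm x * norm ?z \<le> M / 2 * ((norm x)\<^sup>2 + (norm y)\<^sup>2)"
      using assms(2)[of y x] by (simp add: norm_mult)
    also have "\<dots> = norm x * (M * norm x)"
      unfolding y by (simp add: power2_eq_square)
    finally show ?thesis using False by simp
  qed
qed

section \<open>C*-subalgebras and contractivity of star homomorphisms\<close>

lemma cstar_subalgebraD:
  assumes "cstar_subalgebra X"
  shows "closed X" "0 \<in> X" "a \<in> X \<Longrightarrow> b \<in> X \<Longrightarrow> a + b \<in> X" "a \<in> X \<Longrightarrow> b \<in> X \<Longrightarrow> a * b \<in> X"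
    "a \<in> X \<Longrightarrow> c *\<^sub>C a \<in> X" "a \<in> X \<Longrightarrow> star a \<in> X" "a \<in> X \<Longrightarrow> b \<in> X \<Longrightarrow> a - b \<in> X"
    "a \<in> X \<Longrightarrow> r *\<^sub>R a \<in> X"
proof -
  show "a - b \<in> X" if "a \<in> X" "b \<in> X"
  proof -
    have "a + (-1) *\<^sub>C b \<in> X"
      using assms that unfolding cstar_subalgebra_def by blast
    then show ?thesis by (simp add: scaleC_minus1)
  qed
  show "r *\<^sub>R a \<in> X" if "a \<in> X"
    using assms that unfolding cstar_subalgebra_def scaleR_scaleC_cop by blast
qed (use assms in \<open>auto simp: cstar_subalgebra_def\<close>)

lemma cstar_subalgebra_power: "a ^ n \<in> X" if "cstar_subalgebra X" "1 \<in> X" "a \<in> X"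
  using that by (induction n) (auto intro: cstar_subalgebraD)

lemma cstar_subalgebra_sum: "(\<And>i. i \<in> F \<Longrightarrow> f i \<in> X) \<Longrightarrow> sum f F \<in> X" if "cstar_subalgebra X"
  by (induction F rule: infinite_finite_induct) (auto intro: cstar_subalgebraD[OF that])

lemma cstar_subalgebra_generated: "cstar_subalgebra (cstar_generated S)"
  unfolding cstar_generated_def
proof (rule hull_in)
  fix T :: "'h::complex_hilbert cop set set"
  assume "\<forall>t\<in>T. cstar_subalgebra t"
  then show "cstar_subalgebra (\<Inter> T)"
    unfolding cstar_subalgebra_def by (auto intro: closed_Inter)
qed

lemma cstar_generated_superset: "S \<subseteq> cstar_generated S"
  unfolding cstar_generated_def by (rule hull_subset)

lemma cstar_generated_minimal: "S \<subseteq> X \<Longrightarrow> cstar_subalgebra X \<Longrightarrow> cstar_generated S \<subseteq> X"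
  unfolding cstar_generated_def by (rule hull_minimal)

lemma star_homD:
  assumes "star_hom X Y f"
  shows "a \<in> X \<Longrightarrow> f a \<in> Y" "a \<in> X \<Longrightarrow> b \<in> X \<Longrightarrow> f (a + b) = f a + f b"
    "a \<in> X \<Longrightarrow> b \<in> X \<Longrightarrow> f (a * b) = f a * f b" "a \<in> X \<Longrightarrow> f (c *\<^sub>C a) = c *\<^sub>C f a"
    "a \<in> X \<Longrightarrow> f (star a) = star (f a)"
  using assms unfolding star_hom_def by auto

lemma star_hom_linear:
  assumes f: "star_hom X Y f" and X: "cstar_subalgebra X"
  shows "f 0 = 0" "a \<in> X \<Longrightarrow> b \<in> X \<Longrightarrow> f (a - b) = f a - f b"
proof -
  show "f 0 = 0"
    using star_homD(2)[OF f, of 0 0] cstar_subalgebraD[OF X] by simp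
  show "f (a - b) = f a - f b" if "a \<in> X" "b \<in> X"
    using star_homD(2)[OF f, of "a - b" b] that cstar_subalgebraD[OF X] by simp
qed

lemma star_hom_sum:
  assumes f: "star_hom X Y f" and X: "cstar_subalgebra X" and "\<And>i. i \<in> F \<Longrightarrow> g i \<in> X"
  shows "f (sum g F) = (\<Sum>i\<in>F. f (g i))"
  using assms(3)
  by (induction F rule: infinite_finite_induct)
    (simp_all add: star_hom_linear[OF f X] star_homD[OF f] cstar_subalgebra_sum[OF X])

lemma star_hom_power:
  fixes f :: "'h::complex_hilbert cop \<Rightarrow> 'k::complex_hilbert cop"
  assumes f: "star_hom X Y f" and X: "cstar_subalgebra X" "1 \<in> X" "f 1 = 1" and "a \<in> X"
  shows "f (a ^ n) = f a ^ n"
  by (induction n) (simp_all add: assms star_homD[OF f] cstar_subalgebra_power)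

text \<open>The solution is the geometric series u + u^2 + ..., obtained as a fixed point of a
  contraction of \<open>X\<close>; in this form it makes sense in an algebra without unit.\<close>

lemma quasi_inverse_exists:
  assumes X: "cstar_subalgebra X" and u: "u \<in> X" "norm u < 1"
  shows "\<exists>y\<in>X. y = u + u * y"
proof -
  have "\<exists>!y. y \<in> X \<and> u + u * y = y"
  proof (rule Banach_fix)
    show "complete X"
      by (simp add: complete_eq_closed cstar_subalgebraD[OF X])
    show "X \<noteq> {}" using u by auto
    show "0 \<le> norm u" "norm u < 1" using u by auto
    show "(\<lambda>y. u + u * y) ` X \<subseteq> X"
      using u by (auto intro: cstar_subalgebraD[OF X])
    show "dist (u + u * x) (u + u * y) \<le> norm u * dist x y" for x y
      using norm_mult_ineq[of u "x - y"] by (simp add: dist_norm right_diff_distrib)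
  qed
  then show ?thesis by metis
qed

text \<open>The hypothesis makes \<open>star a * a\<close> / M a strict contraction, and
  \<open>f\<close> carries its quasi-inverse to the target. There it says that 1 + C inverts 1 -
  \<open>star (f a) * f a\<close> / M. The target is an arbitrary star algebra, so the lemma applies
  to operators and to functions.\<close>

lemma star_hom_quasi_inverse:
  assumes X: "cstar_subalgebra X" and f: "star_hom X Y f" and a: "a \<in> X" "(norm a)\<^sup>2 < M"
  shows "\<exists>C D. D = star C \<and> C = complex_of_real (1/M) *\<^sub>C (star (f a) * f a)
     + complex_of_real (1/M) *\<^sub>C (star (f a) * f a) * C"
proof -
  have M: "M > 0" using a(2) by (smt (verit) zero_le_power2)
  define u where "u = complex_of_real (1/M) *\<^sub>C (star a * a)"
  have ua: "star a * a \<in> X" and u: "u \<in> X"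
    unfolding u_def using a by (auto intro!: cstar_subalgebraD[OF X])
  have "norm u \<le> (norm a)\<^sup>2 / M"
    using M norm_mult_ineq[of "star a" a]
    by (simp add: u_def norm_scaleC_cop norm_star power2_eq_square norm_divide divide_right_mono)
  also have "\<dots> < 1" using a M by simp
  finally obtain y where y: "y \<in> X" "y = u + u * y"
    using quasi_inverse_exists[OF X u] by blast
  have fu: "f u = complex_of_real (1/M) *\<^sub>C (star (f a) * f a)"
    using a ua by (simp only: u_def star_homD[OF f] cstar_subalgebraD[OF X])
  have "f y = f u + f u * f y"
    using y u by (metis cstar_subalgebraD(4)[OF X] star_homD(2,3)[OF f])
  then show ?thesis unfolding fu by blast
qed

text \<open>If \<open>\<parallel>a\<parallel>\<^sup>2 < M = \<parallel>f a\<parallel>\<^sup>2\<close>, then \<open>1 - (f a)\<^sup>* (f a) / M\<close> has a left inverse,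
  hence is bounded below; this contradicts the choice of \<open>M\<close>.\<close>

lemma star_hom_norm_le:
  fixes f :: "'h::complex_hilbert cop \<Rightarrow> 'k::complex_hilbert cop"
  assumes X: "cstar_subalgebra X" and f: "star_hom X Y f" and a: "a \<in> X"
  shows "norm (f a) \<le> norm a"
proof (rule ccontr)
  assume "\<not> norm (f a) \<le> norm a"
  then have less: "norm a < norm (f a)" by simp
  define M where "M = (norm (f a))\<^sup>2"
  have aM: "(norm a)\<^sup>2 < M"
    unfolding M_def using less by (intro power_strict_mono) auto
  have M: "M > 0" using aM by (smt (verit) zero_le_power2)
  define c where "c = complex_of_real (1/M) *\<^sub>C (star (f a) * f a)"
  obtain C where C: "C = c + c * C"
    using star_hom_quasi_inverse[OF X f a aM] unfolding c_def by blast
  have "star c = c"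
    by (simp add: c_def star_scaleC star_mult star_star)
  then have SC: "star C = c + star C * c"
    by (metis C star_add star_mult)
  define K where "K = norm (1 + star C) + 1"
  have K: "K > 0" unfolding K_def by (smt (verit) norm_ge_zero)
  \<comment> \<open>The adjoint of the equation for \<open>C\<close> provides a left inverse 1 +
    \<open>star C\<close> of 1 - \<open>c\<close>, so 1 - \<open>c\<close> is bounded below. The
    summand 1 in \<open>K\<close> keeps it positive.\<close>
  have low: "norm h \<le> K * norm (cop_apply (1 - c) h)" for h
  proof -
    have "(1 + star C) * (1 - c) = 1"
      using SC by (simp add: algebra_simps)
    then have "h = cop_apply (1 + star C) (cop_apply (1 - c) h)"
      by (metis times_cop.rep_eq one_cop.rep_eq)
    then have "norm h \<le> norm (1 + star C) * norm (cop_apply (1 - c) h)"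
      by (metis norm_cop_le)
    also have "\<dots> \<le> K * norm (cop_apply (1 - c) h)"
      unfolding K_def by (intro mult_right_mono) auto
    finally show ?thesis .
  qed
  \<comment> \<open>Since <h, c h> = s / M and |c h|^2 \<le> s / M, expanding |(1 - c) h|^2 leaves
    at most |h|^2 - s / M. Compared with \<open>low\<close>, this keeps s below M |h|^2 by a fixed
    factor, which is incompatible with M = |f a|^2.\<close>
  have bound: "(norm (cop_apply (f a) h))\<^sup>2 \<le> M * (1 - 1 / K\<^sup>2) * (norm h)\<^sup>2" for h
  proof -
    define s where "s = (norm (cop_apply (f a) h))\<^sup>2"
    have ch: "cop_apply c h = complex_of_real (1/M) *\<^sub>C cop_apply (star (f a)) (cop_apply (f a) h)"
      by (simp add: c_def scaleC_cop.rep_eq times_cop.rep_eq)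
    have 1: "Re (cinner h (cop_apply c h)) = s / M"
      using M by (simp add: ch cinner_scaleC_right cinner_star_right cinner_self s_def)
    have "norm (cop_apply c h) \<le> 1 / M * (norm (f a) * norm (cop_apply (f a) h))"
      unfolding ch norm_scaleC using M norm_cop_le[of "star (f a)"]
      by (simp add: norm_star norm_divide divide_right_mono)
    then have "(norm (cop_apply c h))\<^sup>2 \<le> (1 / M * (norm (f a) * norm (cop_apply (f a) h)))\<^sup>2"
      by (intro power_mono) auto
    also have "\<dots> = s / M"
      using M by (simp add: M_def s_def power_mult_distrib power_divide power2_eq_square)
    finally have 2: "(norm (cop_apply c h))\<^sup>2 \<le> s / M" .
    have "(norm (cop_apply (1 - c) h))\<^sup>2
        = (norm h)\<^sup>2 - 2 * Re (cinner h (cop_apply c h)) + (norm (cop_apply c h))\<^sup>2"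
      unfolding cop_apply_simps power2_norm_eq_inner inner_eq_Re_cinner[symmetric]
      by (simp add: inner_diff inner_commute)
    also have "\<dots> \<le> (norm h)\<^sup>2 - s / M"
      using 1 2 by simp
    finally have "(norm (cop_apply (1 - c) h))\<^sup>2 \<le> (norm h)\<^sup>2 - s / M" .
    moreover have "(norm h)\<^sup>2 \<le> K\<^sup>2 * (norm (cop_apply (1 - c) h))\<^sup>2"
      using power_mono[OF low norm_ge_zero, of h 2] by (simp add: power_mult_distrib)
    ultimately have "(norm h)\<^sup>2 \<le> K\<^sup>2 * ((norm h)\<^sup>2 - s / M)"
      by (smt (verit) mult_left_mono zero_le_power2)
    then have "s \<le> M * (1 - 1 / K\<^sup>2) * (norm h)\<^sup>2"
      using M K by (simp add: field_simps)
    then show ?thesis unfolding s_def .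
  qed
  have less_M: "M * (1 - 1 / K\<^sup>2) < M"
    using M K by (simp add: field_simps)
  define R where "R = max 0 (M * (1 - 1 / K\<^sup>2))"
  have "norm (f a) \<le> sqrt R"
  proof (rule norm_cop_bound, simp add: R_def)
    fix h
    have "(norm (cop_apply (f a) h))\<^sup>2 \<le> R * (norm h)\<^sup>2"
      by (rule order_trans[OF bound]) (simp add: R_def mult_right_mono)
    also have "\<dots> = (sqrt R * norm h)\<^sup>2"
      by (simp add: power_mult_distrib R_def)
    finally show "norm (cop_apply (f a) h) \<le> sqrt R * norm h"
      by (rule power2_le_imp_le) (simp add: R_def)
  qed
  then have "M \<le> (sqrt R)\<^sup>2"
    unfolding M_def by (intro power_mono) auto
  also have "\<dots> = R" by (simp add: R_def)
  also have "\<dots> < M" using M less_M by (simp add: R_def)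
  finally show False by simp
qed

text \<open>With M = |f a z|^2 the quasi-inverse equation, evaluated at \<open>z\<close>, reads C z
  = 1 + C z.\<close>

lemma star_hom_fun_norm_le:
  fixes f :: "'h::complex_hilbert cop \<Rightarrow> 'b \<Rightarrow> complex"
  assumes X: "cstar_subalgebra X" and f: "star_hom X Y f" and a: "a \<in> X"
  shows "cmod (f a z) \<le> norm a"
proof (rule ccontr)
  assume "\<not> cmod (f a z) \<le> norm a"
  then have aM: "(norm a)\<^sup>2 < (cmod (f a z))\<^sup>2"
    by (intro power_strict_mono) auto
  then have nz: "f a z \<noteq> 0" by auto
  obtain C where C: "C = complex_of_real (1/(cmod (f a z))\<^sup>2) *\<^sub>C (star (f a) * f a)
     + complex_of_real (1/(cmod (f a z))\<^sup>2) *\<^sub>C (star (f a) * f a) * C"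
    using star_hom_quasi_inverse[OF X f a aM] by blast
  have "complex_of_real (1/(cmod (f a z))\<^sup>2) * (cnj (f a z) * f a z) = 1"
    using nz complex_norm_square[of "f a z"] by (simp add: field_simps)
  with fun_cong[OF C, of z] show False
    by (simp add: scaleC_fun_def star_fun_def plus_fun_def times_fun_def scaleC_complex_def
        star_complex_def)
qed

lemma star_hom_tendsto:
  fixes f :: "'h::complex_hilbert cop \<Rightarrow> 'k::complex_hilbert cop"
  assumes X: "cstar_subalgebra X" and f: "star_hom X Y f"
    and x: "\<And>n. x n \<in> X" "l \<in> X" "x \<longlonglongrightarrow> l"
  shows "(\<lambda>n. f (x n)) \<longlonglongrightarrow> f l"
proof (rule Lim_null_comparison[THEN LIM_zero_cancel])
  show "(\<lambda>n. norm (x n - l)) \<longlonglongrightarrow> 0"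
    using x(3) by (simp add: LIM_zero tendsto_norm_zero)
  have "norm (f (x n) - f l) \<le> norm (x n - l)" for n
    using star_hom_norm_le[OF X f, of "x n - l"] x
    by (simp add: star_hom_linear[OF f X] cstar_subalgebraD[OF X])
  then show "\<forall>\<^sub>F n in sequentially. norm (f (x n) - f l) \<le> norm (x n - l)" by simp
qed

lemma star_hom_fun_tendsto:
  fixes f :: "'h::complex_hilbert cop \<Rightarrow> 'b \<Rightarrow> complex"
  assumes X: "cstar_subalgebra X" and f: "star_hom X Y f"
    and x: "\<And>n. x n \<in> X" "l \<in> X" "x \<longlonglongrightarrow> l"
  shows "(\<lambda>n. f (x n) z) \<longlonglongrightarrow> f l z"
proof (rule Lim_null_comparison[THEN LIM_zero_cancel])
  show "(\<lambda>n. norm (x n - l)) \<longlonglongrightarrow> 0"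
    using x(3) by (simp add: LIM_zero tendsto_norm_zero)
  have "norm (f (x n) z - f l z) \<le> norm (x n - l)" for n
    using star_hom_fun_norm_le[OF X f, of "x n - l" z] x
    by (simp add: star_hom_linear[OF f X] cstar_subalgebraD[OF X])
  then show "\<forall>\<^sub>F n in sequentially. norm (f (x n) z - f l z) \<le> norm (x n - l)" by simp
qed

text \<open>The target type carries no topology, so continuity enters as the hypothesis
  \<open>cl\<close>: agreement passes to limits of sequences.\<close>

lemma star_homs_agree:
  fixes f g :: "'h::complex_hilbert cop \<Rightarrow> 'b::complex_star_algebra"
  assumes f: "star_hom (cstar_generated S) Y f" and g: "star_hom (cstar_generated S) Z g"
    and S: "\<And>s. s \<in> S \<Longrightarrow> f s = g s"
    and cl: "\<And>x l. (\<And>n. x n \<in> cstar_generated S) \<Longrightarrow> l \<in> cstar_generated S \<Longrightarrow> x \<longlonglongrightarrow> l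
      \<Longrightarrow> (\<And>n. f (x n) = g (x n)) \<Longrightarrow> f l = g l"
    and a: "a \<in> cstar_generated S"
  shows "f a = g a"
proof -
  let ?B = "cstar_generated S"
  note B = cstar_subalgebra_generated[of S]
  have "cstar_subalgebra {a \<in> ?B. f a = g a}"
    unfolding cstar_subalgebra_def
  proof (intro conjI)
    show "closed {a \<in> ?B. f a = g a}"
      unfolding closed_sequential_limits
      using cl closed_sequentially[OF cstar_subalgebraD(1)[OF B]] by blast
  qed (auto simp: star_hom_linear[OF f B] star_hom_linear[OF g B] star_homD[OF f] star_homD[OF g]
      intro: cstar_subalgebraD[OF B])
  then have "?B \<subseteq> {a \<in> ?B. f a = g a}"
    using S cstar_generated_superset by (intro cstar_generated_minimal) auto
  with a show ?thesis by blast
qed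

text \<open>\<open>R z \<epsilon>\<close> stands for: \<open>z\<close> approximates the desired element up to \<open>\<epsilon>\<close>.\<close>

lemma approximation_limit:
  fixes Z :: "'a::banach set" and R :: "'a \<Rightarrow> real \<Rightarrow> bool"
  assumes ex: "\<And>\<epsilon>. 0 < \<epsilon> \<Longrightarrow> \<exists>z\<in>Z. R z \<epsilon>"
    and dist: "\<And>y z \<delta> \<epsilon>. y \<in> Z \<Longrightarrow> z \<in> Z \<Longrightarrow> R y \<delta> \<Longrightarrow> R z \<epsilon> \<Longrightarrow> norm (y - z) \<le> \<delta> + \<epsilon>"
  shows "\<exists>l\<in>closure Z. \<forall>\<epsilon>>0. \<exists>z\<in>Z. R z \<epsilon> \<and> norm (l - z) \<le> \<epsilon>"
proof -
  have "\<forall>k. \<exists>z. z \<in> Z \<and> R z (inverse (real (Suc k)))"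
    using ex by (simp add: Bex_def)
  from choice[OF this] obtain z where z: "\<And>k. z k \<in> Z" "\<And>k. R (z k) (inverse (real (Suc k)))"
    by blast
  have "Cauchy z"
  proof (rule CauchyI)
    fix \<epsilon> :: real
    assume "\<epsilon> > 0"
    then obtain N where N: "inverse (real (Suc N)) < \<epsilon> / 2"
      using reals_Archimedean[of "\<epsilon> / 2"] by auto
    have "norm (z m - z n) < \<epsilon>" if "m \<ge> N" "n \<ge> N" for m n
    proof -
      have "inverse (real (Suc m)) \<le> inverse (real (Suc N))" "inverse (real (Suc n)) \<le> inverse (real (Suc N))"
        using that by (auto intro: le_imp_inverse_le)
      with dist[OF z(1) z(1) z(2) z(2), of m n] N show ?thesis by linarith
    qed
    then show "\<exists>M. \<forall>m\<ge>M. \<forall>n\<ge>M. norm (z m - z n) < \<epsilon>" by blast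
  qed
  then obtain l where l: "z \<longlonglongrightarrow> l"
    using Cauchy_convergent_iff convergent_def by blast
  \<comment> \<open>Letting k tend to infinity in \<open>dist\<close> controls the distance from
    \<open>l\<close> to every approximant, not only to the terms of the sequence. Hence one witness
    satisfies both conditions of the conclusion.\<close>
  have "norm (l - y) \<le> \<epsilon>" if "y \<in> Z" "R y \<epsilon>" for y \<epsilon>
  proof -
    have "(\<lambda>k. norm (z k - y)) \<longlonglongrightarrow> norm (l - y)"
      by (intro tendsto_intros l)
    moreover have "(\<lambda>k. inverse (real (Suc k)) + \<epsilon>) \<longlonglongrightarrow> 0 + \<epsilon>"
      by (intro tendsto_add LIMSEQ_inverse_real_of_nat tendsto_const)
    ultimately show ?thesis
      using LIMSEQ_le[of "\<lambda>k. norm (z k - y)" "norm (l - y)" "\<lambda>k. inverse (real (Suc k)) + \<epsilon>" "0 + \<epsilon>"]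
        dist[OF z(1) that(1) z(2) that(2)] by auto
  qed
  moreover have "l \<in> closure Z"
    using z(1) l unfolding closure_sequential by blast
  ultimately show ?thesis using ex by blast
qed

text \<open>By \<open>le\<close> the projection of \<open>Y\<close> + \<open>I\<close> onto
  \<open>Y\<close> along \<open>I\<close> is contractive. It maps a convergent sequence of sums to a
  Cauchy sequence, so both components converge separately.\<close>

lemma closed_sum_decomposition:
  fixes Y I :: "'a::banach set"
  assumes Y: "\<And>y z. y \<in> Y \<Longrightarrow> z \<in> Y \<Longrightarrow> y - z \<in> Y" and I: "\<And>y z. y \<in> I \<Longrightarrow> z \<in> I \<Longrightarrow> y - z \<in> I"
    and le: "\<And>y i. y \<in> Y \<Longrightarrow> i \<in> I \<Longrightarrow> norm y \<le> norm (y + i)"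
    and x: "x \<in> closure {y + i |y i. y \<in> Y \<and> i \<in> I}"
  shows "\<exists>y\<in>closure Y. \<exists>i\<in>closure I. x = y + i"
proof -
  obtain X where X: "\<And>n. X n \<in> {y + i |y i. y \<in> Y \<and> i \<in> I}" "X \<longlonglongrightarrow> x"
    using x unfolding closure_sequential by blast
  then obtain y i where yi: "\<And>n. y n \<in> Y" "\<And>n. i n \<in> I" "\<And>n. X n = y n + i n"
    by simp metis
  have "norm (y m - y n) \<le> norm (X m - X n)" for m n
    using le[OF Y[OF yi(1)[of m] yi(1)[of n]] I[OF yi(2)[of m] yi(2)[of n]]]
    by (simp add: yi(3) algebra_simps)
  moreover have "Cauchy X" using X(2) by (rule LIMSEQ_imp_Cauchy)
  ultimately have "Cauchy y"
    unfolding Cauchy_iff by (meson order_le_less_trans)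
  then obtain l where l: "y \<longlonglongrightarrow> l"
    using Cauchy_convergent_iff convergent_def by blast
  have "i \<longlonglongrightarrow> x - l"
    using tendsto_diff[OF X(2) l] by (simp add: yi(3))
  then have "x - l \<in> closure I"
    using yi(2) unfolding closure_sequential by blast
  moreover have "l \<in> closure Y"
    using yi(1) l unfolding closure_sequential by blast
  moreover have "x = l + (x - l)" by simp
  ultimately show ?thesis by blast
qed

section \<open>Operators on \<open>\<ell>\<^sup>2(\<nat>)\<close>\<close>

lemma ell2_eqI: "(\<And>i. ell2_nth x i = ell2_nth y i) \<Longrightarrow> x = y"
  by (metis ell2_nth_inject ext)

lemmas ell2_nth_simps = plus_ell2.rep_eq minus_ell2.rep_eq uminus_ell2.rep_eq zero_ell2.rep_eq
  scaleC_ell2.rep_eq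

lemma ell2_nth_sum: "ell2_nth (sum f A) i = (\<Sum>a\<in>A. ell2_nth (f a) i)"
  by (induction A rule: infinite_finite_induct) (simp_all add: ell2_nth_simps)

lift_definition ket :: "nat \<Rightarrow> ell2" is "\<lambda>i j. if j = i then 1 else 0"
proof -
  fix i :: nat
  have "(\<lambda>j. (cmod (if j = i then 1 else 0))\<^sup>2) = (\<lambda>j. if j = i then 1 else 0)"
    by auto
  then show "summable (\<lambda>j. (cmod (if j = i then 1 else 0))\<^sup>2)"
    using summable_single[of i "\<lambda>_. 1::real"] by simp
qed

lemma cinner_ket_left: "cinner (ket i) x = ell2_nth x i"
  unfolding cinner_ell2_def by (subst suminf_finite[of "{i}"]) (auto simp: ket.rep_eq)

lemma norm_ket: "norm (ket i) = 1"
proof -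
  have "(norm (ket i))\<^sup>2 = 1"
    using norm_sq_cinner[of "ket i"] by (simp add: cinner_ket_left ket.rep_eq)
  then show ?thesis
    using power2_eq_imp_eq[of "norm (ket i)" 1] by simp
qed

lemma ell2_nth_star: "ell2_nth (cop_apply (star A) x) i = cinner (cop_apply A (ket i)) x"
  by (simp add: cinner_ket_left[symmetric] cinner_star_right)

lemma ell2_nth_shift: "ell2_nth (cop_apply shift x) i = (case i of 0 \<Rightarrow> 0 | Suc j \<Rightarrow> ell2_nth x j)"
  by (simp add: shift.rep_eq shift_ell2.rep_eq)

lemma shift_ket: "cop_apply shift (ket i) = ket (Suc i)"
  by (rule ell2_eqI) (auto simp: ell2_nth_shift ket.rep_eq split: nat.split)

lemma ell2_nth_star_shift: "ell2_nth (cop_apply (star shift) x) i = ell2_nth x (Suc i)"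
  by (simp add: ell2_nth_star shift_ket cinner_ket_left)

lemma ell2_nth_shift_power:
  "ell2_nth (cop_apply (shift ^ k) x) i = (if i < k then 0 else ell2_nth x (i - k))"
  by (induction k arbitrary: i)
    (auto simp: cop_apply_simps ell2_nth_shift split: nat.split)

lemma ell2_nth_star_shift_power:
  "ell2_nth (cop_apply (star shift ^ k) x) i = ell2_nth x (i + k)"
  by (induction k arbitrary: i) (auto simp: cop_apply_simps ell2_nth_star_shift)

lemma star_shift_shift: "star shift * shift = 1"
  by (intro cop_eqI ell2_eqI) (simp add: cop_apply_simps ell2_nth_shift ell2_nth_star_shift)

lemma ell2_nth_proj_P: "ell2_nth (cop_apply (proj_P n) x) i = (if i \<le> n then ell2_nth x i else 0)"
  by (simp add: proj_P_def cop_apply_simps ell2_nth_simps ell2_nth_shift_power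
      ell2_nth_star_shift_power del: power_Suc)

text \<open>The middle factor projects onto e_0, so this is the rank-one operator taking e_j to e_i.
  Written in terms of the shift, it visibly belongs to the Toeplitz algebra.\<close>

definition matrix_unit :: "nat \<Rightarrow> nat \<Rightarrow> ell2 cop" where
  "matrix_unit i j = shift ^ i * (1 - shift * star shift) * star shift ^ j"

lemma ell2_nth_matrix_unit:
  "ell2_nth (cop_apply (matrix_unit i j) x) k = (if k = i then ell2_nth x j else 0)"
  by (cases "k < i"; cases "k - i")
    (auto simp: matrix_unit_def cop_apply_simps ell2_nth_simps ell2_nth_shift_power ell2_nth_shift
      ell2_nth_star_shift ell2_nth_star_shift_power add.commute)

definition entry :: "ell2 cop \<Rightarrow> nat \<Rightarrow> nat \<Rightarrow> complex" where
  "entry A i j = ell2_nth (cop_apply A (ket j)) i"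

lemma entry_simps:
  "entry (A + B) i j = entry A i j + entry B i j" "entry (A - B) i j = entry A i j - entry B i j"
  "entry (c *\<^sub>C A) i j = c * entry A i j" "entry 0 i j = 0"
  by (simp_all add: entry_def cop_apply_simps ell2_nth_simps)

lemma proj_P_ket_sum: "cop_apply (proj_P n) x = (\<Sum>j\<le>n. ell2_nth x j *\<^sub>C ket j)"
  by (rule ell2_eqI)
    (simp add: ell2_nth_proj_P ell2_nth_sum ell2_nth_simps ket.rep_eq if_distrib cong: if_cong)

lemma proj_P_sandwich:
  "proj_P n * A * proj_P n = (\<Sum>i\<le>n. \<Sum>j\<le>n. entry A i j *\<^sub>C matrix_unit i j)"
proof (intro cop_eqI ell2_eqI)
  fix x k
  have "ell2_nth (cop_apply (proj_P n * A * proj_P n) x) k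
      = (if k \<le> n then \<Sum>j\<le>n. ell2_nth x j * entry A k j else 0)"
    by (simp add: times_cop.rep_eq ell2_nth_proj_P[of n "cop_apply A _"] proj_P_ket_sum[of n x]
        cop_apply_sum_right ell2_nth_sum cop_apply_scaleC ell2_nth_simps entry_def)
  also have "\<dots> = (\<Sum>i\<le>n. if k = i then \<Sum>j\<le>n. ell2_nth x j * entry A k j else 0)"
    by simp
  also have "\<dots> = (\<Sum>i\<le>n. \<Sum>j\<le>n. entry A i j * (if k = i then ell2_nth x j else 0))"
    by (intro sum.cong refl) (simp add: mult.commute)
  also have "\<dots> = ell2_nth (cop_apply (\<Sum>i\<le>n. \<Sum>j\<le>n. entry A i j *\<^sub>C matrix_unit i j) x) k"
    by (simp only: cop_apply_sum_left ell2_nth_sum scaleC_cop.rep_eq scaleC_ell2.rep_eq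
        ell2_nth_matrix_unit)
  finally show "ell2_nth (cop_apply (proj_P n * A * proj_P n) x) k
    = ell2_nth (cop_apply (\<Sum>i\<le>n. \<Sum>j\<le>n. entry A i j *\<^sub>C matrix_unit i j) x) k" .
qed

lemma star_proj_P: "star (proj_P n) = proj_P n"
  by (simp add: proj_P_def star_diff star_one star_mult star_power star_star del: power_Suc)

lemma proj_P_mult: "proj_P m * proj_P n = proj_P (min m n)"
  by (intro cop_eqI ell2_eqI) (simp add: cop_apply_simps ell2_nth_proj_P)

lemma norm_proj_P_sq: "(norm (cop_apply (proj_P n) x))\<^sup>2 = (\<Sum>i\<le>n. (cmod (ell2_nth x i))\<^sup>2)"
  unfolding norm_sq_ell2 by (subst suminf_finite[of "{..n}"]) (auto simp: ell2_nth_proj_P)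

lemma norm_diff_proj_P_sq:
  "(norm (x - cop_apply (proj_P n) x))\<^sup>2 = (norm x)\<^sup>2 - (norm (cop_apply (proj_P n) x))\<^sup>2"
proof -
  have "cinner x (cop_apply (proj_P n) x) = cinner (cop_apply (proj_P n) x) (cop_apply (proj_P n) x)"
    by (metis cinner_star_left star_proj_P proj_P_mult min.idem times_cop.rep_eq)
  then have "inner x (cop_apply (proj_P n) x) = (norm (cop_apply (proj_P n) x))\<^sup>2"
    by (simp add: inner_eq_Re_cinner norm_sq_cinner)
  then show ?thesis
    by (simp add: power2_norm_eq_inner inner_diff inner_commute)
qed

lemma norm_proj_P_le: "norm (proj_P n) \<le> 1"
proof (rule norm_cop_bound)
  fix x
  have "(norm (cop_apply (proj_P n) x))\<^sup>2 \<le> (norm x)\<^sup>2"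
    using norm_diff_proj_P_sq[of x n] by (smt (verit) zero_le_power2)
  then show "norm (cop_apply (proj_P n) x) \<le> 1 * norm x"
    by (simp add: power2_le_iff_abs_le)
qed simp

lemma norm_one_minus_proj_P_le: "norm (1 - proj_P n) \<le> 1"
proof (rule norm_cop_bound)
  fix x
  have "(norm (cop_apply (1 - proj_P n) x))\<^sup>2 \<le> (norm x)\<^sup>2"
    using norm_diff_proj_P_sq[of x n] by (simp add: cop_apply_simps)
  then show "norm (cop_apply (1 - proj_P n) x) \<le> 1 * norm x"
    by (simp add: power2_le_iff_abs_le)
qed simp

lemma proj_P_tendsto: "(\<lambda>n. cop_apply (proj_P n) x) \<longlonglongrightarrow> x"
proof -
  have "(\<lambda>n. (norm x)\<^sup>2 - (norm (cop_apply (proj_P n) x))\<^sup>2) \<longlonglongrightarrow> (norm x)\<^sup>2 - (norm x)\<^sup>2"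
    unfolding norm_proj_P_sq norm_sq_ell2[of x]
    using summable_LIMSEQ'[OF summable_ell2[of x]]
    by (intro tendsto_intros) (simp add: lessThan_Suc_atMost[symmetric] LIMSEQ_Suc atLeast0AtMost)
  then have "(\<lambda>n. (norm (x - cop_apply (proj_P n) x))\<^sup>2) \<longlonglongrightarrow> 0"
    by (simp add: norm_diff_proj_P_sq)
  then have "(\<lambda>n. sqrt ((norm (x - cop_apply (proj_P n) x))\<^sup>2)) \<longlonglongrightarrow> sqrt 0"
    by (rule tendsto_real_sqrt)
  then have "(\<lambda>n. norm (x - cop_apply (proj_P n) x)) \<longlonglongrightarrow> 0" by simp
  then have "(\<lambda>n. x - cop_apply (proj_P n) x) \<longlonglongrightarrow> 0"
    by (rule tendsto_norm_zero_cancel)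
  then show ?thesis
    using tendsto_diff[OF tendsto_const[of x], of "\<lambda>n. x - cop_apply (proj_P n) x" 0] by simp
qed

section \<open>Compact operators as norm limits of their finite corners\<close>

lemma norm_cop_ball_bound:
  assumes "0 \<le> M" "\<And>x. norm x \<le> 1 \<Longrightarrow> norm (cop_apply A x) \<le> M"
  shows "norm A \<le> M"
proof (rule norm_cop_bound[OF assms(1)])
  fix x
  show "norm (cop_apply A x) \<le> M * norm x"
  proof (cases "x = 0")
    case False
    have "norm (cop_apply A ((1 / norm x) *\<^sub>R x)) \<le> M"
      using False by (intro assms(2)) simp
    then show ?thesis
      using False by (simp add: bounded_bilinear.scaleR_right[OF bounded_bilinear_cop_apply] field_simps)
  qed (simp add: cop_apply_zero_right)
qed

text \<open>An iterated sum of compact discs. Such a set contains the image of the unit ball under a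
  finite corner.\<close>

lemma compact_ket_combinations:
  "compact {x. \<exists>c. (\<forall>j. cmod (c j) \<le> R) \<and> x = (\<Sum>j\<le>n. c j *\<^sub>C ket j)}" (is "compact (?C n)")
proof (induction n)
  have line: "compact ((\<lambda>c. c *\<^sub>C ket n) ` cball 0 R)" for n
  proof (rule compact_continuous_image)
    have "bounded_linear (\<lambda>c. c *\<^sub>C ket n)"
      by (rule bounded_linear_intro[of _ 1])
        (simp_all add: scaleC_add_left norm_scaleC norm_ket scaleR_scaleC scaleC_scaleC
          scaleR_conv_of_real)
    then show "continuous_on (cball 0 R) (\<lambda>c. c *\<^sub>C ket n)"
      by (rule linear_continuous_on)
  qed simp
  {
    case 0
    have "?C 0 \<subseteq> (\<lambda>c. c *\<^sub>C ket 0) ` cball 0 R" by auto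
    moreover have "(\<lambda>c. c *\<^sub>C ket 0) ` cball 0 R \<subseteq> ?C 0"
    proof clarify
      fix c :: complex
      assume "c \<in> cball 0 R"
      then show "\<exists>d. (\<forall>j. cmod (d j) \<le> R) \<and> c *\<^sub>C ket 0 = (\<Sum>j\<le>0. d j *\<^sub>C ket j)"
        by (intro exI[of _ "\<lambda>_. c"]) auto
    qed
    ultimately show ?case using line[of 0] by simp
  next
    case (Suc n)
    have "?C (Suc n) = {x + y |x y. x \<in> ?C n \<and> y \<in> (\<lambda>c. c *\<^sub>C ket (Suc n)) ` cball 0 R}"
    proof (intro equalityI subsetI)
      fix x assume "x \<in> {x + y |x y. x \<in> ?C n \<and> y \<in> (\<lambda>c. c *\<^sub>C ket (Suc n)) ` cball 0 R}"
      then obtain c d where "\<forall>j. cmod (c j) \<le> R" "cmod d \<le> R"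
        and x: "x = (\<Sum>j\<le>n. c j *\<^sub>C ket j) + d *\<^sub>C ket (Suc n)"
        by auto
      then have "\<forall>j. cmod ((c(Suc n := d)) j) \<le> R" by simp
      moreover have "x = (\<Sum>j\<le>Suc n. (c(Suc n := d)) j *\<^sub>C ket j)"
        unfolding x by (simp add: fun_upd_def)
      ultimately show "x \<in> ?C (Suc n)" by blast
    qed fastforce
    with compact_sums[OF Suc.IH line[of "Suc n"]] show ?case by simp
  }
qed

text \<open>Compactness of a closure as total boundedness of the set itself. The passage to the
  closure doubles the radius: a finite union of closed balls of radius e / 2 is closed.\<close>

lemma compact_operators_covered:
  "A \<in> compact_operators \<longleftrightarrow> (\<forall>e>0. \<exists>k. finite k \<and> cop_apply A ` cball 0 1 \<subseteq> (\<Union>x\<in>k. ball x e))"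
proof
  assume "A \<in> compact_operators"
  then have "compact (closure (cop_apply A ` cball 0 1))"
    by (simp add: compact_operators_def)
  then have *: "\<forall>e>0. \<exists>k. finite k \<and> closure (cop_apply A ` cball 0 1) \<subseteq> (\<Union>x\<in>k. ball x e)"
    unfolding compact_eq_totally_bounded by (rule conjunct2)
  show "\<forall>e>0. \<exists>k. finite k \<and> cop_apply A ` cball 0 1 \<subseteq> (\<Union>x\<in>k. ball x e)"
  proof (intro allI impI)
    fix e :: real
    assume "e > 0"
    from *[rule_format, OF this] obtain k
      where "finite k \<and> closure (cop_apply A ` cball 0 1) \<subseteq> (\<Union>x\<in>k. ball x e)" ..
    then have "finite k \<and> cop_apply A ` cball 0 1 \<subseteq> (\<Union>x\<in>k. ball x e)"
      by (rule conjE) (rule conjI, assumption, rule order_trans[OF closure_subset])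
    then show "\<exists>k. finite k \<and> cop_apply A ` cball 0 1 \<subseteq> (\<Union>x\<in>k. ball x e)" ..
  qed
next
  assume *: "\<forall>e>0. \<exists>k. finite k \<and> cop_apply A ` cball 0 1 \<subseteq> (\<Union>x\<in>k. ball x e)"
  have "\<exists>k. finite k \<and> closure (cop_apply A ` cball 0 1) \<subseteq> (\<Union>x\<in>k. ball x e)" if "e > 0" for e
  proof -
    have "0 < e / 2" using \<open>e > 0\<close> by simp
    from *[rule_format, OF this] obtain k
      where "finite k \<and> cop_apply A ` cball 0 1 \<subseteq> (\<Union>x\<in>k. ball x (e / 2))" ..
    note k = conjunct1[OF this] conjunct2[OF this]
    have "(\<Union>x\<in>k. ball x (e / 2)) \<subseteq> (\<Union>x\<in>k. cball x (e / 2))"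
      by (intro UN_mono ball_subset_cball order_refl)
    with k(2) have "cop_apply A ` cball 0 1 \<subseteq> (\<Union>x\<in>k. cball x (e / 2))"
      by (rule order_trans)
    then have "closure (cop_apply A ` cball 0 1) \<subseteq> (\<Union>x\<in>k. cball x (e / 2))"
      using k(1) by (intro closure_minimal closed_UN) auto
    also have "\<dots> \<subseteq> (\<Union>x\<in>k. ball x e)"
      using \<open>e > 0\<close> by (intro UN_mono order_refl) auto
    finally have "finite k \<and> closure (cop_apply A ` cball 0 1) \<subseteq> (\<Union>x\<in>k. ball x e)"
      by (rule conjI[OF k(1)])
    then show ?thesis ..
  qed
  then have "compact (closure (cop_apply A ` cball 0 1))"
    unfolding compact_eq_totally_bounded complete_eq_closed
    by (intro conjI[OF closed_closure] allI impI)
  then show "A \<in> compact_operators"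
    unfolding compact_operators_def by (rule CollectI)
qed

text \<open>This description by corners gives the linear and limit properties of compact operators
  and their expansion in matrix units.\<close>

lemma compact_operators_iff:
  "A \<in> compact_operators \<longleftrightarrow> (\<lambda>n. proj_P n * A * proj_P n) \<longlonglongrightarrow> A"
proof
  assume A: "A \<in> compact_operators"
  have left: "(\<lambda>n. (1 - proj_P n) * B) \<longlonglongrightarrow> 0" if B: "B \<in> compact_operators" for B
  proof (rule LIMSEQ_I)
    fix r :: real
    assume "r > 0"
    then have "0 < r / 4" by simp
    from B[unfolded compact_operators_covered, rule_format, OF this] obtain k
      where "finite k \<and> cop_apply B ` cball 0 1 \<subseteq> (\<Union>x\<in>k. ball x (r / 4))" ..
    note k = conjunct1[OF this] conjunct2[OF this]
    have "\<forall>x\<in>k. \<forall>\<^sub>F n in sequentially. norm (x - cop_apply (proj_P n) x) < r / 4"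
    proof
      fix x
      have "(\<lambda>n. x - cop_apply (proj_P n) x) \<longlonglongrightarrow> x - x"
        by (intro tendsto_intros proj_P_tendsto)
      then show "\<forall>\<^sub>F n in sequentially. norm (x - cop_apply (proj_P n) x) < r / 4"
        using order_tendstoD(2)[OF tendsto_norm_zero, of "\<lambda>n. x - cop_apply (proj_P n) x" _ "r / 4"]
          \<open>r > 0\<close> by simp
    qed
    then have "\<forall>\<^sub>F n in sequentially. \<forall>x\<in>k. norm (x - cop_apply (proj_P n) x) < r / 4"
      using k(1) by (simp add: eventually_ball_finite_distrib)
    then obtain N where N: "\<And>n x. n \<ge> N \<Longrightarrow> x \<in> k \<Longrightarrow> norm (x - cop_apply (proj_P n) x) < r / 4"
      by (auto simp: eventually_sequentially)
    have "norm ((1 - proj_P n) * B) \<le> r / 2" if "n \<ge> N" for n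
    proof (rule norm_cop_ball_bound)
      fix h :: ell2
      assume "norm h \<le> 1"
      then obtain x where x: "x \<in> k" "norm (x - cop_apply B h) < r / 4"
        using k(2) by (force simp: dist_norm)
      have "cop_apply ((1 - proj_P n) * B) h
          = (x - cop_apply (proj_P n) x) - cop_apply (1 - proj_P n) (x - cop_apply B h)"
        by (simp add: cop_apply_simps cop_apply_diff_right)
      also have "norm \<dots> \<le> norm (x - cop_apply (proj_P n) x)
          + norm (cop_apply (1 - proj_P n) (x - cop_apply B h))"
        by (rule norm_triangle_ineq4)
      also have "\<dots> \<le> r / 4 + 1 * (r / 4)"
        using N[OF that x(1)] x(2)
        by (intro add_mono order_trans[OF norm_cop_le] mult_mono norm_one_minus_proj_P_le) auto
      finally show "norm (cop_apply ((1 - proj_P n) * B) h) \<le> r / 2" by simp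
    qed (use \<open>r > 0\<close> in simp)
    then show "\<exists>no. \<forall>n\<ge>no. norm ((1 - proj_P n) * B - 0) < r"
      using \<open>r > 0\<close> by (intro exI[of _ N]) fastforce
  qed
  \<comment> \<open>The right-hand tail A (1 - P_n) is reduced to a left-hand one: its squared norm
    is at most that of (1 - P_n) times \<open>star A * A\<close>, and \<open>star A * A\<close> is
    compact because \<open>star A\<close> is continuous.\<close>
  have "star A * A \<in> compact_operators"
  proof -
    let ?C = "closure (cop_apply A ` cball 0 1)"
    have C: "compact (cop_apply (star A) ` ?C)"
      using A unfolding compact_operators_def
      by (intro compact_continuous_image linear_continuous_on bounded_linear_cop_apply) simp
    have "cop_apply (star A * A) ` cball 0 1 \<subseteq> cop_apply (star A) ` ?C"
      using closure_subset[of "cop_apply A ` cball 0 1"] by (auto simp: times_cop.rep_eq)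
    then have "closure (cop_apply (star A * A) ` cball 0 1) \<subseteq> cop_apply (star A) ` ?C"
      using C by (intro closure_minimal compact_imp_closed)
    then have "cop_apply (star A) ` ?C \<inter> closure (cop_apply (star A * A) ` cball 0 1)
        = closure (cop_apply (star A * A) ` cball 0 1)"
      by (rule Int_absorb1)
    with compact_Int_closed[OF C closed_closure[of "cop_apply (star A * A) ` cball 0 1"]]
    have "compact (closure (cop_apply (star A * A) ` cball 0 1))"
      by (simp only:)
    then show ?thesis
      unfolding compact_operators_def by blast
  qed
  from left[OF this] have "(\<lambda>n. norm ((1 - proj_P n) * (star A * A))) \<longlonglongrightarrow> 0"
    by (rule tendsto_norm_zero)
  then have "(\<lambda>n. (norm (A * (1 - proj_P n)))\<^sup>2) \<longlonglongrightarrow> 0"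
  proof (rule Lim_null_comparison[rotated])
    have "(norm (A * (1 - proj_P n)))\<^sup>2 \<le> norm ((1 - proj_P n) * (star A * A))" for n
    proof -
      have "(norm (A * (1 - proj_P n)))\<^sup>2 \<le> norm ((1 - proj_P n) * (star A * A) * (1 - proj_P n))"
        using norm_sq_le_star_mult[of "A * (1 - proj_P n)"]
        by (simp add: star_mult star_diff star_one star_proj_P mult.assoc)
      also have "\<dots> \<le> norm ((1 - proj_P n) * (star A * A)) * 1"
        by (intro order_trans[OF norm_mult_ineq] mult_left_mono norm_one_minus_proj_P_le) simp
      finally show ?thesis by simp
    qed
    then show "\<forall>\<^sub>F n in sequentially. norm ((norm (A * (1 - proj_P n)))\<^sup>2)
        \<le> norm ((1 - proj_P n) * (star A * A))" by simp
  qed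
  then have "(\<lambda>n. sqrt ((norm (A * (1 - proj_P n)))\<^sup>2)) \<longlonglongrightarrow> sqrt 0"
    by (rule tendsto_real_sqrt)
  then have "(\<lambda>n. norm (A * (1 - proj_P n))) \<longlonglongrightarrow> 0" by simp
  then have right: "(\<lambda>n. A * (1 - proj_P n)) \<longlonglongrightarrow> 0"
    by (rule tendsto_norm_zero_cancel)
  \<comment> \<open>Prepares the splitting A - P A P = P A (1 - P) + (1 - P) A.\<close>
  have "(\<lambda>n. proj_P n * (A * (1 - proj_P n))) \<longlonglongrightarrow> 0"
  proof (rule Lim_null_comparison[OF _ tendsto_norm_zero[OF right]])
    have "norm (proj_P n * (A * (1 - proj_P n))) \<le> 1 * norm (A * (1 - proj_P n))" for n
      by (intro order_trans[OF norm_mult_ineq] mult_right_mono norm_proj_P_le) simp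
    then show "\<forall>\<^sub>F n in sequentially. norm (proj_P n * (A * (1 - proj_P n)))
        \<le> norm (A * (1 - proj_P n))" by simp
  qed
  from tendsto_add[OF this left[OF A]]
  have "(\<lambda>n. A - proj_P n * A * proj_P n) \<longlonglongrightarrow> 0"
    by (simp add: algebra_simps)
  from tendsto_diff[OF tendsto_const[of A] this]
  show "(\<lambda>n. proj_P n * A * proj_P n) \<longlonglongrightarrow> A" by simp
next
  assume A: "(\<lambda>n. proj_P n * A * proj_P n) \<longlonglongrightarrow> A"
  show "A \<in> compact_operators"
    unfolding compact_operators_covered
  proof (intro allI impI)
    fix e :: real
    assume "e > 0"
    then obtain n where n: "norm (proj_P n * A * proj_P n - A) < e / 2"
      using LIMSEQ_D[OF A, of "e / 2"] by auto
    define B where "B = proj_P n * A * proj_P n"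
    define C where "C = {x. \<exists>c. (\<forall>j. cmod (c j) \<le> norm B) \<and> x = (\<Sum>j\<le>n. c j *\<^sub>C ket j)}"
    have "compact C" unfolding C_def by (rule compact_ket_combinations)
    from conjunct2[OF this[unfolded compact_eq_totally_bounded], rule_format, OF half_gt_zero[OF \<open>e > 0\<close>]]
    obtain k where "finite k \<and> C \<subseteq> (\<Union>x\<in>k. ball x (e / 2))" ..
    note k = conjunct1[OF this] conjunct2[OF this]
    have "proj_P n * B = B"
      by (simp add: B_def proj_P_mult flip: mult.assoc)
    have "cop_apply A h \<in> (\<Union>x\<in>k. ball x e)" if "norm h \<le> 1" for h
    proof -
      have Bh: "cop_apply B h = (\<Sum>j\<le>n. ell2_nth (cop_apply B h) j *\<^sub>C ket j)"
        unfolding proj_P_ket_sum[symmetric]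
        by (metis \<open>proj_P n * B = B\<close> times_cop.rep_eq)
      have "cmod (ell2_nth (cop_apply B h) j) \<le> norm B" for j
        using norm_ell2_nth_le[of "cop_apply B h" j] norm_cop_le[of B h]
          mult_left_mono[OF that norm_ge_zero[of B]] by linarith
      with Bh have "cop_apply B h \<in> C"
        unfolding C_def by (intro CollectI exI[of _ "ell2_nth (cop_apply B h)"] conjI allI)
      then obtain x where x: "x \<in> k" "dist x (cop_apply B h) < e / 2"
        using k(2) by auto
      have "norm (cop_apply (B - A) h) \<le> norm (B - A) * norm h"
        by (rule norm_cop_le)
      also have "\<dots> \<le> norm (B - A)"
        using mult_left_mono[OF that norm_ge_zero[of "B - A"]] by simp
      also have "\<dots> < e / 2" using n unfolding B_def .
      finally have "dist (cop_apply B h) (cop_apply A h) < e / 2"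
        by (simp add: dist_norm cop_apply_simps)
      with x(2) have "dist x (cop_apply A h) < e"
        using dist_triangle[of x "cop_apply A h" "cop_apply B h"] by simp
      with x(1) show ?thesis by auto
    qed
    then have "cop_apply A ` cball 0 1 \<subseteq> (\<Union>x\<in>k. ball x e)"
      by (intro image_subsetI) (simp only: mem_cball_0)
    with k(1) have "finite k \<and> cop_apply A ` cball 0 1 \<subseteq> (\<Union>x\<in>k. ball x e)" ..
    then show "\<exists>k. finite k \<and> cop_apply A ` cball 0 1 \<subseteq> (\<Union>x\<in>k. ball x e)" ..
  qed
qed

lemma proj_P_sandwich_tendsto:
  assumes "proj_P N * A * proj_P N = A"
  shows "(\<lambda>n. proj_P n * A * proj_P n) \<longlonglongrightarrow> A"
proof (rule tendsto_eventually)
  have "proj_P n * A * proj_P n = A" if "n \<ge> N" for n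
  proof -
    have "proj_P n * (proj_P N * A * proj_P N) * proj_P n = (proj_P n * proj_P N) * A * (proj_P N * proj_P n)"
      by (simp only: mult.assoc)
    then show ?thesis
      using that assms by (simp add: proj_P_mult min_absorb1 min_absorb2)
  qed
  then show "\<forall>\<^sub>F n in sequentially. proj_P n * A * proj_P n = A"
    unfolding eventually_sequentially by blast
qed

lemma sandwich_compact: "proj_P n * A * proj_P n \<in> compact_operators"
proof -
  have "proj_P n * (proj_P n * A * proj_P n) * proj_P n = (proj_P n * proj_P n) * A * (proj_P n * proj_P n)"
    by (simp only: mult.assoc)
  then show ?thesis
    unfolding compact_operators_iff by (intro proj_P_sandwich_tendsto[of n]) (simp add: proj_P_mult)
qed

lemma compact_operators_limit:
  fixes A :: "ell2 cop"
  assumes "\<And>n. X n \<in> compact_operators" "X \<longlonglongrightarrow> A"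
  shows "A \<in> compact_operators"
  unfolding compact_operators_iff
proof (rule LIMSEQ_I)
  fix r :: real
  assume "r > 0"
  then obtain m where m: "norm (X m - A) < r / 3"
    using LIMSEQ_D[OF assms(2), of "r / 3"] by auto
  have "(\<lambda>n. proj_P n * X m * proj_P n) \<longlonglongrightarrow> X m"
    using assms(1) compact_operators_iff by blast
  then obtain N where N: "\<And>n. n \<ge> N \<Longrightarrow> norm (proj_P n * X m * proj_P n - X m) < r / 3"
    using LIMSEQ_D[of _ _ "r / 3"] \<open>r > 0\<close> by force
  have "norm (proj_P n * A * proj_P n - A) < r" if "n \<ge> N" for n
  proof -
    have "norm (proj_P n * (A - X m) * proj_P n) \<le> 1 * norm (A - X m) * 1"
      by (intro order_trans[OF norm_mult_ineq] mult_mono norm_proj_P_le) auto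
    then have "norm (proj_P n * (A - X m) * proj_P n) < r / 3"
      using m by (simp add: norm_minus_commute)
    have eq: "proj_P n * A * proj_P n - A = proj_P n * (A - X m) * proj_P n
        + (proj_P n * X m * proj_P n - X m) + (X m - A)"
      by (simp add: algebra_simps)
    show ?thesis
      unfolding eq using \<open>norm (proj_P n * (A - X m) * proj_P n) < r / 3\<close>
        m N[OF that] norm_triangle_ineq[of "proj_P n * (A - X m) * proj_P n + (proj_P n * X m * proj_P n - X m)" "X m - A"]
        norm_triangle_ineq[of "proj_P n * (A - X m) * proj_P n" "proj_P n * X m * proj_P n - X m"]
      by linarith
  qed
  then show "\<exists>no. \<forall>n\<ge>no. norm (proj_P n * A * proj_P n - A) < r" by blast
qed

lemma compact_operators_linear:
  fixes A B :: "ell2 cop"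
  assumes "A \<in> compact_operators"
  shows "B \<in> compact_operators \<Longrightarrow> A + B \<in> compact_operators" "c *\<^sub>C A \<in> compact_operators"
proof -
  show "A + B \<in> compact_operators" if "B \<in> compact_operators"
    using tendsto_add[of "\<lambda>n. proj_P n * A * proj_P n" A sequentially "\<lambda>n. proj_P n * B * proj_P n" B]
      assms that
    by (simp add: compact_operators_iff distrib_left distrib_right)
  show "c *\<^sub>C A \<in> compact_operators"
    using tendsto_scaleC_cop[of "\<lambda>n. proj_P n * A * proj_P n" A sequentially c] assms
    by (simp add: compact_operators_iff mult_scaleC_left mult_scaleC_right)
qed

section \<open>An amplification inequality\<close>

text \<open>Gram-Schmidt: normalise the part \<open>z\<close> of the new vector that is orthogonal
  to \<open>E\<close>. The earlier vectors are orthogonal to it, so their expansions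
  persist.\<close>

lemma finite_orthonormal_expansion:
  fixes F :: "'h::complex_hilbert set"
  assumes "finite F"
  shows "\<exists>E. finite E \<and> (\<forall>d\<in>E. \<forall>e\<in>E. cinner d e = (if d = e then 1 else 0)) \<and>
    (\<forall>x\<in>F. (\<Sum>e\<in>E. cinner e x *\<^sub>C e) = x)"
  using assms
proof (induction F)
  case empty
  show ?case by (intro exI[of _ "{}"]) simp
next
  case (insert x F)
  then obtain E where E: "finite E" "\<forall>d\<in>E. \<forall>e\<in>E. cinner d e = (if d = e then 1 else 0)"
    "\<forall>x\<in>F. (\<Sum>e\<in>E. cinner e x *\<^sub>C e) = x"
    by blast
  define z where "z = x - (\<Sum>e\<in>E. cinner e x *\<^sub>C e)"
  have ez: "cinner d z = 0" if "d \<in> E" for d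
  proof -
    have "(\<Sum>e\<in>E. cinner e x * cinner d e) = (\<Sum>e\<in>E. if d = e then cinner e x else 0)"
      using E(2) that by (intro sum.cong) auto
    then show ?thesis
      using E(1) that by (simp add: z_def cinner_diff_right cinner_sum_right cinner_scaleC_right)
  qed
  show ?case
  proof (cases "z = 0")
    case True
    with E show ?thesis unfolding z_def by (intro exI[of _ E]) auto
  next
    case False
    define u where "u = complex_of_real (1 / norm z) *\<^sub>C z"
    have uu: "cinner u u = 1"
      using False
      by (simp add: u_def cinner_scaleC_left cinner_scaleC_right cinner_self[of z] power2_eq_square)
    have eu: "cinner d u = 0" "cinner u d = 0" if "d \<in> E" for d
      using ez[OF that] cinner_commute[of u d] by (simp_all add: u_def cinner_scaleC_right)
    then have uE: "u \<notin> E" using uu by force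
    have "cinner u x = cinner u z"
      using eu by (simp add: z_def cinner_diff_right cinner_sum_right cinner_scaleC_right)
    also have "\<dots> = complex_of_real (norm z)"
      using False by (simp add: u_def cinner_scaleC_left cinner_self power2_eq_square)
    finally have "cinner u x *\<^sub>C u = z"
      using False by (simp add: u_def scaleC_scaleC scaleC_one)
    then have "(\<Sum>e\<in>insert u E. cinner e x *\<^sub>C e) = x"
      using E(1) uE by (simp add: z_def)
    moreover have "(\<Sum>e\<in>insert u E. cinner e y *\<^sub>C e) = y" if "y \<in> F" for y
    proof -
      have y: "(\<Sum>e\<in>E. cinner e y *\<^sub>C e) = y" using E(3) that by blast
      have "cinner u y = 0"
        by (subst y[symmetric]) (simp add: cinner_sum_right cinner_scaleC_right eu)
      with y E(1) uE show ?thesis by (simp add: scaleC_zero_left)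
    qed
    ultimately show ?thesis
      using E uu eu by (intro exI[of _ "insert u E"]) auto
  qed
qed

text \<open>The norm of \<open>X \<otimes> 1\<close> is that of \<open>X\<close>.\<close>

lemma amplification_bound:
  fixes x y :: "nat \<Rightarrow> 'h::complex_hilbert" and X :: "ell2 cop"
  shows "cmod (\<Sum>m<N. \<Sum>n<N. entry X m n * cinner (y m) (x n))
    \<le> norm X / 2 * ((\<Sum>n<N. (norm (x n))\<^sup>2) + (\<Sum>n<N. (norm (y n))\<^sup>2))"
proof -
  have "finite (x ` {..<N} \<union> y ` {..<N})" by simp
  from finite_orthonormal_expansion[OF this] obtain E where "finite E"
    and *: "\<forall>b \<in> x ` {..<N} \<union> y ` {..<N}. (\<Sum>e\<in>E. cinner e b *\<^sub>C e) = b"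
    by metis
  have E: "(\<Sum>e\<in>E. cinner e (x n) *\<^sub>C e) = x n" "(\<Sum>e\<in>E. cinner e (y n) *\<^sub>C e) = y n"
    if "n < N" for n
    using * that by blast+
  have parseval: "cinner a b = (\<Sum>e\<in>E. cinner a e * cinner e b)" if "(\<Sum>e\<in>E. cinner e b *\<^sub>C e) = b" for a b
    by (subst that[symmetric], subst cinner_sum_right) (simp add: cinner_sum_right cinner_scaleC_right mult.commute)
  have norm_parseval: "(norm b)\<^sup>2 = (\<Sum>e\<in>E. (cmod (cinner e b))\<^sup>2)" if "(\<Sum>e\<in>E. cinner e b *\<^sub>C e) = b" for b
  proof -
    have "complex_of_real ((norm b)\<^sup>2) = (\<Sum>e\<in>E. cinner b e * cinner e b)"
      using parseval[OF that, of b] by (simp add: cinner_self)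
    also have "\<dots> = complex_of_real (\<Sum>e\<in>E. (cmod (cinner e b))\<^sup>2)"
      unfolding of_real_sum
    proof (rule sum.cong)
      show "cinner b e * cinner e b = complex_of_real ((cmod (cinner e b))\<^sup>2)" for e
        by (subst cinner_commute[of b e]) (simp only: complex_norm_square mult.commute)
    qed simp
    finally show ?thesis using of_real_eq_iff by blast
  qed
  \<comment> \<open>For each basis vector \<open>e\<close> the coordinates of all \<open>x n\<close>
    along \<open>e\<close> form one vector of l^2. The double sum thus splits into one matrix
    coefficient of \<open>X\<close> for each \<open>e\<close>, and Parseval adds up the
    norms.\<close>
  define vx where "vx e = (\<Sum>n<N. cinner e (x n) *\<^sub>C ket n)" for e
  define vy where "vy e = (\<Sum>n<N. cinner e (y n) *\<^sub>C ket n)" for e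
  have norm_comb: "(norm (\<Sum>n<N. c n *\<^sub>C ket n))\<^sup>2 = (\<Sum>n<N. (cmod (c n))\<^sup>2)" for c
  proof -
    have "ell2_nth (\<Sum>n<N. c n *\<^sub>C ket n) i = (if i < N then c i else 0)" for i
      by (simp add: ell2_nth_sum ell2_nth_simps ket.rep_eq if_distrib cong: if_cong)
    then show ?thesis
      unfolding norm_sq_ell2 by (subst suminf_finite[of "{..<N}"]) auto
  qed
  have p: "cinner (y m) (x n) = (\<Sum>e\<in>E. cinner (y m) e * cinner e (x n))" if "n < N" for m n
    by (rule parseval[OF E(1)[OF that]])
  have "(\<Sum>m<N. \<Sum>n<N. entry X m n * cinner (y m) (x n))
      = (\<Sum>m<N. \<Sum>n<N. \<Sum>e\<in>E. entry X m n * (cinner (y m) e * cinner e (x n)))"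
    by (intro sum.cong refl) (subst p, simp, rule sum_distrib_left)
  also have "\<dots> = (\<Sum>m<N. \<Sum>e\<in>E. \<Sum>n<N. entry X m n * (cinner (y m) e * cinner e (x n)))"
    by (rule sum.cong[OF refl sum.swap])
  also have "\<dots> = (\<Sum>e\<in>E. \<Sum>m<N. \<Sum>n<N. entry X m n * (cinner (y m) e * cinner e (x n)))"
    by (rule sum.swap)
  also have "\<dots> = (\<Sum>e\<in>E. cinner (vy e) (cop_apply X (vx e)))"
  proof (intro sum.cong refl)
    fix e
    show "(\<Sum>m<N. \<Sum>n<N. entry X m n * (cinner (y m) e * cinner e (x n)))
        = cinner (vy e) (cop_apply X (vx e))"
      by (simp add: cinner_commute[of "y _" e] vx_def vy_def cop_apply_sum_right cinner_sum_left cinner_sum_right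
          cop_apply_scaleC cinner_scaleC_left cinner_scaleC_right entry_def cinner_ket_left
          sum_distrib_left mult_ac)
        (rule sum.swap)
  qed
  also have "cmod \<dots> \<le> (\<Sum>e\<in>E. norm X / 2 * ((norm (vx e))\<^sup>2 + (norm (vy e))\<^sup>2))"
  proof (rule sum_norm_le)
    fix e
    have "cmod (cinner (vy e) (cop_apply X (vx e))) \<le> norm (vy e) * (norm X * norm (vx e))"
      by (intro order_trans[OF norm_cinner_le] mult_left_mono norm_cop_le) simp
    also have "\<dots> \<le> norm X / 2 * ((norm (vx e))\<^sup>2 + (norm (vy e))\<^sup>2)"
      using mult_left_mono[OF sum_squares_bound[of "norm (vx e)" "norm (vy e)"] norm_ge_zero[of X]]
      by (simp add: power2_eq_square algebra_simps)
    finally show "cmod (cinner (vy e) (cop_apply X (vx e)))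
        \<le> norm X / 2 * ((norm (vx e))\<^sup>2 + (norm (vy e))\<^sup>2)" .
  qed
  also have "\<dots> = norm X / 2 * ((\<Sum>n<N. (norm (x n))\<^sup>2) + (\<Sum>n<N. (norm (y n))\<^sup>2))"
  proof -
    have "(\<Sum>e\<in>E. (norm (vx e))\<^sup>2) = (\<Sum>n<N. (norm (x n))\<^sup>2)"
      unfolding vx_def norm_comb by (subst sum.swap) (simp add: norm_parseval E(1))
    moreover have "(\<Sum>e\<in>E. (norm (vy e))\<^sup>2) = (\<Sum>n<N. (norm (y n))\<^sup>2)"
      unfolding vy_def norm_comb by (subst sum.swap) (simp add: norm_parseval E(2))
    ultimately show ?thesis
      by (simp only: sum_distrib_left[symmetric] sum.distrib)
  qed
  finally show ?thesis .
qed

section \<open>Finite linear combinations and dense subspaces\<close>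

text \<open>The complex span of a family, with explicit coefficients because the norm estimate for
  Toeplitz polynomials compares two sums with the same coefficients.\<close>

definition lin_combs :: "('i \<Rightarrow> 'h::complex_hilbert cop) \<Rightarrow> 'h cop set" where
  "lin_combs m = {\<Sum>p\<in>F. c p *\<^sub>C m p |F c. finite F}"

lemma lin_combs_base: "m p \<in> lin_combs m"
  unfolding lin_combs_def by (intro CollectI exI[of _ "{p}"] exI[of _ "\<lambda>_. 1"]) (simp add: scaleC_one)

lemma lin_combs_zero: "0 \<in> lin_combs m"
  unfolding lin_combs_def by (intro CollectI exI[of _ "{}"]) simp

lemma scaleC_sum_right: "c *\<^sub>C sum f A = (\<Sum>a\<in>A. c *\<^sub>C f a)"
  for f :: "'i \<Rightarrow> 'a::complex_vector"
  by (induction A rule: infinite_finite_induct) (simp_all add: scaleC_zero_right scaleC_add_right)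

lemma lin_combs_scaleC: "x \<in> lin_combs m \<Longrightarrow> c *\<^sub>C x \<in> lin_combs m"
proof -
  assume "x \<in> lin_combs m"
  then obtain F d where F: "finite F" and x: "x = (\<Sum>p\<in>F. d p *\<^sub>C m p)"
    unfolding lin_combs_def by blast
  have "c *\<^sub>C x = (\<Sum>p\<in>F. (c * d p) *\<^sub>C m p)"
    by (simp add: x scaleC_sum_right scaleC_scaleC)
  with F show ?thesis
    unfolding lin_combs_def by (intro CollectI exI[of _ F] exI[of _ "\<lambda>p. c * d p"]) simp
qed

lemma lin_combs_add: "x \<in> lin_combs m \<Longrightarrow> y \<in> lin_combs m \<Longrightarrow> x + y \<in> lin_combs m"
proof -
  assume "x \<in> lin_combs m" "y \<in> lin_combs m"
  then obtain F G c d where F: "finite F" "finite G"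
    and xy: "x = (\<Sum>p\<in>F. c p *\<^sub>C m p)" "y = (\<Sum>p\<in>G. d p *\<^sub>C m p)"
    unfolding lin_combs_def by blast
  have "x = (\<Sum>p\<in>F \<union> G. (if p \<in> F then c p else 0) *\<^sub>C m p)"
    unfolding xy using F
    by (intro sum.mono_neutral_cong_left) (auto simp: scaleC_zero_left)
  moreover have "y = (\<Sum>p\<in>F \<union> G. (if p \<in> G then d p else 0) *\<^sub>C m p)"
    unfolding xy using F
    by (intro sum.mono_neutral_cong_left) (auto simp: scaleC_zero_left)
  ultimately have "x + y = (\<Sum>p\<in>F \<union> G.
      ((if p \<in> F then c p else 0) + (if p \<in> G then d p else 0)) *\<^sub>C m p)"
    by (simp only: sum.distrib scaleC_add_left)
  with F show ?thesis
    unfolding lin_combs_def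
    by (intro CollectI exI[of _ "F \<union> G"]
      exI[of _ "\<lambda>p. (if p \<in> F then c p else 0) + (if p \<in> G then d p else 0)"]) simp
qed

lemma lin_combs_diff: "x \<in> lin_combs m \<Longrightarrow> y \<in> lin_combs m \<Longrightarrow> x - y \<in> lin_combs m"
  using lin_combs_add[of x m "(-1) *\<^sub>C y"] lin_combs_scaleC[of y m "-1"]
  by (simp add: scaleC_minus1)

lemma lin_combs_sum: "(\<And>i. i \<in> A \<Longrightarrow> f i \<in> lin_combs m) \<Longrightarrow> sum f A \<in> lin_combs m"
  by (induction A rule: infinite_finite_induct) (auto intro: lin_combs_zero lin_combs_add)

lemma lin_combs_induct:
  assumes "x \<in> lin_combs m" "P 0" "\<And>c p x. x \<in> lin_combs m \<Longrightarrow> P x \<Longrightarrow> P (c *\<^sub>C m p + x)"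
  shows "P x"
proof -
  obtain F c where "finite F" and x: "x = (\<Sum>p\<in>F. c p *\<^sub>C m p)"
    using assms(1) unfolding lin_combs_def by blast
  from \<open>finite F\<close> have "P (\<Sum>p\<in>F. c p *\<^sub>C m p) \<and> (\<Sum>p\<in>F. c p *\<^sub>C m p) \<in> lin_combs m"
    by induction (auto intro!: assms lin_combs_add lin_combs_scaleC lin_combs_base lin_combs_zero)
  with x show ?thesis by blast
qed

lemma lin_combs_subset:
  assumes "cstar_subalgebra X" "\<And>p. m p \<in> X"
  shows "lin_combs m \<subseteq> X"
proof
  fix x assume "x \<in> lin_combs m"
  then show "x \<in> X"
    by (rule lin_combs_induct) (auto intro: cstar_subalgebraD[OF assms(1)] assms(2))
qed

lemma closure_linear:
  fixes D :: "'a::real_normed_vector set"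
  assumes f: "bounded_linear f" and D: "\<And>x. x \<in> D \<Longrightarrow> f x \<in> closure E" and x: "x \<in> closure D"
  shows "f x \<in> closure E"
proof -
  obtain X where X: "\<And>n. X n \<in> D" "X \<longlonglongrightarrow> x"
    using x unfolding closure_sequential by blast
  have "(\<lambda>n. f (X n)) \<longlonglongrightarrow> f x"
    by (rule bounded_linear.tendsto[OF f X(2)])
  then show ?thesis
    using closed_sequentially[OF closed_closure, of "\<lambda>n. f (X n)" E] D[OF X(1)] by blast
qed

text \<open>The elements that map \<open>closure D\<close> into itself form a C*-algebra.\<close>

lemma cstar_generated_subset_closure:
  fixes D :: "'h::complex_hilbert cop set"
  assumes D: "0 \<in> D" "1 \<in> D" "\<And>x y. x \<in> D \<Longrightarrow> y \<in> D \<Longrightarrow> x + y \<in> D" "\<And>c x. x \<in> D \<Longrightarrow> c *\<^sub>C x \<in> D"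
    and S: "\<And>s y. s \<in> S \<Longrightarrow> y \<in> D \<Longrightarrow> s * y \<in> D" "\<And>s y. s \<in> S \<Longrightarrow> y \<in> D \<Longrightarrow> star s * y \<in> D"
  shows "cstar_generated S \<subseteq> closure D"
proof -
  let ?M = "{x. \<forall>y\<in>closure D. x * y \<in> closure D \<and> star x * y \<in> closure D}"
  have add: "x + y \<in> closure D" if xy: "x \<in> closure D" "y \<in> closure D" for x y
  proof -
    obtain X Y where "\<And>n. X n \<in> D" "X \<longlonglongrightarrow> x" "\<And>n. Y n \<in> D" "Y \<longlonglongrightarrow> y"
      using xy unfolding closure_sequential by blast
    then show ?thesis
      unfolding closure_sequential
      by (intro exI[of _ "\<lambda>n. X n + Y n"]) (auto intro: tendsto_add D)
  qed
  have scale: "c *\<^sub>C x \<in> closure D" if "x \<in> closure D" for c x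
    using closure_linear[OF bounded_linear_scaleC_cop _ that, of c D] D(4) closure_subset by blast
  have "cstar_subalgebra ?M"
    unfolding cstar_subalgebra_def
  proof (intro conjI ballI allI)
    show "closed ?M"
      unfolding closed_sequential_limits
    proof (intro allI impI CollectI ballI, elim conjE)
      fix X l y
      assume X: "\<forall>n. X n \<in> ?M" "X \<longlonglongrightarrow> l" and y: "y \<in> closure D"
      have "(\<lambda>n. X n * y) \<longlonglongrightarrow> l * y" "(\<lambda>n. star (X n) * y) \<longlonglongrightarrow> star l * y"
        by (intro tendsto_intros tendsto_star X)+
      then show "l * y \<in> closure D \<and> star l * y \<in> closure D"
        using X(1) y
          closed_sequentially[OF closed_closure, of "\<lambda>n. X n * y" D "l * y"]
          closed_sequentially[OF closed_closure, of "\<lambda>n. star (X n) * y" D "star l * y"]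
        by simp
    qed
    have "(0::'h cop) \<in> closure D" using D(1) closure_subset by blast
    then show "0 \<in> ?M" by (simp add: star_zero)
  qed (auto simp: star_add star_mult star_scaleC star_star distrib_right mult_scaleC_left mult.assoc
      intro: add scale)
  moreover have "S \<subseteq> ?M"
  proof
    fix s assume s: "s \<in> S"
    have "bounded_linear (\<lambda>y. s * y)" "bounded_linear (\<lambda>y. star s * y)"
      by (rule bounded_linear_mult_right)+
    then show "s \<in> ?M"
      using closure_linear[of "\<lambda>y. s * y" D D] closure_linear[of "\<lambda>y. star s * y" D D] S[OF s]
        closure_subset[of D] by blast
  qed
  ultimately have "cstar_generated S \<subseteq> ?M"
    by (intro cstar_generated_minimal)
  \<comment> \<open>Elements of \<open>?M\<close> lie in \<open>closure D\<close> themselves, being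
    their own products with 1.\<close>
  moreover have "1 \<in> closure D" using D(2) closure_subset by blast
  ultimately show ?thesis by force
qed

section \<open>Norms of Toeplitz polynomials\<close>

text \<open>The condition selects the diagonal of positions (k + a, k + b), which carries the
  nonzero entries of a Toeplitz monomial. A corner of size N contains N - max a b of them; truncated
  subtraction covers small N.\<close>

lemma sum_diagonal_reindex:
  fixes f :: "nat \<Rightarrow> nat \<Rightarrow> complex"
  shows "(\<Sum>m<N. \<Sum>n<N. if a \<le> m \<and> b \<le> n \<and> m - a = n - b then f m n else 0)
    = (\<Sum>k<N - max a b. f (k + a) (k + b))"
proof -
  have "(\<Sum>m<N. \<Sum>n<N. if a \<le> m \<and> b \<le> n \<and> m - a = n - b then f m n else 0)
      = (\<Sum>(m, n)\<in>{..<N} \<times> {..<N}. if a \<le> m \<and> b \<le> n \<and> m - a = n - b then f m n else 0)"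
    by (rule sum.cartesian_product)
  also have "\<dots> = (\<Sum>(m, n)\<in>{(m, n). m < N \<and> n < N \<and> a \<le> m \<and> b \<le> n \<and> m - a = n - b}. f m n)"
    by (rule sum.mono_neutral_cong_right) (auto split: if_splits)
  also have "\<dots> = (\<Sum>k<N - max a b. f (k + a) (k + b))"
    by (rule sum.reindex_bij_witness[of _ "\<lambda>k. (k + a, k + b)" "\<lambda>(m, n). m - a"])
      (auto, rule arg_cong2[where f = f], arith, rule refl)
  finally show ?thesis .
qed

lemma entry_toeplitz_monomial:
  "entry (shift ^ a * star shift ^ b) m n = (if a \<le> m \<and> b \<le> n \<and> m - a = n - b then 1 else 0)"
  by (auto simp: entry_def times_cop.rep_eq ell2_nth_shift_power ell2_nth_star_shift_power ket.rep_eq)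

lemma entry_sum: "entry (sum f A) m n = (\<Sum>a\<in>A. entry (f a) m n)"
  by (induction A rule: infinite_finite_induct) (simp_all add: entry_simps)

text \<open>Replacing the partial isometry \<open>w\<close> by \<open>V = r w\<close> makes the powers tend to \<open>0\<close>; the defect
  operator \<open>D = (1 - V\<^sup>* V)\<^sup>1\<^sup>/\<^sup>2\<close> is explicit, and \<open>\<xi> \<mapsto> (D V\<^sup>n \<xi>)\<^sub>n\<close> is an isometry that
  intertwines \<open>V\<close> with a multiple of the backward shift.\<close>

lemma toeplitz_monomials_norm_le:
  fixes w :: "'h::complex_hilbert cop"
  assumes w: "w * star w * w = w" and F: "finite F"
  shows "norm (\<Sum>(a, b)\<in>F. c (a, b) *\<^sub>C (star w ^ a * w ^ b))
    \<le> norm (\<Sum>(a, b)\<in>F. c (a, b) *\<^sub>C (shift ^ a * star shift ^ b))"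
    (is "norm ?y \<le> norm ?X")
proof (rule norm_le_cinner_bound[OF norm_ge_zero])
  fix \<xi> \<eta> :: 'h
  let ?b = "norm ?X / 2 * ((norm \<xi>)\<^sup>2 + (norm \<eta>)\<^sup>2)"
  define q where "q = star w * w"
  have q: "q * q = q" "star q = q"
    using w by (simp_all add: q_def star_mult star_star mult.assoc)
  have norm_w: "norm (cop_apply w x) \<le> norm x" for x
  proof -
    have "(norm (cop_apply w x))\<^sup>2 = Re (cinner x (cop_apply q x))"
      by (simp add: norm_sq_cinner q_def times_cop.rep_eq cinner_star_right)
    moreover have "Re (cinner x (cop_apply q x)) = (norm (cop_apply q x))\<^sup>2"
      using cinner_star_left[of q x "cop_apply q x"] cop_apply_mult[of q q x] q
      by (simp add: norm_sq_cinner)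
    moreover have "(norm (cop_apply (1 - q) x))\<^sup>2 = (norm x)\<^sup>2 - 2 * Re (cinner x (cop_apply q x)) + (norm (cop_apply q x))\<^sup>2"
      unfolding cop_apply_simps power2_norm_eq_inner inner_eq_Re_cinner[symmetric]
      by (simp add: inner_diff inner_commute)
    ultimately have "(norm (cop_apply w x))\<^sup>2 \<le> (norm x)\<^sup>2"
      using zero_le_power2[of "norm (cop_apply (1 - q) x)"] by linarith
    then show ?thesis by (simp add: power2_le_iff_abs_le)
  qed
  have norm_w_power: "norm (cop_apply (w ^ n) x) \<le> norm x" for n x
  proof (induction n)
    case (Suc n)
    then show ?case
      using norm_w[of "cop_apply (w ^ n) x"] by (simp add: cop_apply_simps)
  qed (simp add: cop_apply_simps)
  have main: "cmod (\<Sum>(a, b)\<in>F. c (a, b) * (complex_of_real (r ^ (a + b))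
      * cinner (cop_apply (w ^ a) \<eta>) (cop_apply (w ^ b) \<xi>))) \<le> ?b"
    if r: "0 < r" "r < 1" for r :: real
  proof -
    define s where "s = sqrt (1 - r\<^sup>2)"
    have s2: "s\<^sup>2 = 1 - r\<^sup>2"
      using r by (simp add: s_def power_le_one)
    \<comment> \<open>As \<open>q\<close> is a projection, the square root of 1 - r^2 q acts as 1
      off its range and as s on it.\<close>
    define D where "D = 1 - q + complex_of_real s *\<^sub>C q"
    define V where "V k x = complex_of_real (r ^ k) *\<^sub>C cop_apply (w ^ k) x" for k x
    have "star D * D = 1 - complex_of_real (r\<^sup>2) *\<^sub>C q"
    proof -
      have "star D * D = 1 - q + (complex_of_real s * complex_of_real s) *\<^sub>C q"
        by (simp add: D_def star_add star_diff star_one star_scaleC q algebra_simps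
            mult_scaleC_left mult_scaleC_right scaleC_scaleC scaleC_add_right scaleC_diff_right)
      also have "complex_of_real s * complex_of_real s = 1 + - complex_of_real (r\<^sup>2)"
        using s2 by (simp add: power2_eq_square flip: of_real_mult)
      also have "(1 + - complex_of_real (r\<^sup>2)) *\<^sub>C q = q - complex_of_real (r\<^sup>2) *\<^sub>C q"
        by (simp add: scaleC_diff_left scaleC_one)
      finally show ?thesis by simp
    qed
    moreover have "cinner (cop_apply D y) (cop_apply D x) = cinner y (cop_apply (star D * D) x)" for x y
      by (simp add: cop_apply_mult cinner_star_right)
    ultimately have DD: "cinner (cop_apply D y) (cop_apply D x)
        = cinner y x - complex_of_real (r\<^sup>2) * cinner (cop_apply w y) (cop_apply w x)" for x y
      by (simp add: cop_apply_simps cinner_diff_right cinner_scaleC_right q_def cinner_star_right)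
    have step: "cinner (cop_apply D (V (k + a) y)) (cop_apply D (V (k + b) x))
        = cinner (V (k + a) y) (V (k + b) x) - cinner (V (Suc k + a) y) (V (Suc k + b) x)" for k a b x y
      unfolding DD
      by (simp add: V_def cop_apply_scaleC cinner_scaleC_left cinner_scaleC_right cop_apply_simps
          power2_eq_square mult_ac)
    \<comment> \<open>The square of \<open>D\<close> is 1 minus the square of the modulus of r w, so
      the sum along a diagonal telescopes. With a = b = 0 this becomes the Bessel inequality
      below.\<close>
    have tele: "(\<Sum>k<L. cinner (cop_apply D (V (k + a) y)) (cop_apply D (V (k + b) x)))
        = cinner (V a y) (V b x) - cinner (V (L + a) y) (V (L + b) x)" for L a b x y
      unfolding step by (induction L) auto
    have bessel: "(\<Sum>n<N. (norm (cop_apply D (V n x)))\<^sup>2) \<le> (norm x)\<^sup>2" for N x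
    proof -
      have "complex_of_real (\<Sum>n<N. (norm (cop_apply D (V n x)))\<^sup>2)
          = complex_of_real ((norm x)\<^sup>2 - (norm (V N x))\<^sup>2)"
        using tele[of 0 x 0 x N] by (simp add: cinner_self V_def[of 0] scaleC_one one_cop.rep_eq)
      then have "(\<Sum>n<N. (norm (cop_apply D (V n x)))\<^sup>2) = (norm x)\<^sup>2 - (norm (V N x))\<^sup>2"
        using of_real_eq_iff by blast
      then show ?thesis by simp
    qed
    \<comment> \<open>Here r < 1 is used: the boundary terms of the telescoping sums vanish in the
      limit.\<close>
    have V0: "(\<lambda>N. V (N - max a b + d) x) \<longlonglongrightarrow> 0" for a b d x
    proof (rule Lim_null_comparison)
      have "(\<lambda>N. r ^ N) \<longlonglongrightarrow> 0"
        using r by (intro LIMSEQ_power_zero) simp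
      then have "(\<lambda>N. r ^ (N + d)) \<longlonglongrightarrow> 0"
        by (rule LIMSEQ_ignore_initial_segment)
      then have "(\<lambda>N. r ^ (N + max a b - max a b + d)) \<longlonglongrightarrow> 0" by simp
      then have "(\<lambda>N. r ^ (N - max a b + d)) \<longlonglongrightarrow> 0"
        by (rule LIMSEQ_offset[where f = "\<lambda>N. r ^ (N - max a b + d)"])
      from tendsto_mult_right[OF this, of "norm x"]
      show "(\<lambda>N. r ^ (N - max a b + d) * norm x) \<longlonglongrightarrow> 0" by simp
      show "\<forall>\<^sub>F N in sequentially. norm (V (N - max a b + d) x) \<le> r ^ (N - max a b + d) * norm x"
        using r by (simp add: V_def norm_scaleC norm_power norm_w_power mult_left_mono)
    qed
    \<comment> \<open>The amplification of \<open>?X\<close> between the first N components of the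
      images of the two vectors. The amplification bound controls it uniformly in N, while
      \<open>tele\<close> evaluates it monomial by monomial up to boundary terms.\<close>
    define S where "S N = (\<Sum>m<N. \<Sum>n<N. entry ?X m n *
        cinner (cop_apply D (V m \<eta>)) (cop_apply D (V n \<xi>)))" for N
    have S_eq: "S N = (\<Sum>(a, b)\<in>F. c (a, b) * (cinner (V a \<eta>) (V b \<xi>)
        - cinner (V (N - max a b + a) \<eta>) (V (N - max a b + b) \<xi>)))" for N
    proof -
      have "S N = (\<Sum>m<N. \<Sum>n<N. \<Sum>p\<in>F. c p * (if fst p \<le> m \<and> snd p \<le> n \<and> m - fst p = n - snd p
          then cinner (cop_apply D (V m \<eta>)) (cop_apply D (V n \<xi>)) else 0))"
      proof -
        have "entry (case p of (a, b) \<Rightarrow> c (a, b) *\<^sub>C (shift ^ a * star shift ^ b)) m n * z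
            = c p * (if fst p \<le> m \<and> snd p \<le> n \<and> m - fst p = n - snd p then z else 0)" for p m n z
          by (cases p) (simp add: entry_simps entry_toeplitz_monomial)
        then show ?thesis
          unfolding S_def entry_sum sum_distrib_right by (simp only:)
      qed
      also have "\<dots> = (\<Sum>m<N. \<Sum>p\<in>F. \<Sum>n<N. c p * (if fst p \<le> m \<and> snd p \<le> n \<and> m - fst p = n - snd p
          then cinner (cop_apply D (V m \<eta>)) (cop_apply D (V n \<xi>)) else 0))"
        by (rule sum.cong[OF refl sum.swap])
      also have "\<dots> = (\<Sum>p\<in>F. \<Sum>m<N. \<Sum>n<N. c p * (if fst p \<le> m \<and> snd p \<le> n \<and> m - fst p = n - snd p
          then cinner (cop_apply D (V m \<eta>)) (cop_apply D (V n \<xi>)) else 0))"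
        by (rule sum.swap)
      also have "\<dots> = (\<Sum>p\<in>F. c p * (\<Sum>m<N. \<Sum>n<N. if fst p \<le> m \<and> snd p \<le> n \<and> m - fst p = n - snd p
          then cinner (cop_apply D (V m \<eta>)) (cop_apply D (V n \<xi>)) else 0))"
        by (simp only: sum_distrib_left)
      also have "\<dots> = (\<Sum>(a, b)\<in>F. c (a, b) * (cinner (V a \<eta>) (V b \<xi>)
          - cinner (V (N - max a b + a) \<eta>) (V (N - max a b + b) \<xi>)))"
        unfolding sum_diagonal_reindex tele by (simp add: case_prod_beta)
      finally show ?thesis .
    qed
    have "(\<lambda>N. \<Sum>(a, b)\<in>F. c (a, b) * (cinner (V a \<eta>) (V b \<xi>)
        - cinner (V (N - max a b + a) \<eta>) (V (N - max a b + b) \<xi>)))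
      \<longlonglongrightarrow> (\<Sum>(a, b)\<in>F. c (a, b) * (cinner (V a \<eta>) (V b \<xi>) - cinner (0::'h) (0::'h)))"
      unfolding case_prod_beta by (intro tendsto_intros tendsto_cinner V0)
    then have lim: "S \<longlonglongrightarrow> (\<Sum>(a, b)\<in>F. c (a, b) * cinner (V a \<eta>) (V b \<xi>))"
      unfolding S_eq[symmetric] by simp
    have "cmod (S N) \<le> ?b" for N
    proof -
      have "cmod (S N) \<le> norm ?X / 2 * ((\<Sum>n<N. (norm (cop_apply D (V n \<xi>)))\<^sup>2)
          + (\<Sum>n<N. (norm (cop_apply D (V n \<eta>)))\<^sup>2))"
        unfolding S_def by (rule amplification_bound)
      also have "\<dots> \<le> ?b"
        by (intro mult_left_mono add_mono bessel) simp
      finally show ?thesis .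
    qed
    then have "cmod (\<Sum>(a, b)\<in>F. c (a, b) * cinner (V a \<eta>) (V b \<xi>)) \<le> ?b"
      by (intro LIMSEQ_le_const2[OF tendsto_norm[OF lim]]) auto
    then show ?thesis
      by (simp add: V_def cinner_scaleC_left cinner_scaleC_right power_add case_prod_beta mult.assoc
          mult.left_commute)
  qed
  \<comment> \<open>A sequence in the open interval from 0 to 1 with limit 1; the double successor
    makes its first term 1/2 and not 0.\<close>
  define R where "R n = 1 - inverse (real (Suc (Suc n)))" for n
  have "(\<lambda>n. inverse (real (Suc (Suc n)))) \<longlonglongrightarrow> 0"
    by (rule LIMSEQ_Suc[OF LIMSEQ_inverse_real_of_nat])
  from tendsto_diff[OF tendsto_const[of 1] this] have R: "R \<longlonglongrightarrow> 1"
    by (simp add: R_def[abs_def])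
  have R01: "0 < R n" "R n < 1" for n
    by (simp_all add: R_def field_simps)
  have "(\<lambda>n. \<Sum>(a, b)\<in>F. c (a, b) * (complex_of_real (R n ^ (a + b))
      * cinner (cop_apply (w ^ a) \<eta>) (cop_apply (w ^ b) \<xi>)))
    \<longlonglongrightarrow> (\<Sum>(a, b)\<in>F. c (a, b) * (complex_of_real (1 ^ (a + b))
      * cinner (cop_apply (w ^ a) \<eta>) (cop_apply (w ^ b) \<xi>)))"
    unfolding case_prod_beta by (intro tendsto_intros R)
  from tendsto_norm[OF this] have "cmod (\<Sum>(a, b)\<in>F. c (a, b) * (complex_of_real (1 ^ (a + b))
      * cinner (cop_apply (w ^ a) \<eta>) (cop_apply (w ^ b) \<xi>))) \<le> ?b"
    by (rule LIMSEQ_le_const2) (intro exI[of _ 0] allI impI main R01)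
  also have "(\<Sum>(a, b)\<in>F. c (a, b) * (complex_of_real (1 ^ (a + b))
      * cinner (cop_apply (w ^ a) \<eta>) (cop_apply (w ^ b) \<xi>))) = cinner \<eta> (cop_apply ?y \<xi>)"
    by (simp add: cop_apply_sum_left cinner_sum_right case_prod_beta cop_apply_simps
        cinner_scaleC_right star_power[symmetric] cinner_star_right)
  finally show "cmod (cinner \<eta> (cop_apply ?y \<xi>)) \<le> ?b" .
qed

section \<open>The C*-algebra of a power partial isometry\<close>

lemma cinner_projection:
  assumes "star q = q" "q * q = q"
  shows "cinner (cop_apply q x) (cop_apply q y) = cinner x (cop_apply q y)"
  using cinner_star_left[of q x "cop_apply q y"] assms cop_apply_mult[of q q y] by simp

text \<open>Since \<open>star shift * shift\<close> = 1, multiplying a monomial from the left by the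
  shift or its adjoint gives a monomial of the same ordered form.\<close>

lemma toeplitz_dense: "toeplitz_algebra \<subseteq> closure (lin_combs (\<lambda>(a, b). shift ^ a * star shift ^ b))"
  (is "_ \<subseteq> closure (lin_combs ?m)")
  unfolding toeplitz_algebra_def
proof (rule cstar_generated_subset_closure)
  show "1 \<in> lin_combs ?m"
    using lin_combs_base[of ?m "(0, 0)"] by simp
  have "shift * y \<in> lin_combs ?m \<and> star shift * y \<in> lin_combs ?m" if "y \<in> lin_combs ?m" for y
    using that
  proof (rule lin_combs_induct)
    show "shift * 0 \<in> lin_combs ?m \<and> star shift * 0 \<in> lin_combs ?m"
      by (simp add: lin_combs_zero)
  next
    fix c and p :: "nat \<times> nat" and x
    assume x: "shift * x \<in> lin_combs ?m \<and> star shift * x \<in> lin_combs ?m"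
    obtain a b where p: "p = (a, b)" by (cases p)
    have "shift * ?m p \<in> lin_combs ?m"
      using lin_combs_base[of ?m "(Suc a, b)"] by (simp add: p mult.assoc)
    moreover have "star shift * ?m p \<in> lin_combs ?m"
    proof (cases a)
      case 0
      then show ?thesis using lin_combs_base[of ?m "(0, Suc b)"] by (simp add: p)
    next
      case (Suc a')
      have "star shift * (shift ^ Suc a' * star shift ^ b) = (star shift * shift) * (shift ^ a' * star shift ^ b)"
        by (simp only: power_Suc mult.assoc)
      then show ?thesis
        using lin_combs_base[of ?m "(a', b)"] by (simp add: p Suc star_shift_shift del: power_Suc)
    qed
    ultimately show "shift * (c *\<^sub>C ?m p + x) \<in> lin_combs ?m \<and> star shift * (c *\<^sub>C ?m p + x) \<in> lin_combs ?m"
      using x by (simp only: distrib_left mult_scaleC_right lin_combs_add lin_combs_scaleC simp_thms)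
  qed
  then show "s * y \<in> lin_combs ?m" "star s * y \<in> lin_combs ?m"
    if "s \<in> {shift}" "y \<in> lin_combs ?m" for s y
    using that by auto
qed (auto intro: lin_combs_zero lin_combs_add lin_combs_scaleC)

lemma shift_in_toeplitz: "shift \<in> toeplitz_algebra"
  unfolding toeplitz_algebra_def using cstar_generated_superset by blast

lemma cstar_subalgebra_toeplitz: "cstar_subalgebra toeplitz_algebra"
  unfolding toeplitz_algebra_def by (rule cstar_subalgebra_generated)

lemma one_in_toeplitz: "1 \<in> toeplitz_algebra"
  using cstar_subalgebraD(4,6)[OF cstar_subalgebra_toeplitz] shift_in_toeplitz
  by (metis star_shift_shift)

text \<open>The exponent 0 is separate: the identity does not vanish beyond position n, whereas all
  higher powers do.\<close>

lemma ell2_nth_truncated_shift_power: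
  "ell2_nth (cop_apply ((proj_P n * shift) ^ i) x) k
    = (if i = 0 then ell2_nth x k else if i \<le> k \<and> k \<le> n then ell2_nth x (k - i) else 0)"
proof (induction i arbitrary: k)
  case (Suc i)
  then show ?case
    by (cases k) (auto simp: cop_apply_simps ell2_nth_proj_P ell2_nth_shift)
qed (simp add: cop_apply_simps)

lemma ell2_nth_star_truncated_shift_power:
  "ell2_nth (cop_apply (star (proj_P n * shift) ^ i) x) k
    = (if i = 0 then ell2_nth x k else if k + i \<le> n then ell2_nth x (k + i) else 0)"
proof (induction i arbitrary: k)
  case (Suc i)
  then show ?case
    by (auto simp: cop_apply_simps ell2_nth_proj_P ell2_nth_star_shift star_mult star_proj_P)
qed (simp add: cop_apply_simps)

lemma ell2_nth_truncated_shift: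
  "ell2_nth (cop_apply (proj_P n * shift) x) k = (if 1 \<le> k \<and> k \<le> n then ell2_nth x (k - 1) else 0)"
  "ell2_nth (cop_apply (star (proj_P n * shift)) x) k = (if k + 1 \<le> n then ell2_nth x (k + 1) else 0)"
  using ell2_nth_truncated_shift_power[of n 1 x k] ell2_nth_star_truncated_shift_power[of n 1 x k]
  by simp_all

text \<open>Instantiated twice, with \<open>w\<close> = v and with \<open>w\<close> =
  \<open>star v\<close>. In the second case \<open>\<phi>\<close> and \<open>\<kappa>\<close> change
  places and \<open>\<Lambda> n\<close> is conjugated by a flip. Here \<open>\<kappa>\<close> is the
  homomorphism that the limit at infinity turns out to be.\<close>

locale toeplitz_extension =
  fixes w :: "'h::complex_hilbert cop" and B :: "'h cop set"
    and \<phi> \<kappa> :: "'h cop \<Rightarrow> ell2 cop" and \<Lambda> :: "nat \<Rightarrow> 'h cop \<Rightarrow> ell2 cop"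
  assumes B_def: "B = cstar_generated {1, w}"
    and ppi: "w ^ n * star w ^ n * w ^ n = w ^ n"
    and comm: "(w ^ k * star w ^ k) * (star w ^ n * w ^ n) = (star w ^ n * w ^ n) * (w ^ k * star w ^ k)"
    and \<phi>: "star_hom B toeplitz_algebra \<phi>" "\<phi> 1 = 1" "\<phi> w = star shift"
    and \<kappa>: "star_hom B toeplitz_algebra \<kappa>" "\<kappa> 1 = 1" "\<kappa> w = shift"
    and \<Lambda>: "star_hom B UNIV (\<Lambda> n)" "\<Lambda> n 1 = 1" "\<Lambda> n w = proj_P n * shift"
begin

lemma B: "cstar_subalgebra B" "1 \<in> B" "w \<in> B" "star w \<in> B"
  using cstar_generated_superset[of "{1, w}"] cstar_subalgebra_generated[of "{1, w}"]
  by (auto simp: B_def cstar_subalgebraD(6))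

lemmas B_closed = cstar_subalgebraD[OF B(1)] cstar_subalgebra_power[OF B(1,2)]

text \<open>In the truncated shift on \<open>\<complex>\<^sup>n\<^sup>+\<^sup>1\<close> the element \<open>g m i j\<close> is the \<open>(i, j)\<close> matrix unit if \<open>m, i, j \<le> n\<close>,
  and \<open>0\<close> otherwise.\<close>

definition q :: "nat \<Rightarrow> 'h cop" where "q n = star w ^ n * w ^ n"
definition e :: "'h cop" where "e = 1 - w * star w"
definition g :: "nat \<Rightarrow> nat \<Rightarrow> nat \<Rightarrow> 'h cop" where "g m i j = w ^ i * q m * e * star w ^ j"
text \<open>The range of the section on Toeplitz polynomials: \<open>star w\<close> stands in the
  place of the shift.\<close>

definition Y :: "'h cop set" where "Y = lin_combs (\<lambda>(a, b). star w ^ a * w ^ b)"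
definition I0 :: "'h cop set" where "I0 = lin_combs (\<lambda>(m, i, j). g m i j)"

section \<open>Relations among \<open>q\<close>, \<open>e\<close> and \<open>g\<close>, and the
  ideal they span\<close>

lemma q_B: "q n \<in> B" and e_B: "e \<in> B" and g_B: "g m i j \<in> B"
proof -
  show 1: "q n \<in> B" "e \<in> B" for n
    by (auto simp: q_def e_def intro!: B_closed B)
  show "g m i j \<in> B"
    by (auto simp: g_def intro!: B_closed B 1)
qed

lemma Y_B: "Y \<subseteq> B"
  unfolding Y_def by (rule lin_combs_subset[OF B(1)]) (auto intro!: B_closed B)

lemma I0_B: "I0 \<subseteq> B"
  unfolding I0_def by (rule lin_combs_subset[OF B(1)]) (auto simp: g_B)

lemma closure_Y_B: "closure Y \<subseteq> B" and closure_I0_B: "closure I0 \<subseteq> B"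
  using closure_minimal[OF Y_B B_closed(1)] closure_minimal[OF I0_B B_closed(1)] .

lemma star_ppi: "star w ^ n * w ^ n * star w ^ n = star w ^ n"
  using arg_cong[OF ppi[of n], of star] by (simp add: star_mult star_power star_star mult.assoc)

lemma star_q: "star (q n) = q n"
  by (simp add: q_def star_mult star_power star_star)

lemma star_e: "star e = e"
  by (simp add: e_def star_diff star_one star_mult star_star)

lemma e_e: "e * e = e"
  using ppi[of 1] by (simp add: e_def algebra_simps) (simp flip: mult.assoc)

text \<open>The source projections of the powers decrease: for i \<le> m the factor w^i inside w^m
  absorbs \<open>q i\<close>.\<close>

lemma q_mult: "q i * q m = q (max i m)"
proof -
  have le: "q m * q i = q m" if "i \<le> m" for i m
  proof -
    have "w ^ m = w ^ (m - i) * w ^ i"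
      using that by (simp flip: power_add)
    then have "q m * q i = star w ^ m * (w ^ (m - i) * (w ^ i * star w ^ i * w ^ i))"
      by (simp add: q_def mult.assoc)
    also have "\<dots> = q m"
      unfolding ppi using \<open>w ^ m = _\<close> by (simp add: q_def)
    finally show ?thesis .
  qed
  show ?thesis
  proof (cases "i \<le> m")
    case True
    have "star (q m * q i) = star (q m)" using le[OF True] by simp
    then show ?thesis using True by (simp add: star_mult star_q max_absorb2)
  next
    case False
    then show ?thesis using le[of m i] by (simp add: max_absorb1)
  qed
qed

lemma e_q: "e * q m = q m * e"
  using comm[of 1 m] by (simp add: e_def q_def algebra_simps)

text \<open>Insert the range projection of w^k and commute it past \<open>star w * w\<close>. This
  rule lets \<open>star w\<close> lower the index i of \<open>g\<close> at the price of raising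
  m.\<close>

lemma q1_power: "star w * w * w ^ k = w ^ k * q (Suc k)"
proof -
  have "star w * w * w ^ k = star w ^ 1 * w ^ 1 * (w ^ k * star w ^ k) * w ^ k"
    by (simp add: mult.assoc ppi[unfolded mult.assoc])
  also have "\<dots> = w ^ k * star w ^ k * (star w ^ 1 * w ^ 1) * w ^ k"
    by (simp only: comm)
  also have "\<dots> = w ^ k * (star w ^ k * star w * (w * w ^ k))"
    by (simp add: mult.assoc)
  also have "\<dots> = w ^ k * q (Suc k)"
    by (simp add: q_def power_commutes mult.assoc)
  finally show ?thesis .
qed

lemma power_q: "w ^ i * q m = w ^ i * q (max i m)"
proof -
  have "w ^ i * q m = w ^ i * q i * q m"
    using ppi[of i] by (simp add: q_def flip: mult.assoc)
  also have "\<dots> = w ^ i * q (max i m)"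
    by (simp add: mult.assoc q_mult)
  finally show ?thesis .
qed

lemma star_g: "star (g m i j) = g m j i"
  by (simp add: g_def star_mult star_power star_star star_q star_e mult.assoc)
    (simp add: e_q flip: mult.assoc)

text \<open>The factor w^i absorbs \<open>q i\<close>, so m may be raised to i; by taking adjoints
  it may also be raised to j. Different m below max i j therefore give the same element.\<close>

lemma g_max: "g m i j = g (max m (max i j)) i j"
proof -
  have 1: "g m i j = g (max i m) i j" for m i j
    unfolding g_def by (simp only: power_q[of i m])
  have "g m i j = g (max i m) i j" by (rule 1)
  also have "\<dots> = star (g (max i m) j i)" by (simp add: star_g)
  also have "\<dots> = star (g (max j (max i m)) j i)" by (simp only: 1[of "max i m" j i])
  also have "\<dots> = g (max j (max i m)) i j" by (rule star_g)
  finally show ?thesis by (simp add: max.assoc max.commute max.left_commute)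
qed

lemma star_w_e: "star w * e = 0"
  using star_ppi[of 1] by (simp add: e_def algebra_simps)

text \<open>Multiplication by \<open>w\<close> raises i. Multiplication by \<open>star w\<close>
  lowers i by \<open>q1_power\<close>, or annihilates the element if i = 0, because
  \<open>star w * e\<close> = 0.\<close>

lemma I0_left: "x \<in> I0 \<Longrightarrow> w * x \<in> I0 \<and> star w * x \<in> I0"
  unfolding I0_def
proof (erule lin_combs_induct)
  fix c and p :: "nat \<times> nat \<times> nat" and x
  let ?G = "lin_combs (\<lambda>(m, i, j). g m i j)"
  assume x: "w * x \<in> ?G \<and> star w * x \<in> ?G"
  obtain m i j where p: "p = (m, i, j)" by (cases p)
  have "w * g m i j = g m (Suc i) j"
    by (simp add: g_def mult.assoc)
  then have "w * g m i j \<in> ?G"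
    using lin_combs_base[of "\<lambda>(m, i, j). g m i j" "(m, Suc i, j)"] by simp
  moreover have "star w * g m i j \<in> ?G"
  proof (cases i)
    case 0
    have "star w * g m i j = star w * (q m * e) * star w ^ j"
      by (simp add: g_def 0 mult.assoc)
    also have "\<dots> = star w * e * q m * star w ^ j"
      by (simp only: e_q[symmetric] mult.assoc)
    finally show ?thesis by (simp add: star_w_e lin_combs_zero)
  next
    case (Suc i')
    have "star w * g m i j = star w * w * w ^ i' * q m * e * star w ^ j"
      by (simp add: g_def Suc mult.assoc)
    also have "\<dots> = w ^ i' * (q (Suc i') * q m) * e * star w ^ j"
      unfolding q1_power by (simp only: mult.assoc)
    also have "\<dots> = g (max (Suc i') m) i' j"
      by (simp only: q_mult g_def)
    finally show ?thesis
      using lin_combs_base[of "\<lambda>(m, i, j). g m i j" "(max (Suc i') m, i', j)"] by simp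
  qed
  ultimately show "w * (c *\<^sub>C (case p of (m, i, j) \<Rightarrow> g m i j) + x) \<in> ?G \<and>
      star w * (c *\<^sub>C (case p of (m, i, j) \<Rightarrow> g m i j) + x) \<in> ?G"
    using x by (simp add: p distrib_left mult_scaleC_right lin_combs_add lin_combs_scaleC)
qed (simp add: lin_combs_zero)

lemma I0_star: "x \<in> I0 \<Longrightarrow> star x \<in> I0"
  unfolding I0_def
proof (erule lin_combs_induct)
  fix c and p :: "nat \<times> nat \<times> nat" and x
  let ?G = "lin_combs (\<lambda>(m, i, j). g m i j)"
  assume x: "star x \<in> ?G"
  obtain m i j where p: "p = (m, i, j)" by (cases p)
  show "star (c *\<^sub>C (case p of (m, i, j) \<Rightarrow> g m i j) + x) \<in> ?G"
    using x lin_combs_base[of "\<lambda>(m, i, j). g m i j" "(m, j, i)"]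
    by (simp add: p star_add star_scaleC star_g lin_combs_add lin_combs_scaleC)
qed (simp add: lin_combs_zero star_zero)

lemma I0_right: "x \<in> I0 \<Longrightarrow> x * w \<in> I0 \<and> x * star w \<in> I0"
  using I0_left[OF I0_star, of x] I0_star[of "star w * star x"] I0_star[of "w * star x"]
  by (simp add: star_mult star_star)

lemma I0_right_power: "x \<in> I0 \<Longrightarrow> x * (star w ^ a * w ^ b) \<in> I0"
proof -
  assume x: "x \<in> I0"
  have "x * star w ^ a \<in> I0"
    by (induction a) (auto simp: x power_Suc2 I0_right simp del: power_Suc simp flip: mult.assoc)
  then have "x * star w ^ a * w ^ b \<in> I0"
    by (induction b) (auto simp: power_Suc2 I0_right simp del: power_Suc simp flip: mult.assoc)
  then show ?thesis by (simp add: mult.assoc)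
qed

definition D :: "'h cop set" where "D = {y + x |y x. y \<in> Y \<and> x \<in> I0}"

lemma D_linear:
  "0 \<in> D" "x \<in> D \<Longrightarrow> y \<in> D \<Longrightarrow> x + y \<in> D" "x \<in> D \<Longrightarrow> c *\<^sub>C x \<in> D" "y \<in> Y \<Longrightarrow> y \<in> D" "y \<in> I0 \<Longrightarrow> y \<in> D"
proof -
  have 0: "0 \<in> Y" "0 \<in> I0" by (simp_all add: Y_def I0_def lin_combs_zero)
  show Y: "y \<in> Y \<Longrightarrow> y \<in> D" for y
    unfolding D_def using 0 by (intro CollectI exI[of _ y] exI[of _ 0]) simp
  show "y \<in> I0 \<Longrightarrow> y \<in> D"
    unfolding D_def using 0 by (intro CollectI exI[of _ 0] exI[of _ y]) simp
  show "0 \<in> D" using 0 Y by blast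
  show "x + y \<in> D" if "x \<in> D" "y \<in> D"
  proof -
    obtain a b c d where "x = a + b" "y = c + d" "a \<in> Y" "c \<in> Y" "b \<in> I0" "d \<in> I0"
      using \<open>x \<in> D\<close> \<open>y \<in> D\<close> unfolding D_def by blast
    then show ?thesis
      unfolding D_def Y_def I0_def
      by (intro CollectI exI[of _ "a + c"] exI[of _ "b + d"]) (simp add: lin_combs_add)
  qed
  show "c *\<^sub>C x \<in> D" if "x \<in> D"
  proof -
    obtain a b where "x = a + b" "a \<in> Y" "b \<in> I0"
      using \<open>x \<in> D\<close> unfolding D_def by blast
    then show ?thesis
      unfolding D_def Y_def I0_def
      by (intro CollectI exI[of _ "c *\<^sub>C a"] exI[of _ "c *\<^sub>C b"]) (simp add: lin_combs_scaleC scaleC_add_right)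
  qed
qed

text \<open>The only product that leaves the ordered form is \<open>w\<close> times a monomial
  beginning with \<open>star w\<close>. There \<open>w * star w\<close> = 1 - e, and the term with e
  falls into \<open>I0\<close>.\<close>

lemma Y_left: "y \<in> Y \<Longrightarrow> w * y \<in> D \<and> star w * y \<in> D"
  unfolding Y_def
proof (erule lin_combs_induct)
  let ?m = "\<lambda>(a, b). star w ^ a * w ^ b"
  fix c and p :: "nat \<times> nat" and x
  assume x: "w * x \<in> D \<and> star w * x \<in> D"
  obtain a b where p: "p = (a, b)" by (cases p)
  have base: "star w ^ a * w ^ b \<in> Y" for a b
    using lin_combs_base[of ?m "(a, b)"] by (simp add: Y_def)
  have "star w * ?m p = star w ^ Suc a * w ^ b"
    by (simp add: p mult.assoc)
  then have 1: "star w * ?m p \<in> D"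
    using D_linear(4)[OF base] by (simp only:)
  have 2: "w * ?m p \<in> D"
  proof (cases a)
    case 0
    then have "w * ?m p = star w ^ 0 * w ^ Suc b" by (simp add: p)
    then show ?thesis using D_linear(4)[OF base] by (simp only:)
  next
    case (Suc a')
    have "e = g 0 0 0" by (simp add: g_def q_def)
    then have "e \<in> I0"
      unfolding I0_def using lin_combs_base[of "\<lambda>(m, i, j). g m i j" "(0, 0, 0)"] by simp
    then have "(-1) *\<^sub>C (e * (star w ^ a' * w ^ b)) \<in> D"
      by (intro D_linear(3,5) I0_right_power)
    then have "star w ^ a' * w ^ b + (-1) *\<^sub>C (e * (star w ^ a' * w ^ b)) \<in> D"
      by (intro D_linear(2) D_linear(4)[OF base])
    also have "star w ^ a' * w ^ b + (-1) *\<^sub>C (e * (star w ^ a' * w ^ b)) = w * ?m p"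
      by (simp add: p Suc e_def scaleC_minus1 algebra_simps)
    finally show ?thesis .
  qed
  show "w * (c *\<^sub>C ?m p + x) \<in> D \<and> star w * (c *\<^sub>C ?m p + x) \<in> D"
    using x 1 2 by (simp only: distrib_left mult_scaleC_right D_linear simp_thms)
qed (simp add: D_linear)

lemma B_dense: "B \<subseteq> closure D"
  unfolding B_def
proof (rule cstar_generated_subset_closure)
  have "star w ^ 0 * w ^ 0 \<in> Y"
    unfolding Y_def using lin_combs_base[of "\<lambda>(a, b). star w ^ a * w ^ b" "(0, 0)"] by simp
  then show "1 \<in> D" using D_linear(4) by simp
  have *: "w * x \<in> D \<and> star w * x \<in> D" if "x \<in> D" for x
  proof -
    obtain a b where "x = a + b" "a \<in> Y" "b \<in> I0"
      using \<open>x \<in> D\<close> unfolding D_def by blast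
    then show ?thesis
      using Y_left[of a] I0_left[of b] by (simp add: distrib_left D_linear)
  qed
  show "s * x \<in> D" "star s * x \<in> D" if "s \<in> {1, w}" "x \<in> D" for s x
    using *[OF that(2)] that by (auto simp: star_one)
qed (fact D_linear(1-3))+

section \<open>The contractive section, the kernel and the image of \<open>\<phi>\<close>\<close>

lemma \<phi>_star_w: "\<phi> (star w) = shift"
  using star_homD(5)[OF \<phi>(1) B(3)] by (simp add: \<phi> star_star)

lemma \<phi>_monomial: "\<phi> (star w ^ a * w ^ b) = shift ^ a * star shift ^ b"
  by (simp add: star_homD[OF \<phi>(1)] B_closed B star_hom_power[OF \<phi>(1) B(1,2) \<phi>(2)] \<phi> \<phi>_star_w)

lemma Y_norm_le:
  assumes "y \<in> Y"
  shows "norm y \<le> norm (\<phi> y)"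
proof -
  obtain F c where F: "finite F" and y: "y = (\<Sum>(a, b)\<in>F. c (a, b) *\<^sub>C (star w ^ a * w ^ b))"
    using assms unfolding Y_def lin_combs_def by (auto simp: case_prod_beta)
  have "\<phi> y = (\<Sum>(a, b)\<in>F. c (a, b) *\<^sub>C (shift ^ a * star shift ^ b))"
    unfolding y
    by (subst star_hom_sum[OF \<phi>(1) B(1)])
      (auto simp: star_homD[OF \<phi>(1)] \<phi>_monomial B_closed B intro!: sum.cong)
  then show ?thesis
    using toeplitz_monomials_norm_le[OF ppi[of 1, simplified] F, of c] y by simp
qed

lemma \<phi>_g: "\<phi> (g m i j) = 0"
proof -
  have "\<phi> e = 0"
    by (simp add: e_def star_hom_linear[OF \<phi>(1) B(1)] star_homD[OF \<phi>(1)] B_closed B \<phi> \<phi>_star_w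
        star_shift_shift)
  then show ?thesis
    by (simp add: g_def star_homD[OF \<phi>(1)] B_closed B q_B e_B)
qed

lemma \<phi>_I0: "x \<in> I0 \<Longrightarrow> \<phi> x = 0"
proof -
  assume "x \<in> I0"
  then obtain F c where "finite F" and x: "x = (\<Sum>(m, i, j)\<in>F. c (m, i, j) *\<^sub>C g m i j)"
    unfolding I0_def lin_combs_def by (auto simp: case_prod_beta)
  then show ?thesis
    by (subst x, subst star_hom_sum[OF \<phi>(1) B(1)])
      (auto simp: star_homD[OF \<phi>(1)] \<phi>_g g_B B_closed scaleC_zero_right intro!: sum.neutral)
qed

lemma norm_closure_Y: "y \<in> closure Y \<Longrightarrow> norm y \<le> norm (\<phi> y)"
proof -
  assume y: "y \<in> closure Y"
  then obtain X where X: "\<And>n. X n \<in> Y" "X \<longlonglongrightarrow> y"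
    unfolding closure_sequential by blast
  have "(\<lambda>n. \<phi> (X n)) \<longlonglongrightarrow> \<phi> y"
    using X y Y_B closure_Y_B by (intro star_hom_tendsto[OF B(1) \<phi>(1)]) auto
  then show ?thesis
    using X Y_norm_le by (intro LIMSEQ_le[OF tendsto_norm[OF X(2)] tendsto_norm]) auto
qed

lemma \<phi>_closure_I0: "x \<in> closure I0 \<Longrightarrow> \<phi> x = 0"
proof -
  assume x: "x \<in> closure I0"
  then obtain X where X: "\<And>n. X n \<in> I0" "X \<longlonglongrightarrow> x"
    unfolding closure_sequential by blast
  have "(\<lambda>n. \<phi> (X n)) \<longlonglongrightarrow> \<phi> x"
    using X x I0_B closure_I0_B by (intro star_hom_tendsto[OF B(1) \<phi>(1)]) auto
  then show ?thesis
    using X \<phi>_I0 by (simp add: LIMSEQ_const_iff)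
qed

text \<open>For y in \<open>Y\<close> and i in \<open>I0\<close> one has |y| \<le> |\<phi> y| =
  |\<phi> (y + i)| \<le> |y + i|, so \<open>closed_sum_decomposition\<close> applies to the dense
  subspace \<open>D\<close>. The \<open>Y\<close>-part of a kernel element is killed by
  \<open>\<phi>\<close> and thus is 0.\<close>

lemma kernel_eq: "hom_kernel B \<phi> = closure I0"
proof (intro equalityI subsetI)
  fix x assume "x \<in> closure I0"
  then show "x \<in> hom_kernel B \<phi>"
    using closure_I0_B \<phi>_closure_I0 by (auto simp: hom_kernel_def)
next
  fix x assume "x \<in> hom_kernel B \<phi>"
  then have x: "x \<in> B" "\<phi> x = 0" by (auto simp: hom_kernel_def)
  have le: "norm y \<le> norm (y + i)" if "y \<in> Y" "i \<in> I0" for y i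
  proof -
    have yi: "y \<in> B" "i \<in> B" using that Y_B I0_B by auto
    have "norm y \<le> norm (\<phi> y)" using that by (rule_tac Y_norm_le)
    also have "\<phi> y = \<phi> (y + i)"
      using yi \<phi>_I0[OF that(2)] by (simp add: star_homD[OF \<phi>(1)])
    also have "norm \<dots> \<le> norm (y + i)"
      using yi by (intro star_hom_norm_le[OF B(1) \<phi>(1)] B_closed)
    finally show ?thesis .
  qed
  have "x \<in> closure {y + i |y i. y \<in> Y \<and> i \<in> I0}"
    using x(1) B_dense unfolding D_def by blast
  have "\<exists>y\<in>closure Y. \<exists>i\<in>closure I0. x = y + i"
    by (rule closed_sum_decomposition[OF _ _ le \<open>x \<in> closure _\<close>]) (simp_all add: Y_def I0_def lin_combs_diff)
  then obtain y i where yi: "y \<in> closure Y" "i \<in> closure I0" "x = y + i"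
    by blast
  have "\<phi> y = 0"
    using yi closure_Y_B closure_I0_B x \<phi>_closure_I0[OF yi(2)] star_homD(2)[OF \<phi>(1), of y i] by auto
  with norm_closure_Y[OF yi(1)] yi show "x \<in> closure I0" by simp
qed

text \<open>Toeplitz polynomials lift to \<open>Y\<close>, and \<open>Y_norm_le\<close> makes the
  lifts of a convergent sequence Cauchy.\<close>

lemma \<phi>_surj: "\<phi> ` B = toeplitz_algebra"
proof
  show "\<phi> ` B \<subseteq> toeplitz_algebra" using star_homD(1)[OF \<phi>(1)] by blast
  show "toeplitz_algebra \<subseteq> \<phi> ` B"
  proof
    fix t assume "t \<in> toeplitz_algebra"
    then have t: "t \<in> closure (lin_combs (\<lambda>(a, b). shift ^ a * star shift ^ b))"
      by (rule subsetD[OF toeplitz_dense])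
    have lift: "\<exists>y\<in>Y. \<phi> y = u" if u: "u \<in> lin_combs (\<lambda>(a, b). shift ^ a * star shift ^ b)" for u
      using u
    proof (rule lin_combs_induct)
      show "\<exists>y\<in>Y. \<phi> y = 0"
        using star_hom_linear[OF \<phi>(1) B(1)] lin_combs_zero unfolding Y_def by blast
      fix c and p :: "nat \<times> nat" and x
      assume "\<exists>y\<in>Y. \<phi> y = x"
      then obtain y where y: "y \<in> Y" "\<phi> y = x" by blast
      obtain a b where p: "p = (a, b)" by (cases p)
      have "c *\<^sub>C (star w ^ a * w ^ b) + y \<in> Y"
        using y lin_combs_base[of "\<lambda>(a, b). star w ^ a * w ^ b" "(a, b)"]
        unfolding Y_def by (intro lin_combs_add lin_combs_scaleC) auto
      moreover have "\<phi> (c *\<^sub>C (star w ^ a * w ^ b) + y) = c *\<^sub>C (shift ^ a * star shift ^ b) + x"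
        using y Y_B by (subst star_homD(2)[OF \<phi>(1)])
          (auto simp: star_homD(4)[OF \<phi>(1)] \<phi>_monomial B_closed B)
      ultimately show "\<exists>y\<in>Y. \<phi> y = c *\<^sub>C (case p of (a, b) \<Rightarrow> shift ^ a * star shift ^ b) + x"
        unfolding p by auto
    qed
    have "\<exists>l\<in>closure Y. \<forall>\<epsilon>>0. \<exists>y\<in>Y. norm (\<phi> y - t) \<le> \<epsilon> \<and> norm (l - y) \<le> \<epsilon>"
    proof (rule approximation_limit)
      fix \<epsilon> :: real
      assume "\<epsilon> > 0"
      then obtain u where u: "u \<in> lin_combs (\<lambda>(a, b). shift ^ a * star shift ^ b)" "dist u t < \<epsilon>"
        using t unfolding closure_approachable by blast
      with lift[OF u(1)] show "\<exists>y\<in>Y. norm (\<phi> y - t) \<le> \<epsilon>"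
        by (auto simp: dist_norm intro: less_imp_le)
    next
      fix y z \<delta> \<epsilon>
      assume yz: "y \<in> Y" "z \<in> Y" and *: "norm (\<phi> y - t) \<le> \<delta>" "norm (\<phi> z - t) \<le> \<epsilon>"
      have "norm (y - z) \<le> norm (\<phi> (y - z))"
        using yz by (intro Y_norm_le) (simp add: Y_def lin_combs_diff)
      also have "\<phi> (y - z) = (\<phi> y - t) - (\<phi> z - t)"
        using yz Y_B by (simp add: star_hom_linear[OF \<phi>(1) B(1)] subset_iff)
      also have "norm \<dots> \<le> \<delta> + \<epsilon>"
        by (rule order_trans[OF norm_triangle_ineq4]) (rule add_mono[OF *])
      finally show "norm (y - z) \<le> \<delta> + \<epsilon>" .
    qed
    then obtain l where l: "l \<in> closure Y"
      "\<And>\<epsilon>. \<epsilon> > 0 \<Longrightarrow> \<exists>y\<in>Y. norm (\<phi> y - t) \<le> \<epsilon> \<and> norm (l - y) \<le> \<epsilon>"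
      by blast
    have lB: "l \<in> B" using l(1) closure_Y_B by blast
    have "norm (\<phi> l - t) \<le> 0"
    proof (rule field_le_epsilon)
      fix \<epsilon> :: real
      assume "\<epsilon> > 0"
      then obtain y where y: "y \<in> Y" "norm (\<phi> y - t) \<le> \<epsilon> / 2" "norm (l - y) \<le> \<epsilon> / 2"
        using l(2)[of "\<epsilon> / 2"] by auto
      then have yB: "y \<in> B" using Y_B by blast
      have eq: "\<phi> l - t = \<phi> (l - y) + (\<phi> y - t)"
        using lB yB by (simp add: star_hom_linear[OF \<phi>(1) B(1)])
      have "norm (\<phi> (l - y)) \<le> norm (l - y)"
        using lB yB by (intro star_hom_norm_le[OF B(1) \<phi>(1)] B_closed)
      then show "norm (\<phi> l - t) \<le> 0 + \<epsilon>"
        unfolding eq using y(2,3) norm_triangle_ineq[of "\<phi> (l - y)" "\<phi> y - t"] by linarith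
    qed
    with lB show "t \<in> \<phi> ` B" by auto
  qed
qed

end

section \<open>The kernel as an algebra of sequences of compact operators\<close>

context toeplitz_extension
begin

text \<open>The projection discards the vectors beyond e_n, where \<open>\<Lambda> n\<close> sends
  \<open>w\<close> to 0 and hence \<open>e\<close> to the identity.\<close>

definition \<pi> :: "'h cop \<Rightarrow> nat \<Rightarrow> ell2 cop" where "\<pi> b n = proj_P n * \<Lambda> n b"

lemma \<Lambda>_star_w: "\<Lambda> n (star w) = star (proj_P n * shift)"
  using star_homD(5)[OF \<Lambda>(1) B(3)] by (simp add: \<Lambda>)

lemma truncated_shift_proj_P: "proj_P n * (proj_P n * shift) = proj_P n * shift"
  "proj_P n * shift * proj_P n = proj_P n * shift"
  by (intro cop_eqI ell2_eqI; auto simp: cop_apply_mult ell2_nth_proj_P ell2_nth_shift split: nat.split)+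

text \<open>The elements whose images commute with the projection form a C*-subalgebra containing 1
  and \<open>w\<close>. The commutation is what makes \<open>\<pi>\<close> multiplicative and
  compatible with adjoints.\<close>

lemma proj_P_commute:
  assumes "b \<in> B"
  shows "proj_P n * \<Lambda> n b = \<Lambda> n b * proj_P n"
proof -
  let ?L = "\<Lambda> n"
  have "cstar_subalgebra {b \<in> B. proj_P n * ?L b = ?L b * proj_P n}" (is "cstar_subalgebra ?C")
    unfolding cstar_subalgebra_def
  proof (intro conjI ballI allI)
    show "closed ?C"
      unfolding closed_sequential_limits
    proof (intro allI impI, elim conjE)
      fix x l
      assume x: "\<forall>k. x k \<in> ?C" "x \<longlonglongrightarrow> l"
      then have "\<And>k. x k \<in> B" by blast
      then have lB: "l \<in> B"
        using closed_sequentially[OF B_closed(1) _ x(2)] by blast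
      have L: "(\<lambda>k. ?L (x k)) \<longlonglongrightarrow> ?L l"
        by (rule star_hom_tendsto[OF B(1) \<Lambda>(1) \<open>\<And>k. x k \<in> B\<close> lB x(2)])
      have "(\<lambda>k. proj_P n * ?L (x k)) \<longlonglongrightarrow> proj_P n * ?L l"
        by (intro tendsto_mult tendsto_const L)
      moreover have "(\<lambda>k. proj_P n * ?L (x k)) \<longlonglongrightarrow> ?L l * proj_P n"
        using tendsto_mult[OF L tendsto_const[of "proj_P n"]] x(1) by simp
      ultimately show "l \<in> ?C"
        using lB LIMSEQ_unique by blast
    qed
  next
    fix x assume x: "x \<in> ?C"
    then have "star (proj_P n * ?L x) = star (?L x * proj_P n)" by simp
    then have "star (?L x) * proj_P n = proj_P n * star (?L x)"
      by (simp only: star_mult star_proj_P)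
    with x show "star x \<in> ?C"
      by (simp add: star_homD[OF \<Lambda>(1)] B_closed)
  next
    fix x y assume xy: "x \<in> ?C" "y \<in> ?C"
    have "proj_P n * (?L x * ?L y) = proj_P n * ?L x * ?L y" by (simp only: mult.assoc)
    also have "proj_P n * ?L x = ?L x * proj_P n" using xy by blast
    also have "?L x * proj_P n * ?L y = ?L x * (proj_P n * ?L y)" by (simp only: mult.assoc)
    also have "proj_P n * ?L y = ?L y * proj_P n" using xy by blast
    also have "?L x * (?L y * proj_P n) = ?L x * ?L y * proj_P n" by (simp only: mult.assoc)
    finally show "x * y \<in> ?C"
      using xy by (simp add: star_homD[OF \<Lambda>(1)] B_closed)
  qed (auto simp: star_hom_linear[OF \<Lambda>(1) B(1)] star_homD[OF \<Lambda>(1)] B_closed distrib_left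
      distrib_right mult_scaleC_left mult_scaleC_right)
  moreover have "{1, w} \<subseteq> ?C"
    using B by (simp add: \<Lambda> truncated_shift_proj_P)
  ultimately have "B \<subseteq> ?C"
    unfolding B_def by (intro cstar_generated_minimal)
  with assms show ?thesis by blast
qed

lemma \<pi>_add: "a \<in> B \<Longrightarrow> b \<in> B \<Longrightarrow> \<pi> (a + b) n = \<pi> a n + \<pi> b n"
  by (simp add: \<pi>_def star_homD[OF \<Lambda>(1)] distrib_left)

lemma \<pi>_diff: "a \<in> B \<Longrightarrow> b \<in> B \<Longrightarrow> \<pi> (a - b) n = \<pi> a n - \<pi> b n"
  by (simp add: \<pi>_def star_hom_linear[OF \<Lambda>(1) B(1)] right_diff_distrib)

lemma \<pi>_scaleC: "a \<in> B \<Longrightarrow> \<pi> (c *\<^sub>C a) n = c *\<^sub>C \<pi> a n"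
  by (simp add: \<pi>_def star_homD[OF \<Lambda>(1)] mult_scaleC_right)

lemma \<pi>_zero: "\<pi> 0 n = 0"
  by (simp add: \<pi>_def star_hom_linear[OF \<Lambda>(1) B(1)])

lemma \<pi>_sum: "(\<And>i. i \<in> F \<Longrightarrow> f i \<in> B) \<Longrightarrow> \<pi> (sum f F) n = (\<Sum>i\<in>F. \<pi> (f i) n)"
  by (simp add: \<pi>_def star_hom_sum[OF \<Lambda>(1) B(1)] sum_distrib_left)

lemma \<pi>_mult: "a \<in> B \<Longrightarrow> b \<in> B \<Longrightarrow> \<pi> (a * b) n = \<pi> a n * \<pi> b n"
proof -
  assume ab: "a \<in> B" "b \<in> B"
  have "proj_P n * \<Lambda> n a * (proj_P n * \<Lambda> n b) = proj_P n * (\<Lambda> n a * proj_P n) * \<Lambda> n b"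
    by (simp add: mult.assoc)
  also have "\<dots> = (proj_P n * proj_P n) * \<Lambda> n a * \<Lambda> n b"
    by (simp add: proj_P_commute[OF ab(1), symmetric] mult.assoc)
  finally show ?thesis
    using ab by (simp add: \<pi>_def star_homD[OF \<Lambda>(1)] proj_P_mult mult.assoc)
qed

lemma \<pi>_star: "a \<in> B \<Longrightarrow> \<pi> (star a) n = star (\<pi> a n)"
  using proj_P_commute[of "star a" n]
  by (simp add: \<pi>_def star_homD[OF \<Lambda>(1)] star_mult star_proj_P B_closed)

lemma \<pi>_sandwich: "a \<in> B \<Longrightarrow> \<pi> a n = proj_P n * (proj_P n * \<Lambda> n a * proj_P n) * proj_P n"
proof -
  assume a: "a \<in> B"
  have "proj_P n * (proj_P n * \<Lambda> n a * proj_P n) * proj_P n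
      = (proj_P n * proj_P n) * \<Lambda> n a * (proj_P n * proj_P n)"
    by (simp only: mult.assoc)
  also have "\<dots> = proj_P n * (\<Lambda> n a * proj_P n)"
    by (simp add: proj_P_mult mult.assoc)
  also have "\<dots> = (proj_P n * proj_P n) * \<Lambda> n a"
    by (simp add: proj_P_commute[OF a, symmetric] mult.assoc)
  finally show ?thesis by (simp add: \<pi>_def proj_P_mult)
qed

lemma norm_\<pi>_le: "a \<in> B \<Longrightarrow> norm (\<pi> a n) \<le> norm a"
proof -
  assume a: "a \<in> B"
  have "norm (\<pi> a n) \<le> norm (proj_P n) * norm (\<Lambda> n a)"
    unfolding \<pi>_def by (rule norm_mult_ineq)
  also have "\<dots> \<le> 1 * norm a"
    using star_hom_norm_le[OF B(1) \<Lambda>(1) a] norm_proj_P_le by (intro mult_mono) auto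
  finally show ?thesis by simp
qed

lemma \<pi>_g: "\<pi> (g m i j) n = (if max m (max i j) \<le> n then matrix_unit i j else 0)"
proof -
  define W where "W = proj_P n * shift"
  note W_nth = ell2_nth_truncated_shift[of n, folded W_def]
    ell2_nth_truncated_shift_power[of n, folded W_def] ell2_nth_star_truncated_shift_power[of n, folded W_def]
  have "\<Lambda> n (g m i j) = W ^ i * (star W ^ m * W ^ m) * (1 - W * star W) * star W ^ j"
    by (simp add: g_def q_def e_def star_homD[OF \<Lambda>(1)] star_hom_linear[OF \<Lambda>(1) B(1)] B_closed B
        star_hom_power[OF \<Lambda>(1) B(1,2) \<Lambda>(2)] \<Lambda> \<Lambda>_star_w W_def)
  then have eq: "\<pi> (g m i j) n = proj_P n * (W ^ i * (star W ^ m * (W ^ m * ((1 - W * star W) * star W ^ j))))"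
    by (simp add: \<pi>_def mult.assoc)
  show ?thesis
  proof (intro cop_eqI ell2_eqI)
    fix x k
    define z where "z = cop_apply ((1 - W * star W) * star W ^ j) x"
    \<comment> \<open>Positions beyond n contribute only if j = 0, as every positive power of the
      truncated shift and of its adjoint vanishes there. The final \<open>proj_P n\<close> removes
      this remainder.\<close>
    have z: "ell2_nth z k = (if k = 0 then if j \<le> n then ell2_nth x j else 0
        else if n < k \<and> j = 0 then ell2_nth x k else 0)" for k
      by (simp only: z_def cop_apply_mult minus_cop.rep_eq one_cop.rep_eq ell2_nth_simps W_nth) auto
    define y where "y = cop_apply (star W ^ m) (cop_apply (W ^ m) z)"
    have y: "ell2_nth y k = (if k = 0 then if j \<le> n \<and> m \<le> n then ell2_nth x j else 0
        else if n < k \<and> j = 0 \<and> m = 0 then ell2_nth x k else 0)" for k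
      by (simp only: y_def W_nth z) auto
    have "cop_apply (\<pi> (g m i j) n) x = cop_apply (proj_P n) (cop_apply (W ^ i) y)"
      by (simp only: eq y_def z_def cop_apply_mult)
    then show "ell2_nth (cop_apply (\<pi> (g m i j) n) x) k
        = ell2_nth (cop_apply (if max m (max i j) \<le> n then matrix_unit i j else 0) x) k"
      by (simp only: ell2_nth_proj_P W_nth y)
        (auto simp: ell2_nth_matrix_unit cop_apply_simps ell2_nth_simps)
  qed
qed

text \<open>The shift is an isometry, so \<open>q m\<close> goes to 1 and m disappears. The result
  is the value that \<open>\<pi>_g\<close> gives for all large n.\<close>

lemma \<kappa>_g: "\<kappa> (g m i j) = matrix_unit i j"
proof -
  have "\<kappa> (star w) = star shift"
    using star_homD(5)[OF \<kappa>(1) B(3)] by (simp add: \<kappa>)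
  moreover have "star shift ^ m * shift ^ m = 1" for m
  proof (induction m)
    case (Suc m)
    have "star shift ^ Suc m * shift ^ Suc m = star shift ^ m * (star shift * shift) * shift ^ m"
      by (simp only: power_Suc2[of "star shift"] power_Suc[of shift] mult.assoc)
    with Suc show ?case by (simp add: star_shift_shift)
  qed simp
  ultimately show ?thesis
    by (simp add: g_def q_def e_def matrix_unit_def star_homD[OF \<kappa>(1)] star_hom_linear[OF \<kappa>(1) B(1)]
        B_closed B star_hom_power[OF \<kappa>(1) B(1,2) \<kappa>(2)] \<kappa>)
qed

section \<open>Bessel inequalities and the norm on the kernel\<close>

lemma norm_diff_q:
  "(norm (cop_apply (q n - q (Suc n)) x))\<^sup>2 = (norm (cop_apply (q n) x))\<^sup>2 - (norm (cop_apply (q (Suc n)) x))\<^sup>2"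
proof -
  have p: "(norm (cop_apply p x))\<^sup>2 = Re (cinner x (cop_apply p x))" if "star p = p" "p * p = p" for p
    using cinner_projection[OF that, of x x] by (simp add: norm_sq_cinner)
  have "(q n - q (Suc n)) * (q n - q (Suc n)) = q n - q (Suc n)"
    by (simp add: algebra_simps q_mult)
  then show ?thesis
    using p[of "q n"] p[of "q (Suc n)"] p[of "q n - q (Suc n)"]
    by (simp add: star_q star_diff q_mult cop_apply_simps cinner_diff_right)
qed

lemma norm_e: "(norm (cop_apply e x))\<^sup>2 = (norm x)\<^sup>2 - (norm (cop_apply (star w) x))\<^sup>2"
proof -
  have "(norm (cop_apply e x))\<^sup>2 = Re (cinner x (cop_apply e x))"
    using cinner_projection[OF star_e e_e, of x x] by (simp add: norm_sq_cinner)
  also have "\<dots> = (norm x)\<^sup>2 - (norm (cop_apply (star w) x))\<^sup>2"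
    by (simp add: e_def cop_apply_simps cinner_diff_right norm_sq_cinner cinner_star_left)
  finally show ?thesis .
qed

text \<open>A partition of 1 into the jumps of the decreasing projections \<open>q n\<close>, with
  the tail collected in the last term. On the range of \<open>e\<close> the jump at n singles out
  the part on which \<open>w\<close> generates a truncated shift of size n + 1.\<close>

definition r :: "nat \<Rightarrow> nat \<Rightarrow> 'h cop" where "r N n = (if n < N then q n - q (Suc n) else q N)"

lemma r_projection: "star (r N n) = r N n" "r N n * r N n = r N n"
  by (simp_all add: r_def star_diff star_q algebra_simps q_mult)

lemma r_sum: "M \<le> N \<Longrightarrow> (\<Sum>n\<in>{M..N}. r N n) = q M"
proof (induction "N - M" arbitrary: M)
  case 0
  then show ?case by (simp add: r_def)
next
  case (Suc d)
  then have "M < N" by simp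
  then have "{M..N} = insert M {Suc M..N}" by auto
  with Suc \<open>M < N\<close> show ?case by (simp add: r_def)
qed

lemma r_bessel: "(\<Sum>n\<le>N. (norm (cop_apply (r N n) x))\<^sup>2) = (norm x)\<^sup>2"
proof -
  have "(\<Sum>n\<le>N. (norm (cop_apply (r N n) x))\<^sup>2)
      = (\<Sum>n<N. (norm (cop_apply (r N n) x))\<^sup>2) + (norm (cop_apply (r N N) x))\<^sup>2"
    by (simp flip: lessThan_Suc_atMost)
  also have "(\<Sum>n<N. (norm (cop_apply (r N n) x))\<^sup>2)
      = (\<Sum>n<N. (norm (cop_apply (q n) x))\<^sup>2 - (norm (cop_apply (q (Suc n)) x))\<^sup>2)"
    by (intro sum.cong) (auto simp: r_def norm_diff_q)
  also have "\<dots> = (norm (cop_apply (q 0) x))\<^sup>2 - (norm (cop_apply (q N) x))\<^sup>2"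
    by (rule sum_lessThan_telescope')
  finally show ?thesis by (simp add: r_def q_def[of 0] one_cop.rep_eq)
qed

lemma e_bessel: "(\<Sum>j<N. (norm (cop_apply e (cop_apply (star w ^ j) x)))\<^sup>2) \<le> (norm x)\<^sup>2"
proof -
  have "(\<Sum>j<N. (norm (cop_apply e (cop_apply (star w ^ j) x)))\<^sup>2)
      = (\<Sum>j<N. (norm (cop_apply (star w ^ j) x))\<^sup>2 - (norm (cop_apply (star w ^ Suc j) x))\<^sup>2)"
    by (simp add: norm_e cop_apply_mult)
  also have "\<dots> = (norm (cop_apply (star w ^ 0) x))\<^sup>2 - (norm (cop_apply (star w ^ N) x))\<^sup>2"
    by (rule sum_lessThan_telescope')
  finally show ?thesis by (simp add: one_cop.rep_eq)
qed

text \<open>With \<open>x\<^sub>n\<^sub>j = r\<^sub>n e w\<^sup>*\<^sup>j x\<close> the coefficient \<open>\<langle>y, a x\<rangle>\<close> of \<open>a \<in> I0\<close> is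
  \<open>\<Sum>\<^sub>n \<Sum>\<^sub>i\<^sub>j \<pi>(a)(n)\<^sub>i\<^sub>j \<langle>y\<^sub>n\<^sub>i, x\<^sub>n\<^sub>j\<rangle>\<close>.\<close>

lemma I0_coefficient:
  assumes "a \<in> I0"
  shows "\<exists>N0. \<forall>N\<ge>N0. cinner y (cop_apply a x) = (\<Sum>n\<le>N. \<Sum>i<Suc N. \<Sum>j<Suc N. entry (\<pi> a n) i j *
    cinner (cop_apply (r N n) (cop_apply e (cop_apply (star w ^ i) y)))
      (cop_apply (r N n) (cop_apply e (cop_apply (star w ^ j) x))))"
    (is "\<exists>N0. \<forall>N\<ge>N0. ?L a = ?R N a")
  using assms unfolding I0_def
proof (rule lin_combs_induct)
  show "\<exists>N0. \<forall>N\<ge>N0. ?L 0 = ?R N 0"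
    by (simp add: \<pi>_zero entry_simps cop_apply_simps)
next
  fix c and p :: "nat \<times> nat \<times> nat" and a
  assume a: "a \<in> lin_combs (\<lambda>(m, i, j). g m i j)" and "\<exists>N0. \<forall>N\<ge>N0. ?L a = ?R N a"
  then obtain N0 where N0: "\<And>N. N \<ge> N0 \<Longrightarrow> ?L a = ?R N a" by blast
  obtain m i j where p: "p = (m, i, j)" by (cases p)
  define M where "M = max m (max i j)"
  have aB: "a \<in> B" using a I0_B unfolding I0_def by blast
  have "?L (c *\<^sub>C g m i j + a) = ?R N (c *\<^sub>C g m i j + a)" if N: "N \<ge> max N0 M" for N
  proof -
    let ?y = "cop_apply e (cop_apply (star w ^ i) y)" and ?x = "cop_apply e (cop_apply (star w ^ j) x)"
    let ?c = "\<lambda>n i j. cinner (cop_apply (r N n) (cop_apply e (cop_apply (star w ^ i) y)))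
      (cop_apply (r N n) (cop_apply e (cop_apply (star w ^ j) x)))"
    have ent: "entry (\<pi> (g m i j) n) i' j' = (if M \<le> n \<and> i' = i \<and> j' = j then 1 else 0)" for n i' j'
      by (auto simp: \<pi>_g M_def entry_def ell2_nth_matrix_unit ket.rep_eq cop_apply_simps ell2_nth_simps)
    have ij: "i < Suc N" "j < Suc N" using N by (auto simp: M_def)
    \<comment> \<open>Only the entry (i, j) with M \<le> n \<le> N contributes. The corresponding
      \<open>r N n\<close> add up to \<open>q M\<close>, and since \<open>e\<close> is a projection
      commuting with \<open>q M\<close> the result is the coefficient of \<open>g M i j\<close>,
      which equals \<open>g m i j\<close>.\<close>
    have "?R N (g m i j) = (\<Sum>n\<le>N. if M \<le> n then ?c n i j else 0)"
    proof (rule sum.cong[OF refl])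
      fix n
      have "(\<Sum>j'<Suc N. entry (\<pi> (g m i j) n) i' j' * ?c n i' j')
          = (if i' = i then if M \<le> n then ?c n i j else 0 else 0)" for i'
      proof -
        have "(\<Sum>j'<Suc N. entry (\<pi> (g m i j) n) i' j' * ?c n i' j')
            = (\<Sum>j'<Suc N. if j' = j then if i' = i then if M \<le> n then ?c n i j else 0 else 0 else 0)"
          by (rule sum.cong[OF refl]) (simp add: ent)
        then show ?thesis
          using ij by (simp only: sum.delta finite_lessThan lessThan_iff if_True)
      qed
      then show "(\<Sum>i'<Suc N. \<Sum>j'<Suc N. entry (\<pi> (g m i j) n) i' j' * ?c n i' j')
          = (if M \<le> n then ?c n i j else 0)"
        using ij by (simp only: sum.delta finite_lessThan lessThan_iff if_True)
    qed
    also have "\<dots> = (\<Sum>n\<in>{M..N}. ?c n i j)"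
      by (rule sum.mono_neutral_cong_right) auto
    also have "\<dots> = (\<Sum>n\<in>{M..N}. cinner ?y (cop_apply (r N n) ?x))"
      by (simp only: cinner_projection[OF r_projection])
    also have "\<dots> = cinner ?y (cop_apply (q M) ?x)"
      using N by (simp add: r_sum flip: cinner_sum_right cop_apply_sum_left)
    also have "\<dots> = cinner (cop_apply (star w ^ i) y) (cop_apply (e * q M * e * star w ^ j) x)"
      by (simp only: cop_apply_mult cinner_star_left[of e, unfolded star_e])
    also have "\<dots> = cinner y (cop_apply (w ^ i * (e * q M * e * star w ^ j)) x)"
      by (simp only: cop_apply_mult cinner_star_left star_power[symmetric])
    also have "w ^ i * (e * q M * e * star w ^ j) = g m i j"
    proof -
      have "w ^ i * (e * q M * e * star w ^ j) = w ^ i * (q M * (e * e)) * star w ^ j"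
        by (simp only: e_q mult.assoc)
      also have "\<dots> = g M i j" by (simp only: e_e g_def mult.assoc)
      finally show ?thesis by (simp only: M_def g_max[symmetric])
    qed
    finally have "?R N (g m i j) = ?L (g m i j)" .
    moreover have "?R N (c *\<^sub>C g m i j + a) = c * ?R N (g m i j) + ?R N a"
    proof -
      have "entry (\<pi> (c *\<^sub>C g m i j + a) n) i' j'
          = c * entry (\<pi> (g m i j) n) i' j' + entry (\<pi> a n) i' j'" for n i' j'
        by (simp add: \<pi>_add \<pi>_scaleC aB g_B B_closed entry_simps)
      then show ?thesis
        by (simp only: distrib_right sum.distrib sum_distrib_left mult.assoc)
    qed
    moreover have "?L (c *\<^sub>C g m i j + a) = c * ?L (g m i j) + ?L a"
      by (simp add: cop_apply_simps cinner_add_right cinner_scaleC_right)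
    moreover have "?L a = ?R N a" using N by (intro N0) simp
    ultimately show ?thesis by (simp only:)
  qed
  then show "\<exists>N0. \<forall>N\<ge>N0. ?L (c *\<^sub>C (case p of (m, i, j) \<Rightarrow> g m i j) + a)
      = ?R N (c *\<^sub>C (case p of (m, i, j) \<Rightarrow> g m i j) + a)"
    unfolding p prod.case by blast
qed

text \<open>The amplification bound is applied for each n separately. Summing over n uses that the
  pieces \<open>r N n\<close> partition each vector e w*^j x, and that the squared norms of these
  vectors sum to at most |x|^2.\<close>

lemma I0_norm_le:
  assumes a: "a \<in> I0" and M: "\<And>n. norm (\<pi> a n) \<le> M"
  shows "norm a \<le> M"
proof (rule norm_le_cinner_bound)
  show "0 \<le> M" using order_trans[OF norm_ge_zero M] .
  then have M2: "0 \<le> M / 2" by simp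
  fix x y
  let ?v = "\<lambda>N n x j. cop_apply (r N n) (cop_apply e (cop_apply (star w ^ j) x))"
  obtain N where N: "cinner y (cop_apply a x)
      = (\<Sum>n\<le>N. \<Sum>i<Suc N. \<Sum>j<Suc N. entry (\<pi> a n) i j * cinner (?v N n y i) (?v N n x j))"
    using I0_coefficient[OF a, of y x] by blast
  have bessel: "(\<Sum>n\<le>N. \<Sum>j<Suc N. (norm (?v N n x j))\<^sup>2) \<le> (norm x)\<^sup>2" for x
    by (subst sum.swap) (simp only: r_bessel e_bessel)
  have "cmod (cinner y (cop_apply a x))
      \<le> (\<Sum>n\<le>N. M / 2 * ((\<Sum>j<Suc N. (norm (?v N n x j))\<^sup>2) + (\<Sum>i<Suc N. (norm (?v N n y i))\<^sup>2)))"
    unfolding N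
  proof (rule sum_norm_le)
    fix n
    have "cmod (\<Sum>i<Suc N. \<Sum>j<Suc N. entry (\<pi> a n) i j * cinner (?v N n y i) (?v N n x j))
        \<le> norm (\<pi> a n) / 2 * ((\<Sum>j<Suc N. (norm (?v N n x j))\<^sup>2) + (\<Sum>i<Suc N. (norm (?v N n y i))\<^sup>2))"
      by (rule amplification_bound)
    also have "\<dots> \<le> M / 2 * ((\<Sum>j<Suc N. (norm (?v N n x j))\<^sup>2) + (\<Sum>i<Suc N. (norm (?v N n y i))\<^sup>2))"
      using M[of n] by (intro mult_right_mono divide_right_mono add_nonneg_nonneg sum_nonneg) simp_all
    finally show "cmod (\<Sum>i<Suc N. \<Sum>j<Suc N. entry (\<pi> a n) i j * cinner (?v N n y i) (?v N n x j))
        \<le> M / 2 * ((\<Sum>j<Suc N. (norm (?v N n x j))\<^sup>2) + (\<Sum>i<Suc N. (norm (?v N n y i))\<^sup>2))" .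
  qed
  also have "\<dots> = M / 2 * ((\<Sum>n\<le>N. \<Sum>j<Suc N. (norm (?v N n x j))\<^sup>2) + (\<Sum>n\<le>N. \<Sum>i<Suc N. (norm (?v N n y i))\<^sup>2))"
    by (simp only: sum_distrib_left[symmetric] sum.distrib)
  also have "\<dots> \<le> M / 2 * ((norm x)\<^sup>2 + (norm y)\<^sup>2)"
    by (intro mult_left_mono[OF _ M2] add_mono bessel)
  finally show "cmod (cinner y (cop_apply a x)) \<le> M / 2 * ((norm x)\<^sup>2 + (norm y)\<^sup>2)" .
qed

lemma closure_I0_norm_le:
  assumes a: "a \<in> closure I0" and M: "\<And>n. norm (\<pi> a n) \<le> M"
  shows "norm a \<le> M"
proof -
  obtain X where X: "\<And>k. X k \<in> I0" "X \<longlonglongrightarrow> a"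
    using a unfolding closure_sequential by blast
  have aB: "a \<in> B" "X k \<in> B" for k using a X closure_I0_B I0_B by auto
  have "norm (X k) \<le> M + norm (X k - a)" for k
  proof (rule I0_norm_le[OF X(1)])
    fix n
    have "\<pi> (X k) n = \<pi> a n + \<pi> (X k - a) n"
      using aB by (simp add: \<pi>_diff)
    also have "norm \<dots> \<le> norm (\<pi> a n) + norm (\<pi> (X k - a) n)"
      by (rule norm_triangle_ineq)
    also have "\<dots> \<le> M + norm (X k - a)"
      using aB by (intro add_mono M norm_\<pi>_le B_closed)
    finally show "norm (\<pi> (X k) n) \<le> M + norm (X k - a)" .
  qed
  moreover have "(\<lambda>k. M + norm (X k - a)) \<longlonglongrightarrow> M + norm (a - a)"
    by (intro tendsto_intros X(2))
  ultimately show ?thesis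
    using LIMSEQ_le[OF tendsto_norm[OF X(2)], of "\<lambda>k. M + norm (X k - a)" "M + norm (a - a)"] by auto
qed

text \<open>On \<open>I0\<close> the sequence eventually equals \<open>\<kappa>\<close>. The bounds
  of \<open>\<pi>\<close> and \<open>\<kappa>\<close> by the norm are uniform in n, so convergence
  passes to the closure.\<close>

lemma \<pi>_tendsto_\<kappa>:
  assumes a: "a \<in> closure I0"
  shows "\<pi> a \<longlonglongrightarrow> \<kappa> a"
proof -
  have ev: "\<forall>\<^sub>F n in sequentially. \<pi> b n = \<kappa> b" if "b \<in> I0" for b
    using that unfolding I0_def
  proof (rule lin_combs_induct)
    show "\<forall>\<^sub>F n in sequentially. \<pi> 0 n = \<kappa> 0"
      by (simp add: \<pi>_zero star_hom_linear[OF \<kappa>(1) B(1)])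
    fix c and p :: "nat \<times> nat \<times> nat" and b
    assume b: "b \<in> lin_combs (\<lambda>(m, i, j). g m i j)" and ev: "\<forall>\<^sub>F n in sequentially. \<pi> b n = \<kappa> b"
    obtain m i j where p: "p = (m, i, j)" by (cases p)
    have bB: "b \<in> B" using b I0_B unfolding I0_def by blast
    have "\<forall>\<^sub>F n in sequentially. max m (max i j) \<le> n" by (rule eventually_ge_at_top)
    with ev show "\<forall>\<^sub>F n in sequentially. \<pi> (c *\<^sub>C (case p of (m, i, j) \<Rightarrow> g m i j) + b) n
        = \<kappa> (c *\<^sub>C (case p of (m, i, j) \<Rightarrow> g m i j) + b)"
      unfolding p prod.case
      by eventually_elim
        (simp add: \<pi>_add \<pi>_scaleC \<pi>_g \<kappa>_g bB g_B B_closed star_homD[OF \<kappa>(1)])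
  qed
  show ?thesis
  proof (rule LIMSEQ_I)
    fix \<epsilon> :: real
    assume \<epsilon>: "\<epsilon> > 0"
    then obtain b where b: "b \<in> I0" "dist b a < \<epsilon> / 2"
      using a closure_approachable half_gt_zero by metis
    have ab: "a \<in> B" "b \<in> B" using a b closure_I0_B I0_B by auto
    have d: "norm (a - b) < \<epsilon> / 2" using b(2) by (simp add: dist_norm norm_minus_commute)
    obtain N where N: "\<And>n. n \<ge> N \<Longrightarrow> \<pi> b n = \<kappa> b"
      using ev[OF b(1)] by (auto simp: eventually_sequentially)
    have "norm (\<pi> a n - \<kappa> a) < \<epsilon>" if "n \<ge> N" for n
    proof -
      have "\<pi> a n - \<kappa> a = \<pi> (a - b) n - \<kappa> (a - b)"
        using ab N[OF that] by (simp add: \<pi>_diff star_hom_linear[OF \<kappa>(1) B(1)])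
      also have "norm \<dots> \<le> norm (\<pi> (a - b) n) + norm (\<kappa> (a - b))"
        by (rule norm_triangle_ineq4)
      also have "\<dots> \<le> norm (a - b) + norm (a - b)"
        using ab by (intro add_mono norm_\<pi>_le star_hom_norm_le[OF B(1) \<kappa>(1)] B_closed)
      finally show ?thesis using d by simp
    qed
    then show "\<exists>N. \<forall>n\<ge>N. norm (\<pi> a n - \<kappa> a) < \<epsilon>" by blast
  qed
qed

section \<open>The image of \<open>\<pi>\<close>\<close>

lemma \<pi>_in_alg_A: "a \<in> closure I0 \<Longrightarrow> \<pi> a \<in> alg_A"
proof -
  assume a: "a \<in> closure I0"
  then have aB: "a \<in> B" using closure_I0_B by blast
  have "\<pi> a n \<in> {proj_P n * k * proj_P n |k. k \<in> compact_operators}" for n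
    using \<pi>_sandwich[OF aB, of n] sandwich_compact[of n "\<Lambda> n a"] by blast
  moreover have "convergent (\<pi> a)"
    using \<pi>_tendsto_\<kappa>[OF a] by (rule convergentI)
  ultimately show ?thesis by (simp add: alg_A_def)
qed

text \<open>The terms before N are reproduced exactly, while the tail is replaced by the constant
  corner P_M K P_M of the limit \<open>K\<close>.\<close>

lemma I0_approximates:
  assumes f: "f \<in> alg_A" and \<epsilon>: "\<epsilon> > 0"
  shows "\<exists>a\<in>I0. \<forall>n. norm (f n - \<pi> a n) < \<epsilon>"
proof -
  have fP: "proj_P n * f n * proj_P n = f n" and fc: "f n \<in> compact_operators" for n
  proof -
    obtain k where k: "f n = proj_P n * k * proj_P n"
      using f unfolding alg_A_def by blast
    have "proj_P n * (proj_P n * k * proj_P n) * proj_P n = (proj_P n * proj_P n) * k * (proj_P n * proj_P n)"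
      by (simp only: mult.assoc)
    then show "proj_P n * f n * proj_P n = f n" by (simp add: k proj_P_mult)
    show "f n \<in> compact_operators" unfolding k by (rule sandwich_compact)
  qed
  obtain K where K: "f \<longlonglongrightarrow> K" using f by (auto simp: alg_A_def convergent_def)
  have Kc: "(\<lambda>n. proj_P n * K * proj_P n) \<longlonglongrightarrow> K"
    using compact_operators_limit[OF fc K] by (simp only: compact_operators_iff)
  from LIMSEQ_D[OF Kc half_gt_zero[OF \<epsilon>]]
  obtain M where "\<forall>n\<ge>M. norm (proj_P n * K * proj_P n - K) < \<epsilon> / 2" ..
  then have M: "norm (proj_P M * K * proj_P M - K) < \<epsilon> / 2" by blast
  from LIMSEQ_D[OF K half_gt_zero[OF \<epsilon>]]
  obtain N' where "\<forall>n\<ge>N'. norm (f n - K) < \<epsilon> / 2" ..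
  then have N': "norm (f n - K) < \<epsilon> / 2" if "n \<ge> N'" for n using that by blast
  define N where "N = max N' M"
  \<comment> \<open>By \<open>\<pi>_g\<close> the difference of \<open>g n i j\<close> and
    \<open>g (Suc n) i j\<close> is a matrix unit at position n and 0 at all others. In
    \<open>v\<close> the condition N \<ge> M ensures that every summand switches on exactly at
    N.\<close>
  define u where "u n = (\<Sum>i\<le>n. \<Sum>j\<le>n. entry (f n) i j *\<^sub>C (g n i j - g (Suc n) i j))" for n
  define v where "v = (\<Sum>i\<le>M. \<Sum>j\<le>M. entry K i j *\<^sub>C g N i j)"
  have gI: "g m i j \<in> I0" for m i j
    unfolding I0_def using lin_combs_base[of "\<lambda>(m, i, j). g m i j" "(m, i, j)"] by simp
  have uI: "u n \<in> I0" and vI: "v \<in> I0" for n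
    using gI unfolding u_def v_def I0_def
    by (auto intro!: lin_combs_sum lin_combs_scaleC lin_combs_diff)
  have \<pi>u: "\<pi> (u n) k = (if k = n then f n else 0)" for n k
  proof -
    have "\<pi> (u n) k = (\<Sum>i\<le>n. \<Sum>j\<le>n. entry (f n) i j *\<^sub>C (\<pi> (g n i j) k - \<pi> (g (Suc n) i j) k))"
      unfolding u_def
      by (simp add: \<pi>_sum \<pi>_scaleC \<pi>_diff B_closed g_B cstar_subalgebra_sum[OF B(1)])
    also have "\<dots> = (\<Sum>i\<le>n. \<Sum>j\<le>n. if k = n then entry (f n) i j *\<^sub>C matrix_unit i j else 0)"
      by (intro sum.cong refl) (auto simp: \<pi>_g scaleC_zero_right)
    also have "\<dots> = (if k = n then proj_P n * f n * proj_P n else 0)"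
      by (simp add: proj_P_sandwich)
    finally show ?thesis by (simp add: fP)
  qed
  have \<pi>v: "\<pi> v k = (if N \<le> k then proj_P M * K * proj_P M else 0)" for k
  proof -
    have "\<pi> v k = (\<Sum>i\<le>M. \<Sum>j\<le>M. entry K i j *\<^sub>C \<pi> (g N i j) k)"
      unfolding v_def by (simp add: \<pi>_sum \<pi>_scaleC B_closed g_B cstar_subalgebra_sum[OF B(1)])
    also have "\<dots> = (\<Sum>i\<le>M. \<Sum>j\<le>M. if N \<le> k then entry K i j *\<^sub>C matrix_unit i j else 0)"
      by (intro sum.cong refl) (auto simp: \<pi>_g scaleC_zero_right N_def)
    also have "\<dots> = (if N \<le> k then proj_P M * K * proj_P M else 0)"
      by (simp add: proj_P_sandwich)
    finally show ?thesis .
  qed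
  define a where "a = (\<Sum>n<N. u n) + v"
  have "a \<in> I0"
    using uI vI unfolding a_def I0_def by (intro lin_combs_add lin_combs_sum)
  moreover have "norm (f k - \<pi> a k) < \<epsilon>" for k
  proof -
    have "\<pi> a k = (\<Sum>n<N. \<pi> (u n) k) + \<pi> v k"
      using uI vI I0_B by (auto simp: a_def \<pi>_add \<pi>_sum subset_iff cstar_subalgebra_sum[OF B(1)])
    then have \<pi>a: "\<pi> a k = (if k < N then f k else proj_P M * K * proj_P M)"
      by (auto simp: \<pi>u \<pi>v)
    show ?thesis
    proof (cases "k < N")
      case False
      then have "norm (f k - K) < \<epsilon> / 2" by (intro N') (simp add: N_def)
      moreover have "norm (f k - proj_P M * K * proj_P M)
          \<le> norm (f k - K) + norm (K - proj_P M * K * proj_P M)"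
        using norm_triangle_ineq[of "f k - K" "K - proj_P M * K * proj_P M"] by simp
      ultimately show ?thesis
        using M False by (simp add: \<pi>a norm_minus_commute)
    qed (simp add: \<pi>a \<epsilon>)
  qed
  ultimately show ?thesis by blast
qed

text \<open>By \<open>I0_norm_le\<close>, elements of \<open>I0\<close> whose images approximate
  \<open>f\<close> uniformly are close to each other in norm.\<close>

lemma \<pi>_surj:
  assumes f: "f \<in> alg_A"
  shows "f \<in> \<pi> ` closure I0"
proof -
  have "\<exists>l\<in>closure I0. \<forall>\<epsilon>>0. \<exists>a\<in>I0. (\<forall>n. norm (f n - \<pi> a n) \<le> \<epsilon>) \<and> norm (l - a) \<le> \<epsilon>"
  proof (rule approximation_limit)
    show "\<exists>a\<in>I0. \<forall>n. norm (f n - \<pi> a n) \<le> \<epsilon>" if "\<epsilon> > 0" for \<epsilon>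
      using I0_approximates[OF f that] by (meson less_imp_le)
    fix a b \<delta> \<epsilon>
    assume ab: "a \<in> I0" "b \<in> I0"
      and *: "\<forall>n. norm (f n - \<pi> a n) \<le> \<delta>" "\<forall>n. norm (f n - \<pi> b n) \<le> \<epsilon>"
    show "norm (a - b) \<le> \<delta> + \<epsilon>"
    proof (rule I0_norm_le)
      show "a - b \<in> I0" using ab unfolding I0_def by (intro lin_combs_diff)
      fix n
      have "\<pi> (a - b) n = (f n - \<pi> b n) - (f n - \<pi> a n)"
        using ab I0_B by (simp add: \<pi>_diff subset_iff)
      then show "norm (\<pi> (a - b) n) \<le> \<delta> + \<epsilon>"
        using *[rule_format, of n] norm_triangle_ineq4[of "f n - \<pi> b n" "f n - \<pi> a n"] by simp
    qed
  qed
  then obtain l where l: "l \<in> closure I0"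
    "\<And>\<epsilon>. \<epsilon> > 0 \<Longrightarrow> \<exists>a\<in>I0. (\<forall>n. norm (f n - \<pi> a n) \<le> \<epsilon>) \<and> norm (l - a) \<le> \<epsilon>"
    by blast
  have lB: "l \<in> B" using l(1) closure_I0_B by blast
  have "norm (\<pi> l n - f n) \<le> 0" for n
  proof (rule field_le_epsilon)
    fix \<epsilon> :: real
    assume "\<epsilon> > 0"
    then obtain a where a: "a \<in> I0" "norm (f n - \<pi> a n) \<le> \<epsilon> / 2" "norm (l - a) \<le> \<epsilon> / 2"
      using l(2)[of "\<epsilon> / 2"] by auto
    then have aB: "a \<in> B" using I0_B by blast
    have eq: "\<pi> l n - f n = \<pi> (l - a) n - (f n - \<pi> a n)"
      using lB aB by (simp add: \<pi>_diff)
    have "norm (\<pi> (l - a) n) \<le> norm (l - a)"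
      using lB aB by (intro norm_\<pi>_le B_closed)
    then show "norm (\<pi> l n - f n) \<le> 0 + \<epsilon>"
      unfolding eq using a(2,3) norm_triangle_ineq4[of "\<pi> (l - a) n" "f n - \<pi> a n"] by linarith
  qed
  then have "\<pi> l = f" by (intro ext) simp
  with l(1) show ?thesis by blast
qed

lemma kernel_iso: "star_iso (hom_kernel B \<phi>) alg_A \<pi>"
  unfolding star_iso_def kernel_eq
proof
  have cB: "a \<in> B" if "a \<in> closure I0" for a using that closure_I0_B by blast
  show "star_hom (closure I0) alg_A \<pi>"
    unfolding star_hom_def
    using \<pi>_in_alg_A cB
    by (auto simp: fun_eq_iff plus_fun_def times_fun_def scaleC_fun_def star_fun_def
        \<pi>_add \<pi>_mult \<pi>_scaleC \<pi>_star)
  have "inj_on \<pi> (closure I0)"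
  proof (rule inj_onI)
    fix a b
    assume ab: "a \<in> closure I0" "b \<in> closure I0" and eq: "\<pi> a = \<pi> b"
    have "a - b \<in> closure I0"
    proof -
      have "a - b \<in> hom_kernel B \<phi>"
        using ab cB by (simp add: hom_kernel_def star_hom_linear[OF \<phi>(1) B(1)] \<phi>_closure_I0 B_closed)
      then show ?thesis by (simp only: kernel_eq)
    qed
    moreover have "norm (\<pi> (a - b) n) \<le> 0" for n
      using ab cB by (simp add: \<pi>_diff eq)
    ultimately have "norm (a - b) \<le> 0" by (rule closure_I0_norm_le)
    then show "a = b" by simp
  qed
  moreover have "\<pi> ` closure I0 = alg_A"
    using \<pi>_in_alg_A \<pi>_surj by blast
  ultimately show "bij_betw \<pi> (closure I0) alg_A" by (simp add: bij_betw_def)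
qed

lemma kernel_limit:
  assumes "a \<in> hom_kernel B \<phi>"
  shows "\<kappa> a = eps_inf (\<pi> a)"
  using \<pi>_tendsto_\<kappa>[of a] assms by (simp add: eps_inf_def kernel_eq limI)

end

section \<open>The sequence algebra\<close>

lemma eps_inf_eqI: "f \<longlonglongrightarrow> K \<Longrightarrow> eps_inf f = K"
  unfolding eps_inf_def by (rule limI)

lemma alg_A_tendsto: "f \<in> alg_A \<Longrightarrow> f \<longlonglongrightarrow> eps_inf f"
  unfolding alg_A_def eps_inf_def by (simp add: convergent_LIMSEQ_iff)

lemma eps_inf_compact: "f \<in> alg_A \<Longrightarrow> eps_inf f \<in> compact_operators"
proof (rule compact_operators_limit[OF _ alg_A_tendsto])
  assume f: "f \<in> alg_A"
  show "f n \<in> compact_operators" for n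
  proof -
    obtain k where "f n = proj_P n * k * proj_P n" using f unfolding alg_A_def by blast
    then show ?thesis by (simp only: sandwich_compact)
  qed
qed

lemma star_hom_eps_inf: "star_hom alg_A compact_operators eps_inf"
  unfolding star_hom_def
proof (intro conjI ballI allI)
  show "eps_inf ` alg_A \<subseteq> compact_operators" using eps_inf_compact by blast
  fix f g :: "nat \<Rightarrow> ell2 cop" and c
  assume f: "f \<in> alg_A"
  show "eps_inf (c *\<^sub>C f) = c *\<^sub>C eps_inf f"
    unfolding scaleC_fun_def by (intro eps_inf_eqI tendsto_scaleC_cop alg_A_tendsto f)
  show "eps_inf (star f) = star (eps_inf f)"
    unfolding star_fun_def by (intro eps_inf_eqI tendsto_star alg_A_tendsto f)
  assume g: "g \<in> alg_A"
  show "eps_inf (f + g) = eps_inf f + eps_inf g"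
    unfolding plus_fun_def by (intro eps_inf_eqI tendsto_add alg_A_tendsto f g)
  show "eps_inf (f * g) = eps_inf f * eps_inf g"
    unfolding times_fun_def by (intro eps_inf_eqI tendsto_mult alg_A_tendsto f g)
qed

lemma eps_inf_surj: "eps_inf ` alg_A = compact_operators"
proof
  show "eps_inf ` alg_A \<subseteq> compact_operators" using eps_inf_compact by blast
  show "compact_operators \<subseteq> eps_inf ` alg_A"
  proof
    fix K :: "ell2 cop"
    assume K: "K \<in> compact_operators"
    then have lim: "(\<lambda>n. proj_P n * K * proj_P n) \<longlonglongrightarrow> K" by (simp only: compact_operators_iff)
    have "(\<lambda>n. proj_P n * K * proj_P n) \<in> alg_A"
      unfolding alg_A_def using K convergentI[OF lim] by blast
    then show "K \<in> eps_inf ` alg_A"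
      using eps_inf_eqI[OF lim] by force
  qed
qed

text \<open>Stated for any automorphism of the null sequences: the identity gives the top row of the
  diagram and \<alpha> its left column.\<close>

lemma short_exact_eps_inf:
  assumes "star_hom alg_A0 alg_A0 \<alpha>" "bij_betw \<alpha> alg_A0 alg_A0"
  shows "short_exact alg_A0 alg_A compact_operators \<alpha> eps_inf"
proof -
  have "alg_A0 \<subseteq> alg_A" by (auto simp: alg_A0_def)
  then show ?thesis
    using assms star_hom_eps_inf eps_inf_surj
    unfolding short_exact_def by (auto simp: star_hom_def bij_betw_def alg_A0_def hom_kernel_def)
qed

section \<open>The Toeplitz extension\<close>

lemma matrix_unit_in_toeplitz: "matrix_unit i j \<in> toeplitz_algebra"
  unfolding matrix_unit_def
  by (intro cstar_subalgebraD[OF cstar_subalgebra_toeplitz]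
      cstar_subalgebra_power[OF cstar_subalgebra_toeplitz] one_in_toeplitz shift_in_toeplitz)

lemma compact_subset_toeplitz: "compact_operators \<subseteq> toeplitz_algebra"
proof
  fix K :: "ell2 cop"
  assume "K \<in> compact_operators"
  then have lim: "(\<lambda>n. proj_P n * K * proj_P n) \<longlonglongrightarrow> K" by (simp only: compact_operators_iff)
  have "proj_P n * K * proj_P n \<in> toeplitz_algebra" for n
    unfolding proj_P_sandwich
    by (intro cstar_subalgebra_sum[OF cstar_subalgebra_toeplitz]
        cstar_subalgebraD(5)[OF cstar_subalgebra_toeplitz] matrix_unit_in_toeplitz)
  then show "K \<in> toeplitz_algebra"
    using closed_sequentially[OF cstar_subalgebraD(1)[OF cstar_subalgebra_toeplitz] _ lim] by blast
qed

text \<open>The operators with symbols z^k and z^(-k); the flag is the sign of the exponent, and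
  both flags give 1 for k = 0.\<close>

definition two_sided_power :: "nat \<times> bool \<Rightarrow> ell2 cop" where
  "two_sided_power p = (if snd p then shift ^ fst p else star shift ^ fst p)"

text \<open>The monomial and the single power of the shift or its adjoint differ only on the vectors
  e_j with j < b, hence inside a finite corner; size a + b is large enough in both cases.\<close>

lemma toeplitz_monomial_mod_compact:
  "\<exists>p. shift ^ a * star shift ^ b - two_sided_power p \<in> compact_operators"
proof -
  have *: "A \<in> compact_operators" if "proj_P N * A * proj_P N = A" for A N
    using proj_P_sandwich_tendsto[OF that] by (simp only: compact_operators_iff)
  show ?thesis
  proof (cases "b \<le> a")
    case True
    then have "proj_P (a + b) * (shift ^ a * star shift ^ b - shift ^ (a - b)) * proj_P (a + b)
        = shift ^ a * star shift ^ b - shift ^ (a - b)"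
      by (intro cop_eqI ell2_eqI)
        (auto simp: cop_apply_mult minus_cop.rep_eq ell2_nth_simps ell2_nth_proj_P ell2_nth_shift_power
          ell2_nth_star_shift_power)
    from *[OF this] show ?thesis
      by (intro exI[of _ "(a - b, True)"]) (simp add: two_sided_power_def)
  next
    case False
    then have "proj_P (a + b) * (shift ^ a * star shift ^ b - star shift ^ (b - a)) * proj_P (a + b)
        = shift ^ a * star shift ^ b - star shift ^ (b - a)"
      by (intro cop_eqI ell2_eqI)
        (auto simp: cop_apply_mult minus_cop.rep_eq ell2_nth_simps ell2_nth_proj_P ell2_nth_shift_power
          ell2_nth_star_shift_power)
    from *[OF this] show ?thesis
      by (intro exI[of _ "(b - a, False)"]) (simp add: two_sided_power_def)
  qed
qed

lemma toeplitz_dense_mod_compact: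
  "toeplitz_algebra \<subseteq> closure {y + k |y k. y \<in> lin_combs two_sided_power \<and> k \<in> compact_operators}"
  (is "_ \<subseteq> closure ?D")
proof -
  have "x \<in> ?D" if "x \<in> lin_combs (\<lambda>(a, b). shift ^ a * star shift ^ b)" for x
    using that
  proof (rule lin_combs_induct)
    have "(0::ell2 cop) \<in> compact_operators"
      using sandwich_compact[of 0 0] by simp
    then show "0 \<in> ?D"
      by (intro CollectI exI[of _ 0]) (simp add: lin_combs_zero)
    fix c and p :: "nat \<times> nat" and x
    assume "x \<in> ?D"
    then obtain y k where x: "x = y + k" "y \<in> lin_combs two_sided_power" "k \<in> compact_operators"
      by blast
    obtain a b where p: "p = (a, b)" by (cases p)
    obtain p' where p': "shift ^ a * star shift ^ b - two_sided_power p' \<in> compact_operators"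
      using toeplitz_monomial_mod_compact by blast
    have "c *\<^sub>C (shift ^ a * star shift ^ b) + x = (c *\<^sub>C two_sided_power p' + y)
        + (c *\<^sub>C (shift ^ a * star shift ^ b - two_sided_power p') + k)"
      by (simp add: x scaleC_diff_right)
    moreover have "c *\<^sub>C two_sided_power p' + y \<in> lin_combs two_sided_power"
      by (intro lin_combs_add lin_combs_scaleC lin_combs_base x)
    moreover have "c *\<^sub>C (shift ^ a * star shift ^ b - two_sided_power p') + k \<in> compact_operators"
      by (intro compact_operators_linear p' x)
    ultimately show "c *\<^sub>C (case p of (a, b) \<Rightarrow> shift ^ a * star shift ^ b) + x \<in> ?D"
      unfolding p prod.case by blast
  qed
  then have "lin_combs (\<lambda>(a, b). shift ^ a * star shift ^ b) \<subseteq> ?D" by (rule subsetI)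
  from order_trans[OF toeplitz_dense closure_mono[OF this]] show ?thesis .
qed

section \<open>Discrete Fourier analysis and the section over the circle\<close>

definition root_of_unity :: "nat \<Rightarrow> complex" where
  "root_of_unity N = cis (2 * pi / real N)"

text \<open>A geometric sum with ratio u satisfying u^N = 1. Exponents below N prevent a - b from
  being a nonzero multiple of N, so u = 1 only for a = b.\<close>

lemma sum_roots_of_unity:
  assumes "a < N" "b < N"
  shows "(\<Sum>s<N. (root_of_unity N ^ s) ^ a * cnj ((root_of_unity N ^ s) ^ b))
    = (if a = b then of_nat N else 0)"
proof -
  define \<theta> where "\<theta> = 2 * pi / real N"
  have root: "root_of_unity N = cis \<theta>" by (simp add: root_of_unity_def \<theta>_def)
  define u where "u = cis \<theta> ^ a * cnj (cis \<theta> ^ b)"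
  have N: "N > 0" using assms by simp
  have summand: "(cis \<theta> ^ s) ^ a * cnj ((cis \<theta> ^ s) ^ b) = u ^ s" for s
    by (simp add: u_def power_mult_distrib mult.commute flip: power_mult)
  have u: "u = cis ((real a - real b) * \<theta>)"
    unfolding u_def Complex.DeMoivre cis_cnj cis_mult by (simp add: left_diff_distrib)
  show ?thesis
  proof (cases "a = b")
    case True
    then show ?thesis unfolding root summand by (simp add: u)
  next
    case False
    have "u \<noteq> 1"
    proof
      assume "u = 1"
      then have "cos ((real a - real b) * \<theta>) = 1"
        by (simp add: u complex_eq_iff)
      then obtain k :: int where "(real a - real b) * \<theta> = of_int k * 2 * pi"
        unfolding cos_one_2pi_int by blast
      then have "pi * (real a - real b) = pi * (of_int k * real N)"
        using N by (simp add: \<theta>_def field_simps)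
      then have "real a - real b = of_int k * real N" by simp
      then have "real_of_int (int a - int b) = real_of_int (k * int N)" by simp
      then have k: "int a - int b = k * int N" by (simp only: of_int_eq_iff)
      then have "k \<noteq> 0" using False by auto
      then have "int N * 1 \<le> int N * \<bar>k\<bar>" by (intro mult_left_mono) auto
      then have "int N \<le> \<bar>int a - int b\<bar>" by (simp add: k abs_mult mult.commute)
      with assms show False by simp
    qed
    moreover have "u ^ N = 1"
    proof -
      have "cis \<theta> ^ N = 1" using N by (simp add: Complex.DeMoivre \<theta>_def cis_2pi)
      then show ?thesis using summand[of N] by simp
    qed
    ultimately show ?thesis
      unfolding root summand using False by (simp add: sum_gp_strict)
  qed
qed

text \<open>Unnormalised samples of a polynomial of degree at most n. The number N of nodes is
  independent of n, as it has to exceed n plus the bandwidth of the operator.\<close>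

definition dft :: "nat \<Rightarrow> (nat \<Rightarrow> complex) \<Rightarrow> nat \<Rightarrow> nat \<Rightarrow> complex" where
  "dft n v N s = (\<Sum>i\<le>n. v i * (root_of_unity N ^ s) ^ i)"

locale circle_symbol =
  fixes \<psi> :: "ell2 cop \<Rightarrow> complex \<Rightarrow> complex"
  assumes \<psi>: "star_hom toeplitz_algebra C_circle \<psi>" "\<psi> shift = circle_fun (\<lambda>z. z)"
begin

lemmas T = cstar_subalgebra_toeplitz
lemmas T_closed = cstar_subalgebraD[OF T] cstar_subalgebra_power[OF T one_in_toeplitz]
  shift_in_toeplitz one_in_toeplitz

lemma \<psi>_pointwise:
  "x \<in> toeplitz_algebra \<Longrightarrow> y \<in> toeplitz_algebra \<Longrightarrow> \<psi> (x + y) z = \<psi> x z + \<psi> y z"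
  "x \<in> toeplitz_algebra \<Longrightarrow> y \<in> toeplitz_algebra \<Longrightarrow> \<psi> (x - y) z = \<psi> x z - \<psi> y z"
  "x \<in> toeplitz_algebra \<Longrightarrow> y \<in> toeplitz_algebra \<Longrightarrow> \<psi> (x * y) z = \<psi> x z * \<psi> y z"
  "x \<in> toeplitz_algebra \<Longrightarrow> \<psi> (c *\<^sub>C x) z = c * \<psi> x z"
  "x \<in> toeplitz_algebra \<Longrightarrow> \<psi> (star x) z = cnj (\<psi> x z)"
  "\<psi> 0 z = 0"
  by (simp_all add: star_homD[OF \<psi>(1)] star_hom_linear[OF \<psi>(1) T] scaleC_fun_def scaleC_complex_def
      star_fun_def star_complex_def zero_fun_def plus_fun_def times_fun_def fun_diff_def)

lemma \<psi>_outside: "x \<in> toeplitz_algebra \<Longrightarrow> z \<notin> sphere 0 1 \<Longrightarrow> \<psi> x z = 0"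
  using star_homD(1)[OF \<psi>(1)] by (auto simp: C_circle_def)

lemma \<psi>_shift: "z \<in> sphere 0 1 \<Longrightarrow> \<psi> shift z = z"
  by (simp add: \<psi>(2) circle_fun_def)

lemma cnj_circle: "z \<in> sphere 0 1 \<Longrightarrow> cnj z * z = 1"
  using complex_norm_square[of z] by (simp add: mult.commute)

lemma \<psi>_one: "z \<in> sphere 0 1 \<Longrightarrow> \<psi> 1 z = 1"
  using \<psi>_pointwise(3)[of "star shift" shift z] \<psi>_pointwise(5)[of shift z]
  by (simp add: star_shift_shift T_closed \<psi>_shift cnj_circle)

lemma \<psi>_power: "x \<in> toeplitz_algebra \<Longrightarrow> z \<in> sphere 0 1 \<Longrightarrow> \<psi> (x ^ n) z = \<psi> x z ^ n"
  by (induction n) (simp_all only: power_0 power_Suc \<psi>_one \<psi>_pointwise(3) T_closed)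

text \<open>The factor \<open>1 - shift * star shift\<close> of a matrix unit has symbol 1 - |z|^2,
  which is 0 on the circle; compact operators are limits of combinations of matrix units.\<close>

lemma \<psi>_compact:
  assumes K: "K \<in> compact_operators"
  shows "\<psi> K z = 0"
proof (cases "z \<in> sphere 0 1")
  case True
  have "\<psi> (matrix_unit i j) z = 0" for i j
    using cnj_circle[OF True]
    by (simp add: matrix_unit_def \<psi>_pointwise T_closed \<psi>_one[OF True] \<psi>_shift[OF True] mult.commute)
  then have "\<psi> (c *\<^sub>C matrix_unit i j) z = 0" for c i j
    by (simp add: \<psi>_pointwise matrix_unit_in_toeplitz)
  moreover have sum: "\<psi> (sum f F) z = (\<Sum>i\<in>F. \<psi> (f i) z)"
    if "\<And>i. i \<in> F \<Longrightarrow> f i \<in> toeplitz_algebra" for F and f :: "nat \<Rightarrow> ell2 cop"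
    using that
    by (induction F rule: infinite_finite_induct) (simp_all add: \<psi>_pointwise cstar_subalgebra_sum[OF T])
  ultimately have "\<psi> (proj_P n * K * proj_P n) z = 0" for n
    unfolding proj_P_sandwich
    by (simp add: sum cstar_subalgebra_sum[OF T] T_closed matrix_unit_in_toeplitz)
  moreover have "(\<lambda>n. \<psi> (proj_P n * K * proj_P n) z) \<longlonglongrightarrow> \<psi> K z"
  proof (rule star_hom_fun_tendsto[OF T \<psi>(1)])
    show "proj_P n * K * proj_P n \<in> toeplitz_algebra" for n
      using compact_subset_toeplitz sandwich_compact by blast
    show "K \<in> toeplitz_algebra" using K compact_subset_toeplitz by blast
    show "(\<lambda>n. proj_P n * K * proj_P n) \<longlonglongrightarrow> K" using K by (simp only: compact_operators_iff)
  qed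
  ultimately show ?thesis by (simp add: LIMSEQ_const_iff)
qed (use assms compact_subset_toeplitz \<psi>_outside in blast)

lemma two_sided_power_in_toeplitz: "two_sided_power p \<in> toeplitz_algebra"
  by (simp add: two_sided_power_def T_closed)

lemma Z_subset: "lin_combs two_sided_power \<subseteq> toeplitz_algebra"
  by (rule lin_combs_subset[OF T two_sided_power_in_toeplitz])

text \<open>Compressions of Toeplitz operators are recovered from the values of the symbol at the
  \<open>N\<close>-th roots of unity, as soon as \<open>N\<close> exceeds the bandwidth.\<close>

lemma discrete_fourier:
  assumes "y \<in> lin_combs two_sided_power"
  shows "\<exists>N0. \<forall>N\<ge>N0. of_nat N * (\<Sum>i\<le>n. \<Sum>j\<le>n. cnj (v i) * u j * entry y i j)
    = (\<Sum>s<N. \<psi> y (root_of_unity N ^ s) * cnj (dft n v N s)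
        * dft n u N s)"
    (is "\<exists>N0. \<forall>N\<ge>N0. of_nat N * ?L y = ?R N y")
  using assms
proof (rule lin_combs_induct)
  show "\<exists>N0. \<forall>N\<ge>N0. of_nat N * ?L 0 = ?R N 0"
    by (simp add: entry_simps \<psi>_pointwise)
  fix c and p :: "nat \<times> bool" and y
  assume y: "y \<in> lin_combs two_sided_power" and "\<exists>N0. \<forall>N\<ge>N0. of_nat N * ?L y = ?R N y"
  then obtain N0 where N0: "\<And>N. N \<ge> N0 \<Longrightarrow> of_nat N * ?L y = ?R N y" by blast
  obtain k d where p: "p = (k, d)" by (cases p)
  have "of_nat N * ?L (c *\<^sub>C two_sided_power p + y) = ?R N (c *\<^sub>C two_sided_power p + y)"
    if N: "N \<ge> max N0 (n + k + 1)" for N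
  proof -
    let ?z = "\<lambda>s. root_of_unity N ^ s"
    have z: "?z s \<in> sphere 0 1" for s by (simp add: root_of_unity_def norm_power)
    \<comment> \<open>The symbol z^k or z^(-k) is absorbed into one of the two exponents, so that
      both stay nonnegative. They are at most n + k, hence below N, as the orthogonality relation
      requires.\<close>
    define a where "a j = (if d then k + j else j)" for j
    define b where "b i = (if d then i else i + k)" for i
    have symb: "\<psi> (two_sided_power p) (?z s) * cnj (?z s ^ i) * ?z s ^ j = ?z s ^ a j * cnj (?z s ^ b i)" for s i j
      by (simp add: p two_sided_power_def \<psi>_power[OF _ z] \<psi>_pointwise T_closed \<psi>_shift[OF z] a_def b_def
          power_add mult_ac)
    have ent: "entry (two_sided_power p) i j = (if a j = b i then 1 else 0)" for i j
      by (auto simp: p two_sided_power_def entry_def ell2_nth_shift_power ell2_nth_star_shift_power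
          ket.rep_eq a_def b_def)
    have "?R N (two_sided_power p) = (\<Sum>s<N. \<Sum>i\<le>n. \<Sum>j\<le>n. cnj (v i) * u j *
        (\<psi> (two_sided_power p) (?z s) * cnj (?z s ^ i) * ?z s ^ j))"
    proof -
      have "A * cnj (\<Sum>i\<le>n. v i * x ^ i) * (\<Sum>j\<le>n. u j * x ^ j)
          = (\<Sum>i\<le>n. \<Sum>j\<le>n. cnj (v i) * u j * (A * cnj (x ^ i) * x ^ j))" for A x
      proof -
        have "A * cnj (\<Sum>i\<le>n. v i * x ^ i) * (\<Sum>j\<le>n. u j * x ^ j)
            = A * (cnj (\<Sum>i\<le>n. v i * x ^ i) * (\<Sum>j\<le>n. u j * x ^ j))"
          by (rule mult.assoc)
        also have "cnj (\<Sum>i\<le>n. v i * x ^ i) * (\<Sum>j\<le>n. u j * x ^ j)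
            = (\<Sum>i\<le>n. \<Sum>j\<le>n. cnj (v i * x ^ i) * (u j * x ^ j))"
          by (simp only: cnj_sum sum_product)
        also have "A * \<dots> = (\<Sum>i\<le>n. \<Sum>j\<le>n. A * (cnj (v i * x ^ i) * (u j * x ^ j)))"
          by (simp only: sum_distrib_left)
        also have "\<dots> = (\<Sum>i\<le>n. \<Sum>j\<le>n. cnj (v i) * u j * (A * cnj (x ^ i) * x ^ j))"
          by (simp only: complex_cnj_mult mult_ac)
        finally show ?thesis .
      qed
      then show ?thesis by (simp only: dft_def)
    qed
    also have "\<dots> = (\<Sum>i\<le>n. \<Sum>s<N. \<Sum>j\<le>n. cnj (v i) * u j * (?z s ^ a j * cnj (?z s ^ b i)))"
      unfolding symb by (rule sum.swap)
    also have "\<dots> = (\<Sum>i\<le>n. \<Sum>j\<le>n. \<Sum>s<N. cnj (v i) * u j * (?z s ^ a j * cnj (?z s ^ b i)))"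
      by (rule sum.cong[OF refl sum.swap])
    also have "\<dots> = (\<Sum>i\<le>n. \<Sum>j\<le>n. cnj (v i) * u j * (if a j = b i then of_nat N else 0))"
    proof (intro sum.cong refl)
      fix i j assume "i \<in> {..n}" "j \<in> {..n}"
      then have "a j < N" "b i < N" using N by (auto simp: a_def b_def)
      then show "(\<Sum>s<N. cnj (v i) * u j * (?z s ^ a j * cnj (?z s ^ b i)))
          = cnj (v i) * u j * (if a j = b i then of_nat N else 0)"
        by (simp only: sum_distrib_left[symmetric] sum_roots_of_unity)
    qed
    also have "\<dots> = of_nat N * ?L (two_sided_power p)"
      unfolding ent sum_distrib_left by (intro sum.cong refl) simp
    finally have 1: "of_nat N * ?L (two_sided_power p) = ?R N (two_sided_power p)" by (rule sym)
    have yT: "y \<in> toeplitz_algebra" using y Z_subset by blast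
    have "?R N (c *\<^sub>C two_sided_power p + y) = c * ?R N (two_sided_power p) + ?R N y"
      by (simp only: \<psi>_pointwise T_closed yT two_sided_power_in_toeplitz distrib_right sum.distrib
          sum_distrib_left[of c] mult.assoc)
    moreover have "?L (c *\<^sub>C two_sided_power p + y) = c * ?L (two_sided_power p) + ?L y"
      by (simp only: entry_simps distrib_left sum.distrib sum_distrib_left[of c] mult.left_commute)
    moreover have "of_nat N * ?L y = ?R N y" using N by (intro N0) simp
    ultimately show ?thesis
      using 1 by (simp only: distrib_left mult.left_commute)
  qed
  then show "\<exists>N0. \<forall>N\<ge>N0. of_nat N * ?L (c *\<^sub>C two_sided_power p + y) = ?R N (c *\<^sub>C two_sided_power p + y)"
    by blast
qed

text \<open>On a corner the form of \<open>y\<close> is an average, over roots of unity, of the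
  symbol times two sampled polynomials. The bound \<open>C\<close> on the symbol then bounds the
  form, and the corners exhaust the space.\<close>

lemma Z_norm_le:
  assumes y: "y \<in> lin_combs two_sided_power" and C: "0 \<le> C" "\<And>z. cmod (\<psi> y z) \<le> C"
  shows "norm y \<le> C"
proof (rule norm_le_cinner_bound[OF C(1)])
  fix x w :: ell2
  \<comment> \<open>The Fourier identity for the operator 1, whose symbol is 1 on the circle, is
    Parseval's identity for the samples.\<close>
  have one: "1 \<in> lin_combs two_sided_power"
    using lin_combs_base[of two_sided_power "(0, True)"] by (simp add: two_sided_power_def)
  have amgm: "p * q \<le> (q\<^sup>2 + p\<^sup>2) / 2" for p q :: real
    using sum_squares_bound[of p q] by simp
  have bound: "cmod (cinner (cop_apply (proj_P n) w) (cop_apply y (cop_apply (proj_P n) x)))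
      \<le> C / 2 * ((norm x)\<^sup>2 + (norm w)\<^sup>2)" for n
  proof -
    define u where "u = ell2_nth x"
    define v where "v = ell2_nth w"
    obtain N1 where N1: "\<And>N. N \<ge> N1 \<Longrightarrow> of_nat N * (\<Sum>i\<le>n. \<Sum>j\<le>n. cnj (v i) * u j * entry y i j)
      = (\<Sum>s<N. \<psi> y (root_of_unity N ^ s) * cnj (dft n v N s)
        * dft n u N s)"
      using discrete_fourier[OF y, where n = n and v = v and u = u] by blast
    have parseval: "\<exists>N0. \<forall>N\<ge>N0. real N * (\<Sum>i\<le>n. (cmod (a i))\<^sup>2)
        = (\<Sum>s<N. (cmod (dft n a N s))\<^sup>2)" for a
    proof -
      obtain N0 where N0: "\<And>N. N \<ge> N0 \<Longrightarrow> of_nat N * (\<Sum>i\<le>n. \<Sum>j\<le>n. cnj (a i) * a j * entry 1 i j)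
        = (\<Sum>s<N. \<psi> 1 (root_of_unity N ^ s) * cnj (dft n a N s)
          * dft n a N s)"
        using discrete_fourier[OF one, where n = n and v = a and u = a] by blast
      have "real N * (\<Sum>i\<le>n. (cmod (a i))\<^sup>2)
        = (\<Sum>s<N. (cmod (dft n a N s))\<^sup>2)" if "N \<ge> N0" for N
      proof -
        have "(\<Sum>j\<le>n. cnj (a i) * a j * entry 1 i j) = complex_of_real ((cmod (a i))\<^sup>2)" if "i \<le> n" for i
        proof -
          have "(\<Sum>j\<le>n. cnj (a i) * a j * entry 1 i j) = (\<Sum>j\<le>n. if j = i then cnj (a i) * a i else 0)"
            by (intro sum.cong refl) (auto simp: entry_def one_cop.rep_eq ket.rep_eq)
          then show ?thesis
            using that complex_norm_square[of "a i"] by (simp add: mult.commute)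
        qed
        then have "complex_of_real (real N * (\<Sum>i\<le>n. (cmod (a i))\<^sup>2))
            = of_nat N * (\<Sum>i\<le>n. \<Sum>j\<le>n. cnj (a i) * a j * entry 1 i j)"
          by simp
        also have "\<dots> = (\<Sum>s<N. complex_of_real ((cmod (dft n a N s))\<^sup>2))"
          unfolding N0[OF that]
        proof (rule sum.cong[OF refl])
          fix s
          have "root_of_unity N ^ s \<in> sphere 0 1" by (simp add: root_of_unity_def norm_power)
          then show "\<psi> 1 (root_of_unity N ^ s) * cnj (dft n a N s)
              * dft n a N s
            = complex_of_real ((cmod (dft n a N s))\<^sup>2)"
            by (simp only: \<psi>_one complex_norm_square mult_1_left mult.commute)
        qed
        finally have "complex_of_real (real N * (\<Sum>i\<le>n. (cmod (a i))\<^sup>2))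
          = complex_of_real (\<Sum>s<N. (cmod (dft n a N s))\<^sup>2)"
          by (simp only: of_real_sum)
        then show ?thesis by (simp only: of_real_eq_iff)
      qed
      then show ?thesis by blast
    qed
    obtain N2 where N2: "\<And>N. N \<ge> N2 \<Longrightarrow> real N * (\<Sum>i\<le>n. (cmod (u i))\<^sup>2)
        = (\<Sum>s<N. (cmod (dft n u N s))\<^sup>2)"
      using parseval[of u] by blast
    obtain N3 where N3: "\<And>N. N \<ge> N3 \<Longrightarrow> real N * (\<Sum>i\<le>n. (cmod (v i))\<^sup>2)
        = (\<Sum>s<N. (cmod (dft n v N s))\<^sup>2)"
      using parseval[of v] by blast
    define N where "N = max (max N1 1) (max N2 N3)"
    have N: "N \<ge> N1" "N \<ge> N2" "N \<ge> N3" "N > 0" by (auto simp: N_def)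
    have inner: "cinner (cop_apply (proj_P n) w) (cop_apply y (cop_apply (proj_P n) x))
        = (\<Sum>i\<le>n. \<Sum>j\<le>n. cnj (v i) * u j * entry y i j)"
      by (simp add: proj_P_ket_sum cop_apply_sum_right cinner_sum_left cinner_sum_right cop_apply_scaleC
          cinner_scaleC_left cinner_scaleC_right cinner_ket_left entry_def u_def v_def
          sum_distrib_left mult_ac) (rule sum.swap)
    have "real N * cmod (\<Sum>i\<le>n. \<Sum>j\<le>n. cnj (v i) * u j * entry y i j)
        = cmod (\<Sum>s<N. \<psi> y (root_of_unity N ^ s) * cnj (dft n v N s) * dft n u N s)"
      unfolding N1[OF N(1), symmetric] by (simp add: norm_mult)
    also have "\<dots> \<le> (\<Sum>s<N. C / 2 * ((cmod (dft n u N s))\<^sup>2 + (cmod (dft n v N s))\<^sup>2))"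
    proof (rule sum_norm_le)
      fix s
      have "cmod (\<psi> y (root_of_unity N ^ s) * cnj (dft n v N s) * dft n u N s)
          \<le> C * (cmod (dft n v N s) * cmod (dft n u N s))"
        by (simp only: norm_mult complex_mod_cnj mult.assoc) (intro mult_right_mono C(2) mult_nonneg_nonneg norm_ge_zero)
      also have "\<dots> \<le> C * (((cmod (dft n u N s))\<^sup>2 + (cmod (dft n v N s))\<^sup>2) / 2)"
        by (intro mult_left_mono amgm C(1))
      finally show "cmod (\<psi> y (root_of_unity N ^ s) * cnj (dft n v N s) * dft n u N s)
          \<le> C / 2 * ((cmod (dft n u N s))\<^sup>2 + (cmod (dft n v N s))\<^sup>2)" by simp
    qed
    also have "\<dots> = C / 2 * ((\<Sum>s<N. (cmod (dft n u N s))\<^sup>2) + (\<Sum>s<N. (cmod (dft n v N s))\<^sup>2))"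
      by (simp only: sum_distrib_left[symmetric] sum.distrib)
    also have "\<dots> = real N * (C / 2 * ((\<Sum>i\<le>n. (cmod (u i))\<^sup>2) + (\<Sum>i\<le>n. (cmod (v i))\<^sup>2)))"
      unfolding N2[OF N(2), symmetric] N3[OF N(3), symmetric] by (simp only: distrib_left mult.left_commute)
    finally have "cmod (\<Sum>i\<le>n. \<Sum>j\<le>n. cnj (v i) * u j * entry y i j)
        \<le> C / 2 * ((\<Sum>i\<le>n. (cmod (u i))\<^sup>2) + (\<Sum>i\<le>n. (cmod (v i))\<^sup>2))"
      using N(4) by (simp only: mult_le_cancel_left_pos of_nat_0_less_iff)
    also have "\<dots> \<le> C / 2 * ((norm x)\<^sup>2 + (norm w)\<^sup>2)"
    proof (intro mult_left_mono add_mono)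
      have "(\<Sum>i\<le>n. (cmod (ell2_nth x i))\<^sup>2) \<le> (norm x)\<^sup>2" for x
        unfolding norm_sq_ell2 by (intro sum_le_suminf summable_ell2) auto
      then show "(\<Sum>i\<le>n. (cmod (u i))\<^sup>2) \<le> (norm x)\<^sup>2" "(\<Sum>i\<le>n. (cmod (v i))\<^sup>2) \<le> (norm w)\<^sup>2"
        by (simp_all only: u_def v_def)
    qed (use C(1) in simp)
    finally show ?thesis unfolding inner .
  qed
  have "(\<lambda>n. cinner (cop_apply (proj_P n) w) (cop_apply y (cop_apply (proj_P n) x)))
      \<longlonglongrightarrow> cinner w (cop_apply y x)"
    by (intro tendsto_cinner tendsto_cop_apply tendsto_const proj_P_tendsto)
  from LIMSEQ_le_const2[OF tendsto_norm[OF this]] bound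
  show "cmod (cinner w (cop_apply y x)) \<le> C / 2 * ((norm x)\<^sup>2 + (norm w)\<^sup>2)" by blast
qed

lemma closure_Z_subset: "closure (lin_combs two_sided_power) \<subseteq> toeplitz_algebra"
  by (rule closure_minimal[OF Z_subset T_closed(1)])

lemma closure_Z_norm_le:
  assumes y: "y \<in> closure (lin_combs two_sided_power)" and C: "0 \<le> C" "\<And>z. cmod (\<psi> y z) \<le> C"
  shows "norm y \<le> C"
proof -
  obtain X where X: "\<And>k. X k \<in> lin_combs two_sided_power" "X \<longlonglongrightarrow> y"
    using y unfolding closure_sequential by blast
  have yT: "y \<in> toeplitz_algebra" "X k \<in> toeplitz_algebra" for k
    using y X closure_Z_subset Z_subset by auto
  have "norm (X k) \<le> C + norm (X k - y)" for k
  proof (rule Z_norm_le[OF X(1)])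
    fix z
    have "\<psi> (X k) z = \<psi> y z + \<psi> (X k - y) z"
      by (simp add: \<psi>_pointwise yT)
    also have "cmod \<dots> \<le> cmod (\<psi> y z) + cmod (\<psi> (X k - y) z)"
      by (rule norm_triangle_ineq)
    also have "\<dots> \<le> C + norm (X k - y)"
      by (intro add_mono C star_hom_fun_norm_le[OF T \<psi>(1)] T_closed yT)
    finally show "cmod (\<psi> (X k) z) \<le> C + norm (X k - y)" .
  qed (use C(1) in simp)
  moreover have "(\<lambda>k. C + norm (X k - y)) \<longlonglongrightarrow> C + norm (y - y)"
    by (intro tendsto_intros X(2))
  ultimately show ?thesis
    using LIMSEQ_le[OF tendsto_norm[OF X(2)], of "\<lambda>k. C + norm (X k - y)" "C + norm (y - y)"] by auto
qed

text \<open>Adding a compact operator leaves the symbol unchanged and the symbol is bounded by the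
  norm; with \<open>Z_norm_le\<close> this gives the estimate that
  \<open>closed_sum_decomposition\<close> asks for.\<close>

lemma toeplitz_decomposition:
  assumes x: "x \<in> toeplitz_algebra"
  shows "\<exists>y\<in>closure (lin_combs two_sided_power). \<exists>k\<in>compact_operators. x = y + k"
proof -
  have le: "norm y \<le> norm (y + k)" if "y \<in> lin_combs two_sided_power" "k \<in> compact_operators" for y k
  proof (rule Z_norm_le[OF that(1) norm_ge_zero])
    fix z
    have yk: "y \<in> toeplitz_algebra" "k \<in> toeplitz_algebra"
      using that Z_subset compact_subset_toeplitz by auto
    then have "\<psi> y z = \<psi> (y + k) z"
      using \<psi>_compact[OF that(2)] by (simp add: \<psi>_pointwise)
    then show "cmod (\<psi> y z) \<le> norm (y + k)"
      using star_hom_fun_norm_le[OF T \<psi>(1) T_closed(3)[OF yk], of z] by simp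
  qed
  have mem: "x \<in> closure {y + k |y k. y \<in> lin_combs two_sided_power \<and> k \<in> compact_operators}"
    using x toeplitz_dense_mod_compact by blast
  have "\<exists>y\<in>closure (lin_combs two_sided_power). \<exists>k\<in>closure compact_operators. x = y + k"
  proof (rule closed_sum_decomposition[OF _ _ le mem])
    show "y - z \<in> lin_combs two_sided_power"
      if "y \<in> lin_combs two_sided_power" "z \<in> lin_combs two_sided_power" for y z
      using that by (rule lin_combs_diff)
    show "y - z \<in> compact_operators" if "y \<in> compact_operators" "z \<in> compact_operators" for y z :: "ell2 cop"
      using compact_operators_linear(1)[OF that(1) compact_operators_linear(2)[OF that(2), of "-1"]]
      by (simp add: scaleC_minus1)
  qed
  moreover have "closed (compact_operators :: ell2 cop set)"
    unfolding closed_sequential_limits using compact_operators_limit by blast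
  ultimately show ?thesis by simp
qed

lemma \<psi>_kernel: "hom_kernel toeplitz_algebra \<psi> = compact_operators"
proof (intro equalityI subsetI)
  fix x assume "x \<in> hom_kernel toeplitz_algebra \<psi>"
  then have x: "x \<in> toeplitz_algebra" "\<psi> x = 0" by (auto simp: hom_kernel_def)
  obtain y k where yk: "y \<in> closure (lin_combs two_sided_power)" "k \<in> compact_operators" "x = y + k"
    using toeplitz_decomposition[OF x(1)] by blast
  have "y \<in> toeplitz_algebra" "k \<in> toeplitz_algebra"
    using yk closure_Z_subset compact_subset_toeplitz by auto
  then have "\<psi> y z = 0" for z
    using \<psi>_pointwise(1)[of y k z] \<psi>_compact[OF yk(2)] x(2) yk(3) by (simp add: zero_fun_def)
  then have "norm y \<le> 0" by (intro closure_Z_norm_le[OF yk(1)]) simp_all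
  with yk show "x \<in> compact_operators" by simp
next
  fix x assume "x \<in> (compact_operators :: ell2 cop set)"
  then show "x \<in> hom_kernel toeplitz_algebra \<psi>"
    using compact_subset_toeplitz \<psi>_compact[of x] by (auto simp: hom_kernel_def fun_eq_iff zero_fun_def)
qed

lemma \<psi>_real_polynomial:
  assumes "real_polynomial_function p"
  shows "\<exists>t\<in>toeplitz_algebra. \<forall>z\<in>sphere 0 1. \<psi> t z = complex_of_real (p z)"
  using assms
proof induction
  case (linear f)
  interpret f: bounded_linear f by fact
  \<comment> \<open>A real-linear functional is z -> f(1) Re z + f(\<i>) Im z, and on the circle the
    real and imaginary parts of z are the symbols of combinations of the shift and its
    adjoint.\<close>
  define t where "t = (complex_of_real (f 1) / 2) *\<^sub>C (shift + star shift)
    + (complex_of_real (f \<i>) / (2 * \<i>)) *\<^sub>C (shift - star shift)"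
  have "\<psi> t z = complex_of_real (f z)" if z: "z \<in> sphere 0 1" for z
  proof -
    have "z = Re z *\<^sub>R 1 + Im z *\<^sub>R \<i>"
      by (simp add: complex_eq_iff)
    then have "f z = f (Re z *\<^sub>R 1 + Im z *\<^sub>R \<i>)"
      by (rule arg_cong)
    also have "\<dots> = Re z * f 1 + Im z * f \<i>"
      by (simp only: f.add f.scaleR real_scaleR_def)
    finally have fz: "f z = Re z * f 1 + Im z * f \<i>" .
    have "\<psi> t z = complex_of_real (f 1) / 2 * (z + cnj z) + complex_of_real (f \<i>) / (2 * \<i>) * (z - cnj z)"
      by (simp only: t_def \<psi>_pointwise T_closed \<psi>_shift[OF z])
    also have "\<dots> = complex_of_real (f z)"
      unfolding fz complex_add_cnj complex_diff_cnj by (simp add: field_simps)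
    finally show ?thesis .
  qed
  moreover have "t \<in> toeplitz_algebra" by (simp add: t_def T_closed)
  ultimately show ?case by blast
next
  case (const c)
  show ?case
    by (intro bexI[of _ "complex_of_real c *\<^sub>C 1"] ballI)
      (simp_all only: \<psi>_pointwise T_closed \<psi>_one mult_1_right)
next
  case (add p p')
  then obtain t t' where "t \<in> toeplitz_algebra" "t' \<in> toeplitz_algebra"
    "\<forall>z\<in>sphere 0 1. \<psi> t z = complex_of_real (p z)" "\<forall>z\<in>sphere 0 1. \<psi> t' z = complex_of_real (p' z)"
    by blast
  then show ?case
    by (intro bexI[of _ "t + t'"]) (simp_all add: \<psi>_pointwise T_closed)
next
  case (mult p p')
  then obtain t t' where "t \<in> toeplitz_algebra" "t' \<in> toeplitz_algebra"
    "\<forall>z\<in>sphere 0 1. \<psi> t z = complex_of_real (p z)" "\<forall>z\<in>sphere 0 1. \<psi> t' z = complex_of_real (p' z)"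
    by blast
  then show ?case
    by (intro bexI[of _ "t * t'"]) (simp_all add: \<psi>_pointwise T_closed)
qed

lemma \<psi>_approximates:
  assumes f: "f \<in> C_circle" and \<epsilon>: "\<epsilon> > 0"
  shows "\<exists>y\<in>lin_combs two_sided_power. \<forall>z. cmod (f z - \<psi> y z) \<le> \<epsilon>"
proof -
  obtain h where h: "polynomial_function h" "\<And>z. z \<in> sphere 0 1 \<Longrightarrow> norm (f z - h z) < \<epsilon> / 2"
    using Stone_Weierstrass_polynomial_function[of "sphere 0 1" f "\<epsilon> / 2"] f \<epsilon>
    by (auto simp: C_circle_def)
  have "real_polynomial_function (Re \<circ> h)" "real_polynomial_function (Im \<circ> h)"
    using h(1) bounded_linear_Re bounded_linear_Im unfolding polynomial_function_def by blast+
  then obtain t1 t2 where t: "t1 \<in> toeplitz_algebra" "t2 \<in> toeplitz_algebra"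
    "\<forall>z\<in>sphere 0 1. \<psi> t1 z = complex_of_real (Re (h z))"
    "\<forall>z\<in>sphere 0 1. \<psi> t2 z = complex_of_real (Im (h z))"
    using \<psi>_real_polynomial[of "Re \<circ> h"] \<psi>_real_polynomial[of "Im \<circ> h"] by (auto simp: o_def)
  define t where "t = t1 + \<i> *\<^sub>C t2"
  have tT: "t \<in> toeplitz_algebra" by (simp add: t_def T_closed t)
  have th: "\<psi> t z = h z" if "z \<in> sphere 0 1" for z
    using t that by (simp add: t_def \<psi>_pointwise T_closed complex_eq_iff)
  \<comment> \<open>Dropping the compact part keeps the symbol and leads into the closure of the
    two-sided powers, where the symbol controls the norm.\<close>
  obtain y k where yk: "y \<in> closure (lin_combs two_sided_power)" "k \<in> compact_operators" "t = y + k"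
    using toeplitz_decomposition[OF tT] by blast
  have yT: "y \<in> toeplitz_algebra" "k \<in> toeplitz_algebra"
    using yk closure_Z_subset compact_subset_toeplitz by auto
  have \<psi>y: "\<psi> y z = \<psi> t z" for z
    using yT \<psi>_compact[OF yk(2)] by (simp add: yk(3) \<psi>_pointwise)
  have fy: "cmod (f z - \<psi> y z) \<le> \<epsilon> / 2" for z
  proof (cases "z \<in> sphere 0 1")
    case True
    then show ?thesis using h(2)[OF True] by (simp add: \<psi>y th)
  next
    case False
    then show ?thesis using f \<epsilon> \<psi>_outside[OF yT(1) False] by (simp add: C_circle_def)
  qed
  obtain x where x: "x \<in> lin_combs two_sided_power" "dist x y < \<epsilon> / 2"
    using yk(1) half_gt_zero[OF \<epsilon>] unfolding closure_approachable by blast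
  then have xT: "x \<in> toeplitz_algebra" using Z_subset by blast
  have "cmod (f z - \<psi> x z) \<le> \<epsilon>" for z
  proof -
    have eq: "f z - \<psi> x z = (f z - \<psi> y z) - \<psi> (x - y) z"
      by (simp add: \<psi>_pointwise xT yT)
    have "cmod (\<psi> (x - y) z) \<le> norm (x - y)"
      by (intro star_hom_fun_norm_le[OF T \<psi>(1)] T_closed xT yT)
    then show ?thesis
      unfolding eq using fy[of z] x(2)[unfolded dist_norm]
        norm_triangle_ineq4[of "f z - \<psi> y z" "\<psi> (x - y) z"] by linarith
  qed
  with x(1) show ?thesis by blast
qed

lemma \<psi>_surj: "\<psi> ` toeplitz_algebra = C_circle"
proof
  show "\<psi> ` toeplitz_algebra \<subseteq> C_circle" using star_homD(1)[OF \<psi>(1)] by blast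
  show "C_circle \<subseteq> \<psi> ` toeplitz_algebra"
  proof
    fix f assume f: "f \<in> C_circle"
    let ?Z = "lin_combs two_sided_power"
    have "\<exists>l\<in>closure ?Z. \<forall>\<epsilon>>0. \<exists>y\<in>?Z. (\<forall>z. cmod (f z - \<psi> y z) \<le> \<epsilon>) \<and> norm (l - y) \<le> \<epsilon>"
    proof (rule approximation_limit)
      show "\<exists>y\<in>?Z. \<forall>z. cmod (f z - \<psi> y z) \<le> \<epsilon>" if "\<epsilon> > 0" for \<epsilon>
        by (rule \<psi>_approximates[OF f that])
      fix x y \<delta> \<epsilon>
      assume xy: "x \<in> ?Z" "y \<in> ?Z"
        and *: "\<forall>z. cmod (f z - \<psi> x z) \<le> \<delta>" "\<forall>z. cmod (f z - \<psi> y z) \<le> \<epsilon>"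
      show "norm (x - y) \<le> \<delta> + \<epsilon>"
      proof (rule Z_norm_le[OF lin_combs_diff[OF xy]])
        show "0 \<le> \<delta> + \<epsilon>"
          using *[rule_format, of 0] norm_ge_zero[of "f 0 - \<psi> x 0"] norm_ge_zero[of "f 0 - \<psi> y 0"]
          by linarith
        fix z
        have "\<psi> (x - y) z = (f z - \<psi> y z) - (f z - \<psi> x z)"
          using xy Z_subset by (simp add: \<psi>_pointwise subset_iff)
        then show "cmod (\<psi> (x - y) z) \<le> \<delta> + \<epsilon>"
          using *[rule_format, of z] norm_triangle_ineq4[of "f z - \<psi> y z" "f z - \<psi> x z"] by simp
      qed
    qed
    then obtain l where l: "l \<in> closure ?Z"
      "\<And>\<epsilon>. \<epsilon> > 0 \<Longrightarrow> \<exists>y\<in>?Z. (\<forall>z. cmod (f z - \<psi> y z) \<le> \<epsilon>) \<and> norm (l - y) \<le> \<epsilon>"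
      by blast
    have lT: "l \<in> toeplitz_algebra" using l(1) closure_Z_subset by blast
    have "cmod (\<psi> l z - f z) \<le> 0" for z
    proof (rule field_le_epsilon)
      fix \<epsilon> :: real
      assume "\<epsilon> > 0"
      then obtain y where y: "y \<in> ?Z" "cmod (f z - \<psi> y z) \<le> \<epsilon> / 2" "norm (l - y) \<le> \<epsilon> / 2"
        using l(2)[of "\<epsilon> / 2"] by auto
      then have yT: "y \<in> toeplitz_algebra" using Z_subset by blast
      have eq: "\<psi> l z - f z = \<psi> (l - y) z - (f z - \<psi> y z)"
        by (simp add: \<psi>_pointwise lT yT)
      have "cmod (\<psi> (l - y) z) \<le> norm (l - y)"
        by (intro star_hom_fun_norm_le[OF T \<psi>(1)] T_closed lT yT)
      then show "cmod (\<psi> l z - f z) \<le> 0 + \<epsilon>"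
        unfolding eq using y(2,3) norm_triangle_ineq4[of "\<psi> (l - y) z" "f z - \<psi> y z"] by linarith
    qed
    then have "\<psi> l = f" by (intro ext) simp
    with lT show "f \<in> \<psi> ` toeplitz_algebra" by blast
  qed
qed

lemma toeplitz_exact: "short_exact compact_operators toeplitz_algebra C_circle id \<psi>"
  using \<psi>(1) \<psi>_kernel \<psi>_surj compact_subset_toeplitz
  by (auto simp: short_exact_def star_hom_def)

end

text \<open>Composition with the reflection z -> cnj z of the circle yields a symbol map that sends
  the shift to z, with the same kernel.\<close>

lemma toeplitz_exact_cnj:
  assumes \<psi>: "star_hom toeplitz_algebra C_circle \<psi>" "\<psi> shift = circle_fun cnj"
  shows "short_exact compact_operators toeplitz_algebra C_circle id \<psi>"
proof -
  define \<psi>' where "\<psi>' t z = \<psi> t (cnj z)" for t z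
  have flip: "(\<lambda>z. f (cnj z)) \<in> C_circle" if "f \<in> C_circle" for f
    using that
    by (auto simp: C_circle_def intro!: continuous_on_compose2[of "sphere 0 1" f _ cnj] continuous_intros)
  have "star_hom toeplitz_algebra C_circle \<psi>'"
    using \<psi>(1) flip
    by (auto simp: star_hom_def \<psi>'_def[abs_def] fun_eq_iff scaleC_fun_def star_fun_def plus_fun_def times_fun_def)
  moreover have "\<psi>' shift = circle_fun (\<lambda>z. z)"
    by (auto simp: \<psi>'_def \<psi>(2) circle_fun_def fun_eq_iff)
  ultimately interpret S: circle_symbol \<psi>'
    by unfold_locales
  have "hom_kernel toeplitz_algebra \<psi> = hom_kernel toeplitz_algebra \<psi>'"
    unfolding hom_kernel_def \<psi>'_def by (auto simp: fun_eq_iff) (metis complex_cnj_cnj)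
  moreover have "\<psi> ` toeplitz_algebra = C_circle"
  proof
    show "\<psi> ` toeplitz_algebra \<subseteq> C_circle" using star_homD(1)[OF \<psi>(1)] by blast
    show "C_circle \<subseteq> \<psi> ` toeplitz_algebra"
    proof
      fix f assume "f \<in> C_circle"
      then obtain t where t: "t \<in> toeplitz_algebra" "\<psi>' t = (\<lambda>z. f (cnj z))"
        using flip[of f] S.\<psi>_surj by (metis imageE)
      have "\<psi> t z = f z" for z
        using fun_cong[OF t(2), of "cnj z"] by (simp add: \<psi>'_def)
      then have "\<psi> t = f" by (rule ext)
      with t(1) show "f \<in> \<psi> ` toeplitz_algebra" by blast
    qed
  qed
  ultimately show ?thesis
    using S.toeplitz_exact \<psi>(1) by (simp add: short_exact_def)
qed

section \<open>Covariant representations\<close>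

lemma tau_nth: "tau k a i = (if i < k then 0 else a (i - k))"
  by (induction k arbitrary: i) (auto simp: tau_def tau1_def split: nat.split)

lemma conv_seqs_closed:
  "a \<in> conv_seqs \<Longrightarrow> b \<in> conv_seqs \<Longrightarrow> a + b \<in> conv_seqs"
  "a \<in> conv_seqs \<Longrightarrow> b \<in> conv_seqs \<Longrightarrow> a * b \<in> conv_seqs"
  "a \<in> conv_seqs \<Longrightarrow> c *\<^sub>C a \<in> conv_seqs" "a \<in> conv_seqs \<Longrightarrow> star a \<in> conv_seqs"
  by (auto simp: conv_seqs_def convergent_def plus_fun_def times_fun_def scaleC_fun_def scaleC_complex_def
      star_fun_def star_complex_def intro: tendsto_add tendsto_mult tendsto_mult_left tendsto_cnj)

lemma eventually_const_conv_seqs: "(\<And>i. i \<ge> N \<Longrightarrow> a i = L) \<Longrightarrow> a \<in> conv_seqs"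
  unfolding conv_seqs_def convergent_def
  by (intro CollectI exI[of _ L] tendsto_eventually) (auto simp: eventually_sequentially)

lemma const_conv_seqs: "(\<lambda>_. c) \<in> conv_seqs"
  by (rule eventually_const_conv_seqs[of 0]) simp

lemma tau_one_conv_seqs: "tau k (\<lambda>_. 1) \<in> conv_seqs"
  by (rule eventually_const_conv_seqs[of k _ 1]) (simp add: tau_nth)

lemma sqrt_conv_seqs:
  assumes "a \<in> conv_seqs"
  shows "(\<lambda>i. complex_of_real (sqrt (M\<^sup>2 - (cmod (a i))\<^sup>2))) \<in> conv_seqs"
proof -
  obtain L where "a \<longlonglongrightarrow> L" using assms by (auto simp: conv_seqs_def convergent_def)
  then have "(\<lambda>i. complex_of_real (sqrt (M\<^sup>2 - (cmod (a i))\<^sup>2)))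
      \<longlonglongrightarrow> complex_of_real (sqrt (M\<^sup>2 - (cmod L)\<^sup>2))"
    by (intro tendsto_intros)
  then show ?thesis unfolding conv_seqs_def convergent_def by blast
qed

locale covariant =
  fixes \<rho> :: "(nat \<Rightarrow> complex) \<Rightarrow> 'h::complex_hilbert cop" and V :: "nat \<Rightarrow> 'h cop"
  assumes cov: "covariant_rep \<rho> V"
begin

lemma \<rho>: "star_hom conv_seqs UNIV \<rho>"
  using cov by (simp add: covariant_rep_def nondegenerate_rep_def)

lemma V_pi: "V n * star (V n) * V n = V n"
  using cov by (simp add: covariant_rep_def partial_isometry_def)

lemma V_add: "V m * V n = V (m + n)"
  using cov by (simp add: covariant_rep_def)

lemma \<rho>_tau: "a \<in> conv_seqs \<Longrightarrow> \<rho> (tau n a) = V n * \<rho> a * star (V n)"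
  using cov by (simp add: covariant_rep_def)

lemma V_comm: "a \<in> conv_seqs \<Longrightarrow> star (V n) * V n * \<rho> a = \<rho> a * (star (V n) * V n)"
  using cov by (simp add: covariant_rep_def)

text \<open>The image of the constant 1 fixes all vectors \<open>\<rho> a h\<close>; nondegeneracy
  makes these span a dense subspace.\<close>

lemma \<rho>_one: "\<rho> (\<lambda>_. 1) = 1"
proof -
  let ?E = "\<rho> (\<lambda>_. 1)" and ?S = "{cop_apply (\<rho> a) h |a h. a \<in> conv_seqs}"
  let ?F = "{x. cop_apply ?E x = x}"
  have "?S \<subseteq> ?F"
  proof clarify
    fix a h assume a: "a \<in> conv_seqs"
    have "?E * \<rho> a = \<rho> ((\<lambda>_. 1) * a)"
      using star_homD(3)[OF \<rho> const_conv_seqs a] by simp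
    also have "(\<lambda>_. 1) * a = a" by (simp add: times_fun_def)
    finally show "cop_apply ?E (cop_apply (\<rho> a) h) = cop_apply (\<rho> a) h"
      by (simp flip: cop_apply_mult)
  qed
  moreover have "subspace ?F"
    by (auto simp: subspace_def cop_apply_zero_right cop_apply_add_right
        bounded_bilinear.scaleR_right[OF bounded_bilinear_cop_apply])
  ultimately have "span ?S \<subseteq> ?F" by (rule span_minimal)
  moreover have "closed ?F"
    by (intro closed_Collect_eq linear_continuous_on bounded_linear_cop_apply continuous_on_id)
  ultimately have "closure (span ?S) \<subseteq> ?F" by (rule closure_minimal)
  moreover have "closure (span ?S) = UNIV"
    using cov by (simp add: covariant_rep_def nondegenerate_rep_def)
  ultimately show ?thesis
    by (intro cop_eqI) (auto simp: one_cop.rep_eq)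
qed

text \<open>Covariance at 0 shows that \<open>V 0\<close> is a coisometry, and the semigroup law
  that it is idempotent.\<close>

lemma V_zero: "V 0 = 1"
proof -
  have "tau 0 (\<lambda>_. 1) = (\<lambda>_. 1)" by (simp add: tau_def)
  then have 1: "V 0 * star (V 0) = 1"
    using \<rho>_tau[OF const_conv_seqs[of 1], of 0] by (simp add: \<rho>_one)
  have "V 0 = V 0 * (V 0 * star (V 0))" by (simp add: 1)
  also have "\<dots> = V 0 * V 0 * star (V 0)" by (simp add: mult.assoc)
  also have "\<dots> = 1" using V_add[of 0 0] 1 by simp
  finally show ?thesis .
qed

lemma V_power: "V n = V 1 ^ n"
proof (induction n)
  case (Suc n)
  then show ?case using V_add[of 1 n] by simp
qed (simp add: V_zero)

lemma \<rho>_tau_one: "\<rho> (tau k (\<lambda>_. 1)) = V 1 ^ k * star (V 1) ^ k"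
  using \<rho>_tau[OF const_conv_seqs[of 1], of k] by (simp add: \<rho>_one V_power[of k] star_power)

lemma power_pi: "V 1 ^ n * star (V 1) ^ n * V 1 ^ n = V 1 ^ n"
  using V_pi[of n] by (simp add: V_power[of n] star_power)

text \<open>The range projections of the powers are images under \<open>\<rho>\<close> of shifted
  constants, so the second covariance condition applies to them.\<close>

lemma projections_commute:
  "(V 1 ^ k * star (V 1) ^ k) * (star (V 1) ^ n * V 1 ^ n)
    = (star (V 1) ^ n * V 1 ^ n) * (V 1 ^ k * star (V 1) ^ k)"
  using V_comm[OF tau_one_conv_seqs, of n k] by (simp add: \<rho>_tau_one V_power[of n] star_power)

lemma \<rho>_diff: "a \<in> conv_seqs \<Longrightarrow> b \<in> conv_seqs \<Longrightarrow> \<rho> (a - b) = \<rho> a - \<rho> b"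
proof -
  assume ab: "a \<in> conv_seqs" "b \<in> conv_seqs"
  have eq: "a - b = a + (-1) *\<^sub>C b" by (simp add: scaleC_minus1)
  have "\<rho> (a - b) = \<rho> a + (-1) *\<^sub>C \<rho> b"
    unfolding eq using ab by (simp only: star_homD[OF \<rho>] conv_seqs_closed)
  then show ?thesis by (simp add: scaleC_minus1)
qed

text \<open>With \<open>b = (M\<^sup>2 - |a|\<^sup>2)\<^sup>1\<^sup>/\<^sup>2\<close> one has \<open>\<rho>(a)\<^sup>* \<rho>(a) + \<rho>(b)\<^sup>* \<rho>(b) = M\<^sup>2\<close>.\<close>

lemma norm_\<rho>_le:
  assumes a: "a \<in> conv_seqs" and M: "\<And>i. cmod (a i) \<le> M"
  shows "norm (\<rho> a) \<le> M"
proof (rule norm_cop_bound)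
  show M0: "0 \<le> M" using order_trans[OF norm_ge_zero M] .
  fix x
  define b where "b = (\<lambda>i. complex_of_real (sqrt (M\<^sup>2 - (cmod (a i))\<^sup>2)))"
  have b: "b \<in> conv_seqs" unfolding b_def by (rule sqrt_conv_seqs[OF a])
  have "star a * a + star b * b = complex_of_real (M\<^sup>2) *\<^sub>C (\<lambda>_. 1)"
  proof
    fix i
    have "(cmod (a i))\<^sup>2 \<le> M\<^sup>2" using M[of i] by (intro power_mono) simp_all
    then have "b i * b i = complex_of_real (M\<^sup>2 - (cmod (a i))\<^sup>2)"
      by (simp add: b_def flip: of_real_mult)
    moreover have "cnj (b i) = b i" by (simp add: b_def)
    ultimately show "(star a * a + star b * b) i = (complex_of_real (M\<^sup>2) *\<^sub>C (\<lambda>_. 1)) i"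
      using complex_norm_square[of "a i"]
      by (simp add: plus_fun_def times_fun_def star_fun_def star_complex_def scaleC_fun_def
          scaleC_complex_def mult.commute)
  qed
  from arg_cong[OF this, of \<rho>]
  have eq: "star (\<rho> a) * \<rho> a + star (\<rho> b) * \<rho> b = complex_of_real (M\<^sup>2) *\<^sub>C 1"
    by (simp only: star_homD[OF \<rho>] a b conv_seqs_closed const_conv_seqs \<rho>_one)
  have "(norm (cop_apply (\<rho> a) x))\<^sup>2 + (norm (cop_apply (\<rho> b) x))\<^sup>2
      = Re (cinner x (cop_apply (star (\<rho> a) * \<rho> a + star (\<rho> b) * \<rho> b) x))"
    by (simp add: cop_apply_simps cinner_add_right cinner_star_right norm_sq_cinner)
  also have "\<dots> = (M * norm x)\<^sup>2"
    unfolding eq by (simp add: cop_apply_simps cinner_scaleC_right cinner_self power_mult_distrib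
        flip: of_real_power of_real_mult)
  finally have "(norm (cop_apply (\<rho> a) x))\<^sup>2 \<le> (M * norm x)\<^sup>2"
    using zero_le_power2[of "norm (cop_apply (\<rho> b) x)"] by linarith
  then show "norm (cop_apply (\<rho> a) x) \<le> M * norm x"
    by (rule power2_le_imp_le) (simp add: M0)
qed

lemma eventually_const_in_generated:
  assumes "\<And>i. i \<ge> N \<Longrightarrow> a i = L"
  shows "\<rho> a \<in> cstar_generated {1, V 1}"
  using assms
proof (induction N arbitrary: a)
  note G = cstar_subalgebra_generated[of "{1, V 1}"]
  have G1: "1 \<in> cstar_generated {1, V 1}" "V 1 \<in> cstar_generated {1, V 1}"
    using cstar_generated_superset by blast+
  {
    case 0
    then have "a = L *\<^sub>C (\<lambda>_. 1)" by (auto simp: scaleC_fun_def scaleC_complex_def)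
    then have "\<rho> a = L *\<^sub>C 1"
      by (simp only: star_homD(4)[OF \<rho> const_conv_seqs] \<rho>_one)
    then show ?case by (simp only: cstar_subalgebraD(5)[OF G] G1)
  next
    case (Suc N)
    \<comment> \<open>The indicator sequence of position N, as a difference of two shifted
      constants; its image is a difference of range projections of powers of
      \<open>V 1\<close>.\<close>
    let ?d = "tau N (\<lambda>_. 1) + (-1) *\<^sub>C tau (Suc N) (\<lambda>_. 1)"
    define a' where "a' = a(N := L)"
    have a': "\<rho> a' \<in> cstar_generated {1, V 1}"
      using Suc.prems by (intro Suc.IH) (auto simp: a'_def)
    have conv: "a' \<in> conv_seqs"
      using Suc.prems by (intro eventually_const_conv_seqs[of N _ L]) (auto simp: a'_def)
    have a_eq: "a = a' + (a N - L) *\<^sub>C ?d"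
      using Suc.prems
      by (auto simp: fun_eq_iff a'_def plus_fun_def scaleC_fun_def scaleC_complex_def tau_nth)
    have "\<rho> a = \<rho> (a' + (a N - L) *\<^sub>C ?d)"
      by (rule arg_cong[OF a_eq])
    also have "\<dots> = \<rho> a' + (a N - L) *\<^sub>C (V 1 ^ N * star (V 1) ^ N + (-1) *\<^sub>C (V 1 ^ Suc N * star (V 1) ^ Suc N))"
      by (simp only: star_homD[OF \<rho>] conv conv_seqs_closed tau_one_conv_seqs \<rho>_tau_one)
    finally show ?case
      using a' by (simp only: cstar_subalgebraD(3-6)[OF G] cstar_subalgebra_power[OF G G1(1)] G1)
  }
qed

text \<open>Eventually constant sequences are uniformly dense in the convergent ones and have images
  generated by 1 and \<open>V 1\<close>. This presents the crossed product as the unital C*-algebra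
  of one power partial isometry.\<close>

lemma covariant_algebra_eq: "covariant_algebra \<rho> V = cstar_generated {1, V 1}"
  unfolding covariant_algebra_def
proof (intro equalityI cstar_generated_minimal cstar_subalgebra_generated)
  note G = cstar_subalgebra_generated[of "{1, V 1}"]
  have G1: "1 \<in> cstar_generated {1, V 1}" "V 1 \<in> cstar_generated {1, V 1}"
    using cstar_generated_superset by blast+
  have "\<rho> a \<in> cstar_generated {1, V 1}" if a: "a \<in> conv_seqs" for a
  proof -
    obtain L where L: "a \<longlonglongrightarrow> L" using a by (auto simp: conv_seqs_def convergent_def)
    have "\<exists>b\<in>cstar_generated {1, V 1}. dist b (\<rho> a) < \<epsilon>" if \<epsilon>: "\<epsilon> > 0" for \<epsilon>
    proof -
      from LIMSEQ_D[OF L half_gt_zero[OF \<epsilon>]] obtain N where N: "\<forall>i\<ge>N. norm (a i - L) < \<epsilon> / 2" ..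
      define b where "b i = (if i < N then a i else L)" for i
      have b: "\<rho> b \<in> cstar_generated {1, V 1}" "b \<in> conv_seqs"
        by (rule eventually_const_in_generated[of N _ L], simp add: b_def)
          (rule eventually_const_conv_seqs[of N _ L], simp add: b_def)
      have "norm (\<rho> (b - a)) \<le> \<epsilon> / 2"
      proof (rule norm_\<rho>_le)
        have "b - a = b + (-1) *\<^sub>C a" by (simp add: scaleC_minus1)
        then show "b - a \<in> conv_seqs" using a b by (simp only: conv_seqs_closed)
        show "cmod ((b - a) i) \<le> \<epsilon> / 2" for i
          using N \<epsilon> by (auto simp: b_def fun_diff_def norm_minus_commute not_less intro: less_imp_le)
      qed
      then have "dist (\<rho> b) (\<rho> a) < \<epsilon>"
        using \<epsilon> by (simp add: dist_norm \<rho>_diff a b)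
      with b(1) show ?thesis by blast
    qed
    then have "\<rho> a \<in> closure (cstar_generated {1, V 1})"
      by (simp add: closure_approachable)
    then show ?thesis by (simp only: closure_closed[OF cstar_subalgebraD(1)[OF G]])
  qed
  moreover have "V n \<in> cstar_generated {1, V 1}" for n
    unfolding V_power[of n] by (intro cstar_subalgebra_power[OF G] G1)
  ultimately show "\<rho> ` conv_seqs \<union> range V \<subseteq> cstar_generated {1, V 1}" by blast
  have "\<rho> (\<lambda>_. 1) \<in> \<rho> ` conv_seqs" using const_conv_seqs by blast
  then show "{1, V 1} \<subseteq> cstar_generated (\<rho> ` conv_seqs \<union> range V)"
    using cstar_generated_superset[of "\<rho> ` conv_seqs \<union> range V"] by (auto simp: \<rho>_one)
qed

end

section \<open>Truncated shifts\<close>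

text \<open>Beyond n the shift part vanishes, so covariance needs a scalar that is 0 for every
  properly shifted sequence; entry 0 is such a scalar, and it keeps the representation
  unital.\<close>

definition truncated_diag :: "nat \<Rightarrow> (nat \<Rightarrow> complex) \<Rightarrow> ell2 cop" where
  "truncated_diag n a = (\<Sum>i\<le>n. a i *\<^sub>C matrix_unit i i) + a 0 *\<^sub>C (1 - proj_P n)"

lemma ell2_nth_truncated_diag:
  "ell2_nth (cop_apply (truncated_diag n a) x) i = (if i \<le> n then a i else a 0) * ell2_nth x i"
  by (simp add: truncated_diag_def cop_apply_simps cop_apply_sum_left ell2_nth_simps ell2_nth_sum
      ell2_nth_matrix_unit ell2_nth_proj_P if_distrib[of "(*) _"] cong: if_cong)

lemma truncated_covariant: "covariant_rep (truncated_diag n) (\<lambda>k. (proj_P n * shift) ^ k)"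
proof -
  let ?W = "proj_P n * shift"
  note nth = cop_apply_mult one_cop.rep_eq ell2_nth_truncated_diag ell2_nth_truncated_shift_power
    ell2_nth_star_truncated_shift_power
  have one: "truncated_diag n (\<lambda>_. 1) = 1"
    by (intro cop_eqI ell2_eqI) (simp add: nth one_cop.rep_eq)
  have "star_hom conv_seqs UNIV (truncated_diag n)"
    unfolding star_hom_def
  proof (intro conjI ballI allI subset_UNIV)
    fix a b c
    show "truncated_diag n (a + b) = truncated_diag n a + truncated_diag n b"
      by (intro cop_eqI ell2_eqI)
        (simp add: nth plus_cop.rep_eq ell2_nth_simps plus_fun_def distrib_right)
    show "truncated_diag n (a * b) = truncated_diag n a * truncated_diag n b"
      by (intro cop_eqI ell2_eqI) (simp add: nth times_fun_def)
    show "truncated_diag n (c *\<^sub>C a) = c *\<^sub>C truncated_diag n a"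
      by (intro cop_eqI ell2_eqI)
        (simp add: nth scaleC_cop.rep_eq ell2_nth_simps scaleC_fun_def scaleC_complex_def)
    have "cop_apply (truncated_diag n a) (ket i) = (if i \<le> n then a i else a 0) *\<^sub>C ket i" for i
      by (rule ell2_eqI) (auto simp: nth ell2_nth_simps ket.rep_eq)
    then show "truncated_diag n (star a) = star (truncated_diag n a)"
      by (intro cop_eqI ell2_eqI)
        (simp add: nth ell2_nth_star cinner_scaleC_left cinner_ket_left star_fun_def star_complex_def)
  qed
  moreover have "{cop_apply (truncated_diag n a) h |a h. a \<in> conv_seqs} = UNIV"
  proof -
    have "h \<in> {cop_apply (truncated_diag n a) h |a h. a \<in> conv_seqs}" for h
      using const_conv_seqs[of 1]
      by (intro CollectI exI[of _ "\<lambda>_. 1"] exI[of _ h]) (simp add: one one_cop.rep_eq)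
    then show ?thesis by blast
  qed
  ultimately have "nondegenerate_rep (truncated_diag n)"
    by (simp add: nondegenerate_rep_def)
  moreover have "partial_isometry (?W ^ k)" for k
    unfolding partial_isometry_def star_power
    by (intro cop_eqI ell2_eqI) (auto simp: nth)
  moreover have "?W ^ k * ?W ^ m = ?W ^ (k + m)" for k m
    by (simp only: power_add)
  moreover have "truncated_diag n (tau k a) = ?W ^ k * truncated_diag n a * star (?W ^ k)" for k a
    unfolding star_power
    by (intro cop_eqI ell2_eqI) (auto simp: nth tau_nth)
  moreover have "star (?W ^ k) * ?W ^ k * truncated_diag n a = truncated_diag n a * (star (?W ^ k) * ?W ^ k)"
    for k a
    unfolding star_power
    by (intro cop_eqI ell2_eqI) (auto simp: nth)
  ultimately show ?thesis
    unfolding covariant_rep_def by blast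
qed

text \<open>The flip \<open>e\<^sub>i \<leftrightarrow> e\<^sub>n\<^sub>-\<^sub>i\<close> interchanges the truncated shift and its adjoint.\<close>

definition flip_op :: "nat \<Rightarrow> ell2 cop" where
  "flip_op n = (\<Sum>i\<le>n. matrix_unit i (n - i)) + (1 - proj_P n)"

lemma ell2_nth_flip_op:
  "ell2_nth (cop_apply (flip_op n) x) i = (if i \<le> n then ell2_nth x (n - i) else ell2_nth x i)"
  by (simp add: flip_op_def cop_apply_simps cop_apply_sum_left ell2_nth_simps ell2_nth_sum
      ell2_nth_matrix_unit ell2_nth_proj_P cong: if_cong)

lemma flip_op_flip_op: "flip_op n * flip_op n = 1"
  by (intro cop_eqI ell2_eqI) (simp add: cop_apply_mult one_cop.rep_eq ell2_nth_flip_op)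

lemma star_flip_op: "star (flip_op n) = flip_op n"
proof (intro cop_eqI ell2_eqI)
  fix x i
  have "cop_apply (flip_op n) (ket i) = ket (if i \<le> n then n - i else i)"
    by (rule ell2_eqI) (auto simp: ell2_nth_flip_op ket.rep_eq)
  then show "ell2_nth (cop_apply (star (flip_op n)) x) i = ell2_nth (cop_apply (flip_op n) x) i"
    by (simp add: ell2_nth_star cinner_ket_left ell2_nth_flip_op)
qed

lemma flip_truncated_shift:
  "flip_op n * star (proj_P n * shift) * flip_op n = proj_P n * shift"
  by (intro cop_eqI ell2_eqI)
    (auto simp: cop_apply_mult[of "_ * _"] cop_apply_mult[of "flip_op n"] ell2_nth_flip_op
      ell2_nth_truncated_shift)

section \<open>The diagram\<close>

lemma hom_kernel_closed:
  assumes f: "star_hom B Z f" and B: "cstar_subalgebra B"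
    and "a \<in> hom_kernel B f" "b \<in> hom_kernel B f"
  shows "a + b \<in> hom_kernel B f" "a * b \<in> hom_kernel B f" "c *\<^sub>C a \<in> hom_kernel B f"
    "star a \<in> hom_kernel B f"
  using assms(3,4)
  by (simp_all add: hom_kernel_def star_homD[OF f] cstar_subalgebraD[OF B] scaleC_zero_right star_zero)

lemma star_iso_inv:
  assumes \<pi>: "star_iso X Y \<pi>"
    and X: "\<And>a b. a \<in> X \<Longrightarrow> b \<in> X \<Longrightarrow> a + b \<in> X" "\<And>a b. a \<in> X \<Longrightarrow> b \<in> X \<Longrightarrow> a * b \<in> X"
      "\<And>a c. a \<in> X \<Longrightarrow> c *\<^sub>C a \<in> X" "\<And>a. a \<in> X \<Longrightarrow> star a \<in> X"
  shows "star_hom Y X (inv_into X \<pi>)"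
proof -
  let ?i = "inv_into X \<pi>"
  have hom: "star_hom X Y \<pi>" and bij: "bij_betw \<pi> X Y" using \<pi> by (auto simp: star_iso_def)
  have iX: "?i y \<in> X" and \<pi>i: "\<pi> (?i y) = y" if "y \<in> Y" for y
    using bij that by (auto simp: bij_betw_def inv_into_into f_inv_into_f)
  have i\<pi>: "?i (\<pi> x) = x" if "x \<in> X" for x
    using bij that by (auto simp: bij_betw_def)
  show ?thesis
    unfolding star_hom_def
  proof (intro conjI ballI allI)
    show "?i ` Y \<subseteq> X" using iX by blast
    fix a b c assume a: "a \<in> Y"
    show "?i (c *\<^sub>C a) = c *\<^sub>C ?i a"
      using i\<pi>[OF X(3)[OF iX[OF a]], of c] by (simp add: star_homD[OF hom] iX \<pi>i a)
    show "?i (star a) = star (?i a)"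
      using i\<pi>[OF X(4)[OF iX[OF a]]] by (simp add: star_homD[OF hom] iX \<pi>i a)
    assume b: "b \<in> Y"
    show "?i (a + b) = ?i a + ?i b"
      using i\<pi>[OF X(1)[OF iX[OF a] iX[OF b]]] by (simp add: star_homD[OF hom] iX \<pi>i a b)
    show "?i (a * b) = ?i a * ?i b"
      using i\<pi>[OF X(2)[OF iX[OF a] iX[OF b]]] by (simp add: star_homD[OF hom] iX \<pi>i a b)
  qed
qed

lemma kernel_short_exact:
  assumes \<phi>: "star_hom B Z \<phi>" "\<phi> ` B = Z" and B: "cstar_subalgebra B"
    and \<pi>: "star_iso (hom_kernel B \<phi>) Y \<pi>"
  shows "star_hom Y (hom_kernel B \<phi>) (inv_into (hom_kernel B \<phi>) \<pi>)"
    "short_exact Y B Z (inv_into (hom_kernel B \<phi>) \<pi>) \<phi>"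
proof -
  let ?i = "inv_into (hom_kernel B \<phi>) \<pi>"
  show hom: "star_hom Y (hom_kernel B \<phi>) ?i"
    by (rule star_iso_inv[OF \<pi>]) (rule hom_kernel_closed[OF \<phi>(1) B]; assumption)+
  have "bij_betw ?i Y (hom_kernel B \<phi>)"
    using \<pi> by (simp add: star_iso_def bij_betw_inv_into)
  moreover have "star_hom Y B ?i"
    using hom unfolding star_hom_def hom_kernel_def by blast
  ultimately show "short_exact Y B Z ?i \<phi>"
    using \<phi> by (simp add: short_exact_def bij_betw_def)
qed

lemma star_hom_compose:
  assumes "star_hom X Y f" "star_hom Y Z g"
  shows "star_hom X Z (\<lambda>x. g (f x))"
  using assms unfolding star_hom_def by (auto simp: image_subset_iff)

lemma cstar_generated_one_star: "cstar_generated {1, star v} = cstar_generated {1, v}"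
proof -
  have "cstar_generated {1, star v} \<subseteq> cstar_generated {1, v}" for v :: "'h::complex_hilbert cop"
    using cstar_generated_superset[of "{1, v}"] cstar_subalgebra_generated[of "{1, v}"]
    by (intro cstar_generated_minimal) (auto intro: cstar_subalgebraD)
  from this[of v] this[of "star v"] show ?thesis by (simp add: star_star)
qed

theorem theorem6p1:
  fixes i_c :: "(nat \<Rightarrow> complex) \<Rightarrow> 'h::complex_hilbert cop"
    and i_N :: "nat \<Rightarrow> 'h cop"
    and B :: "'h cop set"
    and \<phi>\<^sub>T \<phi>\<^sub>T\<^sub>s :: "'h cop \<Rightarrow> ell2 cop"
    and \<psi>\<^sub>T \<psi>\<^sub>T\<^sub>s :: "ell2 cop \<Rightarrow> complex \<Rightarrow> complex"
  assumes universal: "universal_covariant_rep i_c i_N"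
    and B_def: "B = covariant_algebra i_c i_N"
    and phi_T: "star_hom B toeplitz_algebra \<phi>\<^sub>T" "\<phi>\<^sub>T 1 = 1" "\<phi>\<^sub>T (i_N 1) = shift"
    and phi_Ts: "star_hom B toeplitz_algebra \<phi>\<^sub>T\<^sub>s" "\<phi>\<^sub>T\<^sub>s 1 = 1" "\<phi>\<^sub>T\<^sub>s (i_N 1) = star shift"
    and psi_T: "star_hom toeplitz_algebra C_circle \<psi>\<^sub>T" "\<psi>\<^sub>T shift = circle_fun (\<lambda>z. z)"
    and psi_Ts: "star_hom toeplitz_algebra C_circle \<psi>\<^sub>T\<^sub>s" "\<psi>\<^sub>T\<^sub>s shift = circle_fun cnj"
  shows "\<exists>\<pi> \<pi>\<^sub>s \<alpha>.
      star_iso (hom_kernel B \<phi>\<^sub>T\<^sub>s) alg_A \<pi> \<and>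
      star_iso (hom_kernel B \<phi>\<^sub>T) alg_A \<pi>\<^sub>s \<and>
      star_iso alg_A0 alg_A0 \<alpha> \<and>
      (let \<pi>_inv = inv_into (hom_kernel B \<phi>\<^sub>T\<^sub>s) \<pi>;
           \<pi>\<^sub>s_inv = inv_into (hom_kernel B \<phi>\<^sub>T) \<pi>\<^sub>s
       in
        \<comment> \<open>commuting squares\<close>
        (\<forall>f\<in>alg_A0. \<pi>\<^sub>s_inv (\<alpha> f) = \<pi>_inv (id f)) \<and>
        (\<forall>f\<in>alg_A. \<phi>\<^sub>T (\<pi>_inv f) = id (eps_inf f)) \<and>
        (\<forall>f\<in>alg_A. \<phi>\<^sub>T\<^sub>s (\<pi>\<^sub>s_inv f) = id (eps_inf f)) \<and>
        (\<forall>b\<in>B. \<psi>\<^sub>T\<^sub>s (\<phi>\<^sub>T b) = \<psi>\<^sub>T (\<phi>\<^sub>T\<^sub>s b)) \<and>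
        \<comment> \<open>exact rows\<close>
        short_exact alg_A0 alg_A compact_operators id eps_inf \<and>
        short_exact alg_A B toeplitz_algebra \<pi>\<^sub>s_inv \<phi>\<^sub>T \<and>
        short_exact compact_operators toeplitz_algebra C_circle id \<psi>\<^sub>T \<and>
        \<comment> \<open>exact columns\<close>
        short_exact alg_A0 alg_A compact_operators \<alpha> eps_inf \<and>
        short_exact alg_A B toeplitz_algebra \<pi>_inv \<phi>\<^sub>T\<^sub>s \<and>
        short_exact compact_operators toeplitz_algebra C_circle id \<psi>\<^sub>T\<^sub>s)"
proof -
  interpret covariant i_c i_N
    using universal by unfold_locales (simp add: universal_covariant_rep_def)
  define v where "v = i_N 1"
  have BG: "B = cstar_generated {1, v}"
    by (simp only: B_def covariant_algebra_eq v_def)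
  have Bs: "cstar_subalgebra B" and B1: "1 \<in> B" "v \<in> B"
    using cstar_generated_superset[of "{1, v}"] by (auto simp: BG cstar_subalgebra_generated)
  \<comment> \<open>The only use of the factorisation property. Unitality of the factor comes from
    \<open>\<rho>_one\<close>, which identifies 1 with the image of the constant sequence.\<close>
  have "\<exists>\<Lambda>. star_hom B UNIV \<Lambda> \<and> \<Lambda> 1 = 1 \<and> \<Lambda> v = proj_P n * shift" for n
  proof -
    obtain \<Lambda> where \<Lambda>: "star_hom B UNIV \<Lambda>" "\<forall>a\<in>conv_seqs. \<Lambda> (i_c a) = truncated_diag n a"
      "\<forall>k. \<Lambda> (i_N k) = (proj_P n * shift) ^ k"
      using universal truncated_covariant[of n] unfolding universal_covariant_rep_def B_def by blast
    have "\<Lambda> 1 = truncated_diag n (\<lambda>_. 1)"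
      using \<Lambda>(2) const_conv_seqs[of 1] \<rho>_one by force
    also have "\<dots> = 1"
      by (intro cop_eqI ell2_eqI) (simp add: ell2_nth_truncated_diag one_cop.rep_eq)
    finally show ?thesis using \<Lambda>(1) \<Lambda>(3) by (intro exI[of _ \<Lambda>]) (simp add: v_def)
  qed
  then obtain \<Lambda> where \<Lambda>: "\<And>n. star_hom B UNIV (\<Lambda> n)" "\<And>n. \<Lambda> n 1 = 1" "\<And>n. \<Lambda> n v = proj_P n * shift"
    by metis
  \<comment> \<open>Conjugated so that \<open>star v\<close> is sent to the truncated shift, as the
    second instance of the locale demands.\<close>
  define \<Lambda>s where "\<Lambda>s n b = flip_op n * \<Lambda> n b * flip_op n" for n b
  interpret T: toeplitz_extension v B \<phi>\<^sub>T\<^sub>s \<phi>\<^sub>T \<Lambda>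
    by unfold_locales
      (simp_all only: BG power_pi projections_commute v_def phi_T phi_Ts \<Lambda>[unfolded BG v_def]
        phi_T(1)[unfolded BG v_def] phi_Ts(1)[unfolded BG v_def])
  have \<Lambda>s_hom: "star_hom B UNIV (\<Lambda>s n)" for n
    unfolding star_hom_def
  proof (intro conjI ballI allI subset_UNIV)
    fix a b c assume a: "a \<in> B"
    show "\<Lambda>s n (c *\<^sub>C a) = c *\<^sub>C \<Lambda>s n a"
      using a by (simp add: \<Lambda>s_def star_homD[OF \<Lambda>(1)] mult_scaleC_left mult_scaleC_right)
    show "\<Lambda>s n (star a) = star (\<Lambda>s n a)"
      using a by (simp add: \<Lambda>s_def star_homD[OF \<Lambda>(1)] star_mult star_flip_op mult.assoc)
    assume b: "b \<in> B"
    show "\<Lambda>s n (a + b) = \<Lambda>s n a + \<Lambda>s n b"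
      using a b by (simp add: \<Lambda>s_def star_homD[OF \<Lambda>(1)] distrib_left distrib_right)
    have "\<Lambda>s n a * \<Lambda>s n b = flip_op n * \<Lambda> n a * (flip_op n * flip_op n) * \<Lambda> n b * flip_op n"
      by (simp only: \<Lambda>s_def mult.assoc)
    then show "\<Lambda>s n (a * b) = \<Lambda>s n a * \<Lambda>s n b"
      using a b by (simp add: \<Lambda>s_def star_homD[OF \<Lambda>(1)] flip_op_flip_op mult.assoc)
  qed
  interpret Ts: toeplitz_extension "star v" B \<phi>\<^sub>T \<phi>\<^sub>T\<^sub>s \<Lambda>s
  proof
    show "B = cstar_generated {1, star v}"
      by (simp only: BG cstar_generated_one_star)
    show "star v ^ n * star (star v) ^ n * star v ^ n = star v ^ n" for n
      unfolding star_star by (rule T.star_ppi)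
    show "star v ^ k * star (star v) ^ k * (star (star v) ^ n * star v ^ n)
        = star (star v) ^ n * star v ^ n * (star v ^ k * star (star v) ^ k)" for k n
      unfolding star_star by (rule T.comm[symmetric])
    show "\<phi>\<^sub>T (star v) = star shift" "\<phi>\<^sub>T\<^sub>s (star v) = shift"
      using B1 by (simp_all add: star_homD(5)[OF phi_T(1)] star_homD(5)[OF phi_Ts(1)] T.\<phi> T.\<kappa> star_star)
    show "\<Lambda>s n 1 = 1" for n by (simp add: \<Lambda>s_def \<Lambda> flip_op_flip_op)
    show "\<Lambda>s n (star v) = proj_P n * shift" for n
      using B1 by (simp only: \<Lambda>s_def star_homD(5)[OF \<Lambda>(1)] \<Lambda> flip_truncated_shift)
  qed (fact phi_T phi_Ts \<Lambda>s_hom)+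
  let ?K = "hom_kernel B \<phi>\<^sub>T\<^sub>s" and ?Ks = "hom_kernel B \<phi>\<^sub>T"
  let ?i = "inv_into ?K T.\<pi>" and ?is = "inv_into ?Ks Ts.\<pi>"
  define \<alpha> where "\<alpha> f = Ts.\<pi> (?i f)" for f
  have i: "?i f \<in> ?K" "T.\<pi> (?i f) = f" if "f \<in> alg_A" for f
    using T.kernel_iso that by (auto simp: star_iso_def bij_betw_def inv_into_into f_inv_into_f)
  have js: "?is f \<in> ?Ks" "Ts.\<pi> (?is f) = f" if "f \<in> alg_A" for f
    using Ts.kernel_iso that by (auto simp: star_iso_def bij_betw_def inv_into_into f_inv_into_f)
  have i\<pi>: "?i (T.\<pi> b) = b" if "b \<in> ?K" for b
    using T.kernel_iso that by (auto simp: star_iso_def bij_betw_def)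
  have is\<pi>: "?is (Ts.\<pi> b) = b" if "b \<in> ?Ks" for b
    using Ts.kernel_iso that by (auto simp: star_iso_def bij_betw_def)
  have \<pi>A: "T.\<pi> b \<in> alg_A" if "b \<in> ?K" for b
    using T.kernel_iso that by (auto simp: star_iso_def star_hom_def)
  have \<pi>sA: "Ts.\<pi> b \<in> alg_A" if "b \<in> ?Ks" for b
    using Ts.kernel_iso that by (auto simp: star_iso_def star_hom_def)
  have square_K: "\<phi>\<^sub>T (?i f) = eps_inf f" if "f \<in> alg_A" for f
    using T.kernel_limit[OF i(1)[OF that]] i(2)[OF that] by simp
  have square_Ks: "\<phi>\<^sub>T\<^sub>s (?is f) = eps_inf f" if "f \<in> alg_A" for f
    using Ts.kernel_limit[OF js(1)[OF that]] js(2)[OF that] by simp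
  have A0_A: "f \<in> alg_A" "eps_inf f = 0" if "f \<in> alg_A0" for f
    using that by (auto simp: alg_A0_def)
  \<comment> \<open>For a null sequence the limit formula gives \<open>\<phi>\<^sub>T (?i f)\<close>
    = 0, so its preimage lies in both kernels. This is what allows the second isomorphism to be
    applied to it.\<close>
  have i0: "?i f \<in> ?Ks" if "f \<in> alg_A0" for f
    using i(1)[OF A0_A(1)[OF that]] square_K[OF A0_A(1)[OF that]] A0_A(2)[OF that]
    by (simp add: hom_kernel_def)
  have \<alpha>0: "\<alpha> f \<in> alg_A0" if f: "f \<in> alg_A0" for f
  proof -
    have "eps_inf (\<alpha> f) = \<phi>\<^sub>T\<^sub>s (?i f)"
      unfolding \<alpha>_def using Ts.kernel_limit[OF i0[OF f]] by simp
    also have "\<dots> = 0" using i(1)[OF A0_A(1)[OF f]] by (simp add: hom_kernel_def)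
    finally show ?thesis
      using \<pi>sA[OF i0[OF f]] by (simp add: alg_A0_def \<alpha>_def)
  qed
  have i_hom: "star_hom alg_A ?K ?i"
    by (rule kernel_short_exact(1)[OF phi_Ts(1) T.\<phi>_surj Bs T.kernel_iso])
  have "star_hom alg_A0 ?Ks ?i"
    using i_hom A0_A(1) i0 by (auto simp: star_hom_def)
  moreover have "star_hom ?Ks alg_A Ts.\<pi>"
    using Ts.kernel_iso by (simp add: star_iso_def)
  ultimately have "star_hom alg_A0 alg_A \<alpha>"
    unfolding \<alpha>_def[abs_def] by (rule star_hom_compose)
  then have \<alpha>_hom: "star_hom alg_A0 alg_A0 \<alpha>"
    using \<alpha>0 by (auto simp: star_hom_def)
  have is_\<alpha>: "?is (\<alpha> f) = ?i f" if "f \<in> alg_A0" for f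
    unfolding \<alpha>_def by (rule is\<pi>[OF i0[OF that]])
  have \<alpha>_bij: "bij_betw \<alpha> alg_A0 alg_A0"
  proof (rule bij_betwI[of _ _ _ "\<lambda>g. T.\<pi> (?is g)"])
    have is0: "?is g \<in> ?K" if "g \<in> alg_A0" for g
      using js(1)[OF A0_A(1)[OF that]] square_Ks[OF A0_A(1)[OF that]] A0_A(2)[OF that]
      by (simp add: hom_kernel_def)
    show "\<alpha> \<in> alg_A0 \<rightarrow> alg_A0" using \<alpha>0 by blast
    show "(\<lambda>g. T.\<pi> (?is g)) \<in> alg_A0 \<rightarrow> alg_A0"
    proof
      fix g assume g: "g \<in> alg_A0"
      have "eps_inf (T.\<pi> (?is g)) = \<phi>\<^sub>T (?is g)" using T.kernel_limit[OF is0[OF g]] by simp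
      also have "\<dots> = 0" using js(1)[OF A0_A(1)[OF g]] by (simp add: hom_kernel_def)
      finally show "T.\<pi> (?is g) \<in> alg_A0" using \<pi>A[OF is0[OF g]] by (simp add: alg_A0_def)
    qed
    show "T.\<pi> (?is (\<alpha> f)) = f" if "f \<in> alg_A0" for f
      by (simp only: is_\<alpha>[OF that] i(2)[OF A0_A(1)[OF that]])
    show "\<alpha> (T.\<pi> (?is g)) = g" if "g \<in> alg_A0" for g
      by (simp only: \<alpha>_def i\<pi>[OF is0[OF that]] js(2)[OF A0_A(1)[OF that]])
  qed
  \<comment> \<open>Both composites send v to the conjugate coordinate on the circle: one through
    the shift, the other through its adjoint. Agreement on 1 and v extends to \<open>B\<close> by
    continuity.\<close>
  have square_B: "\<psi>\<^sub>T\<^sub>s (\<phi>\<^sub>T b) = \<psi>\<^sub>T (\<phi>\<^sub>T\<^sub>s b)" if b: "b \<in> B" for b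
  proof -
    have f: "star_hom B C_circle (\<lambda>b. \<psi>\<^sub>T\<^sub>s (\<phi>\<^sub>T b))" and g: "star_hom B C_circle (\<lambda>b. \<psi>\<^sub>T (\<phi>\<^sub>T\<^sub>s b))"
      using star_hom_compose[OF phi_T(1) psi_Ts(1)] star_hom_compose[OF phi_Ts(1) psi_T(1)] .
    have star_T: "star shift \<in> toeplitz_algebra"
      by (intro cstar_subalgebraD[OF cstar_subalgebra_toeplitz] shift_in_toeplitz)
    \<comment> \<open>The value at 1 is determined by the value at the shift, through
      \<open>star shift * shift\<close> = 1.\<close>
    have one: "\<psi> 1 = star (\<psi> shift) * \<psi> shift" if "star_hom toeplitz_algebra C_circle \<psi>"
      for \<psi> :: "ell2 cop \<Rightarrow> complex \<Rightarrow> complex"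
      using star_homD(3)[OF that star_T shift_in_toeplitz] star_homD(5)[OF that shift_in_toeplitz]
      by (simp add: star_shift_shift)
    have \<psi>1: "\<psi>\<^sub>T\<^sub>s 1 = \<psi>\<^sub>T 1"
      by (simp add: one[OF psi_T(1)] one[OF psi_Ts(1)] psi_T(2) psi_Ts(2) fun_eq_iff times_fun_def
          star_fun_def star_complex_def circle_fun_def mult.commute)
    have \<psi>v: "\<psi>\<^sub>T\<^sub>s shift = \<psi>\<^sub>T (star shift)"
      by (simp add: star_homD(5)[OF psi_T(1) shift_in_toeplitz] psi_T(2) psi_Ts(2) fun_eq_iff
          star_fun_def star_complex_def circle_fun_def)
    show ?thesis
    proof (rule star_homs_agree[OF f[unfolded BG] g[unfolded BG]])
      show "\<psi>\<^sub>T\<^sub>s (\<phi>\<^sub>T s) = \<psi>\<^sub>T (\<phi>\<^sub>T\<^sub>s s)" if "s \<in> {1, v}" for s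
        using that \<psi>1 \<psi>v by (auto simp: T.\<phi> T.\<kappa>)
      show "b \<in> cstar_generated {1, v}" using b by (simp only: BG)
    next
      fix x l
      assume x: "\<And>n. x n \<in> cstar_generated {1, v}" "l \<in> cstar_generated {1, v}" "x \<longlonglongrightarrow> l"
        and eq: "\<And>n. \<psi>\<^sub>T\<^sub>s (\<phi>\<^sub>T (x n)) = \<psi>\<^sub>T (\<phi>\<^sub>T\<^sub>s (x n))"
      show "\<psi>\<^sub>T\<^sub>s (\<phi>\<^sub>T l) = \<psi>\<^sub>T (\<phi>\<^sub>T\<^sub>s l)"
      proof
        fix z
        have "(\<lambda>n. \<psi>\<^sub>T\<^sub>s (\<phi>\<^sub>T (x n)) z) \<longlonglongrightarrow> \<psi>\<^sub>T\<^sub>s (\<phi>\<^sub>T l) z"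
          by (rule star_hom_fun_tendsto[OF Bs f x[folded BG]])
        moreover have "(\<lambda>n. \<psi>\<^sub>T\<^sub>s (\<phi>\<^sub>T (x n)) z) \<longlonglongrightarrow> \<psi>\<^sub>T (\<phi>\<^sub>T\<^sub>s l) z"
          unfolding eq by (rule star_hom_fun_tendsto[OF Bs g x[folded BG]])
        ultimately show "\<psi>\<^sub>T\<^sub>s (\<phi>\<^sub>T l) z = \<psi>\<^sub>T (\<phi>\<^sub>T\<^sub>s l) z" by (rule LIMSEQ_unique)
      qed
    qed
  qed
  have id0: "star_hom alg_A0 alg_A0 id" "bij_betw id alg_A0 alg_A0"
    by (simp_all add: star_hom_def)
  interpret S: circle_symbol \<psi>\<^sub>T
    using psi_T by unfold_locales
  show ?thesis
    unfolding Let_def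
    using T.kernel_iso Ts.kernel_iso \<alpha>_hom \<alpha>_bij is_\<alpha> square_K square_Ks square_B
      short_exact_eps_inf[OF id0] short_exact_eps_inf[OF \<alpha>_hom \<alpha>_bij]
      kernel_short_exact(2)[OF phi_T(1) Ts.\<phi>_surj Bs Ts.kernel_iso]
      kernel_short_exact(2)[OF phi_Ts(1) T.\<phi>_surj Bs T.kernel_iso]
      S.toeplitz_exact toeplitz_exact_cnj[OF psi_Ts]
    by (intro exI[of _ T.\<pi>] exI[of _ Ts.\<pi>] exI[of _ \<alpha>]) (simp add: star_iso_def)
qed

end
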